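(* Let $d>0$ be a real number. Let $\mathcal{T}_0(d)$ be the set of graph parameters of the form $t(\cdot,H)$, where $H$ is a $[-d,d]$-weighted graph, and let $\mathcal{T}_3(d)$ be the set of graph parameters of the form $t(\cdot,W)$, where $W$ is a $[-d,d]$-graphon. Then $\mathcal{T}_3(d)$ is the closure of $\mathcal{T}_0(d)$ in the space of all graph parameters with the topology of pointwise convergence.
   Context: A multigraph is a finite undirected graph in which multiple edges are allowed and loops are excluded; for distinct nodes $i,j$ of a multigraph $F$, $F_{i,j}$ denotes the number of edges joining $i$ and $j$. A graph parameter is a real-valued function on multigraphs that is invariant under isomorphism. The space of graph parameters carries the topology of pointwise convergence ($f_n\to f$ iff $f_n(F)\to f(F)$ for every multigraph $F$). A weighted graph $H$ is a finite nonempty node set $V(H)$ together with positive real nodeweights $\alpha_i$ ($i\in V(H)$) and real edgeweights $\beta_{ij}=\beta_{ji}$ ($i,j\in V(H)$, $i=j$ allowed). It is a $[-d,d]$-weighted graph if all $\beta_{ij}\in[-d,d]$. For a multigraph $F$, $$\hom(F,H)=\sum_{\varphi:V(F)\to V(H)}\ \prod_{i\in V(F)}\alpha_{\varphi(i)}\prod_{ij\in E(F)}\beta_{\varphi(i)\varphi(j)},\qquad t(F,H)=\frac{\hom(F,H)}{\bigl(\sum_{i}\alpha_i\bigr)^{|V(F)|}},$$ where edges are counted with multiplicity. Let $\mathcal{P}[-d,d]$ be the set of Borel probability measures on $[-d,d]$ with the weak topology. A $[-d,d]$-graphon is a symmetric function $W:[0,1]^2\to\mathcal{P}[-d,d]$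 that is measurable with respect to the Borel sets of $\mathcal{P}[-d,d]$. Put $W_k(x,y)=\int_{[-d,d]} s^k\,dW(x,y)(s)$ for $k\ge 0$ (so $W_0\equiv 1$). For a multigraph $F$ with $V(F)=\{1,\dots,m\}$, $$t(F,W)=\int_{[0,1]^m}\prod_{1\le i<j\le m}W_{F_{i,j}}(x_i,x_j)\,dx_1\cdots dx_m .$$ *)

theory Defs
  imports "HOL-Probability.Probability"
begin

section \<open>Multigraphs and graph parameters\<close>

text \<open>
  Nodes are natural numbers; every finite loopless multigraph is isomorphic to one of these.
  The second component gives the number of edges joining two nodes.
\<close>

typedef multigraph =
  "{(V :: nat set, e :: nat \<Rightarrow> nat \<Rightarrow> nat).
      finite V \<and> (\<forall>i j. e i j = e j i) \<and> (\<forall>i. e i i = 0) \<and> (\<forall>i j. i \<notin> V \<longrightarrow> e i j = 0)}"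
  by (rule exI[of _ "({}, \<lambda>_ _. 0)"]) simp

definition nodes :: "multigraph \<Rightarrow> nat set" where
  "nodes F = fst (Rep_multigraph F)"

definition edge_mult :: "multigraph \<Rightarrow> nat \<Rightarrow> nat \<Rightarrow> nat" where
  "edge_mult F = snd (Rep_multigraph F)"

definition node_pairs :: "multigraph \<Rightarrow> (nat \<times> nat) set" where
  "node_pairs F = {(i, j). i \<in> nodes F \<and> j \<in> nodes F \<and> i < j}"

definition multigraph_iso :: "multigraph \<Rightarrow> multigraph \<Rightarrow> bool" where
  "multigraph_iso F G \<longleftrightarrow>
     (\<exists>\<pi>. bij_betw \<pi> (nodes F) (nodes G) \<and>
          (\<forall>i\<in>nodes F. \<forall>j\<in>nodes F. edge_mult F i j = edge_mult G (\<pi> i) (\<pi> j)))"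

definition graph_parameters :: "(multigraph \<Rightarrow> real) set" where
  "graph_parameters = {f. \<forall>F G. multigraph_iso F G \<longrightarrow> f F = f G}"

text \<open>
  The library topology on a function type is the product topology, that is, the topology
  of pointwise convergence.
\<close>

definition graph_parameter_topology :: "(multigraph \<Rightarrow> real) topology" where
  "graph_parameter_topology = top_of_set graph_parameters"


section \<open>Weighted graphs\<close>

record weighted_graph =
  wnodes :: "nat set"
  nodeweight :: "nat \<Rightarrow> real"
  edgeweight :: "nat \<Rightarrow> nat \<Rightarrow> real"

definition is_weighted_graph :: "real \<Rightarrow> weighted_graph \<Rightarrow> bool" where
  "is_weighted_graph d H \<longleftrightarrow>
     finite (wnodes H) \<and> wnodes H \<noteq> {} \<and>
     (\<forall>i\<in>wnodes H. nodeweight H i > 0) \<and>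
     (\<forall>i\<in>wnodes H. \<forall>j\<in>wnodes H.
        edgeweight H i j = edgeweight H j i \<and> edgeweight H i j \<in> {-d..d})"

definition hom_weighted :: "multigraph \<Rightarrow> weighted_graph \<Rightarrow> real" where
  "hom_weighted F H =
     (\<Sum>\<phi> \<in> nodes F \<rightarrow>\<^sub>E wnodes H.
        (\<Prod>i\<in>nodes F. nodeweight H (\<phi> i)) *
        (\<Prod>(i, j)\<in>node_pairs F. edgeweight H (\<phi> i) (\<phi> j) ^ edge_mult F i j))"

definition t_weighted :: "multigraph \<Rightarrow> weighted_graph \<Rightarrow> real" where
  "t_weighted F H = hom_weighted F H / (\<Sum>i\<in>wnodes H. nodeweight H i) ^ card (nodes F)"

definition T0 :: "real \<Rightarrow> (multigraph \<Rightarrow> real) set" where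
  "T0 d = {(\<lambda>F. t_weighted F H) | H. is_weighted_graph d H}"


section \<open>Graphons with values in probability measures\<close>

definition prob_measures :: "real \<Rightarrow> real measure set" where
  "prob_measures d = {M. prob_space M \<and> sets M = sets (restrict_space borel {-d..d})}"

text \<open>
  The coarsest topology making \<open>M \<mapsto> \<integral>f dM\<close> continuous for every continuous
  (hence bounded) \<open>f\<close> on \<open>[-d, d]\<close>.
\<close>

definition weak_topology :: "real \<Rightarrow> real measure topology" where
  "weak_topology d =
     topology_generated_by
       {{M \<in> prob_measures d. (\<integral>s. f s \<partial>M) \<in> U} | f U.
          continuous_on {-d..d} (f :: real \<Rightarrow> real) \<and> open (U :: real set)}"

lemma topspace_weak_topology: "topspace (weak_topology d) = prob_measures d"
proof -
  have "{M \<in> prob_measures d. (\<integral>s. (0::real) \<partial>M) \<in> UNIV} \<subseteq> topspace (weak_topology d)"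
    unfolding weak_topology_def topology_generated_by_topspace
    by (rule Union_upper, rule CollectI, rule exI[of _ "\<lambda>_. 0"], rule exI[of _ UNIV]) simp
  then show ?thesis
    unfolding weak_topology_def topology_generated_by_topspace by blast
qed

definition borel_prob_measures :: "real \<Rightarrow> real measure measure" where
  "borel_prob_measures d = sigma (prob_measures d) {U. openin (weak_topology d) U}"

text \<open>
  Measurability on the unit square is Lebesgue measurability. Only the values of \<open>W\<close> on the
  unit square matter, and membership of these values in \<open>prob_measures d\<close> is part of
  \<open>\<rightarrow>\<^sub>M\<close>.
\<close>

definition is_graphon :: "real \<Rightarrow> (real \<Rightarrow> real \<Rightarrow> real measure) \<Rightarrow> bool" where
  "is_graphon d W \<longleftrightarrow>
     (\<forall>x\<in>{0..1}. \<forall>y\<in>{0..1}. W x y = W y x) \<and>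
     (\<lambda>(x, y). W x y) \<in> lebesgue_on ({0..1} \<times> {0..1}) \<rightarrow>\<^sub>M borel_prob_measures d"

definition moment :: "nat \<Rightarrow> (real \<Rightarrow> real \<Rightarrow> real measure) \<Rightarrow> real \<Rightarrow> real \<Rightarrow> real" where
  "moment k W x y = (\<integral>s. s ^ k \<partial>W x y)"

text \<open>
  Lebesgue measure on \<open>[0, 1]\<close> to the power \<open>V\<close>. The completion is needed because \<open>W\<close> is only
  Lebesgue measurable, and the Bochner integral of a non-measurable function is \<open>0\<close>.
\<close>

definition lebesgue_cube :: "nat set \<Rightarrow> (nat \<Rightarrow> real) measure" where
  "lebesgue_cube V = completion (\<Pi>\<^sub>M i\<in>V. restrict_space lborel {0..1})"

definition t_graphon :: "multigraph \<Rightarrow> (real \<Rightarrow> real \<Rightarrow> real measure) \<Rightarrow> real" where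
  "t_graphon F W =
     (\<integral>x. (\<Prod>(i, j)\<in>node_pairs F. moment (edge_mult F i j) W (x i) (x j))
        \<partial>lebesgue_cube (nodes F))"

definition T3 :: "real \<Rightarrow> (multigraph \<Rightarrow> real) set" where
  "T3 d = {(\<lambda>F. t_graphon F W) | W. is_graphon d W}"

end

theory Submission
  imports Defs
begin

text \<open>
  A weighted graph and a graphon enter the density of a multigraph \<open>F\<close> only through the kernels that
  belong to the edge multiplicities: the powers \<open>\<beta>\<^sub>i\<^sub>j ^ k\<close> in one case, the moments
  of \<open>W x y\<close> in the other. Divided by \<open>d ^ k\<close> all these kernels have values in \<open>[-1, 1]\<close>, and \<open>t(F, \<cdot>)\<close> is
  \<open>d ^ |E(F)|\<close> times the density of \<open>F\<close> in the resulting kernel family. Only finitely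
  many kernels matter for a given \<open>F\<close>, and a change of these kernels by at most \<open>\<epsilon>\<close> in the cut
  norm changes the density by at most \<open>\<epsilon>\<close> times the number of pairs of nodes
  of \<open>F\<close> (\<open>counting_lemma\<close>). In contrast to an edgeweight, a moment kernel need not be the power of another
  kernel, but averaging powers over pairs of cells of a partition gives a sequence of moments.

  Limits of weighted graphs are graphons (\<open>limit_of_weighted_graphs\<close>). The energy increment argument, applied to
  several kernels at once, gives for each weighted graph a nested sequence of partitions whose
  quotients are regular for more and more moments with smaller and smaller error, while
  the number of cells at each level does not depend on the graph (\<open>weak_regularity\<close>, \<open>regular_quotients\<close>). The cell
  weights and the averaged kernels are therefore countably many bounded numbers, and along a subsequence
  all of them converge. The limits again describe step functions on nested interval partitions
  of \<open>[0, 1]\<close> in which each level is the average of the next one. Such bounded martingales converge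
  in \<open>L\<^sup>2\<close>, and along a subsequence almost everywhere. As the set of moment sequences is closed
  (\<open>moment_seq_closed\<close>, a form of Helly's theorem), the pointwise limits are the moments of a probability
  measure \<open>W x y\<close> on \<open>[-d, d]\<close>, and \<open>W\<close> is measurable because polynomials are dense in the continuous
  functions on \<open>[-d, d]\<close>, so that the moments determine the Borel sets (\<open>limit_graphon\<close>).

  Graphons are limits of weighted graphs (\<open>graphon_approx\<close>). Bernstein polynomials replace the measures
  \<open>W x y\<close> by measures on a fixed finite set of atoms with almost the same first moments; averaging over a fine
  grid, and rounding, makes the weights of the atoms constant on the cells of the grid and rational with
  a common denominator \<open>Q\<close> (\<open>graphon_grid_approx\<close>). Such a step graphon is approximated by a blow-up in which each cell becomes many
  nodes and the \<open>Q\<close> equally likely atoms are distributed quasirandomly over the pairs of nodes by an explicit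
  construction (\<open>quasirandom_blowup\<close>).

  The topology of pointwise convergence requires only finitely many multigraphs at a time
  (\<open>closure_pointwise\<close>), and the bounded multigraphs on an initial segment of the natural numbers are
  finitely many, so that a point of the closure is a limit of a sequence.
\<close>

section \<open>Homomorphism densities of finite kernel families\<close>

lemma finite_nodes [simp]: "finite (nodes F)"
  using Rep_multigraph[of F] by (auto simp: nodes_def)

lemma finite_node_pairs [simp]: "finite (node_pairs F)"
  by (rule finite_subset[of _ "nodes F \<times> nodes F"]) (auto simp: node_pairs_def)

lemma edge_mult_sym: "edge_mult F i j = edge_mult F j i"
  using Rep_multigraph[of F] by (auto simp: edge_mult_def split_beta)

text \<open>The number of edges, counted with multiplicity.\<close>

definition edge_count :: "multigraph \<Rightarrow> nat" where
  "edge_count F = (\<Sum>(i, j)\<in>node_pairs F. edge_mult F i j)"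

text \<open>
  A kernel family \<open>b\<close> on a finite set \<open>V\<close> assigns to every \<open>k\<close> a kernel \<open>b k\<close>, which is used for
  the pairs of nodes that are joined by exactly \<open>k\<close> edges; \<open>\<alpha>\<close> is a weight function on \<open>V\<close>.
\<close>

definition fin_dens ::
    "multigraph \<Rightarrow> 'a set \<Rightarrow> ('a \<Rightarrow> real) \<Rightarrow> (nat \<Rightarrow> 'a \<Rightarrow> 'a \<Rightarrow> real) \<Rightarrow> real" where
  "fin_dens F V \<alpha> b =
     (\<Sum>\<phi>\<in>nodes F \<rightarrow>\<^sub>E V. (\<Prod>i\<in>nodes F. \<alpha> (\<phi> i)) *
        (\<Prod>(i, j)\<in>node_pairs F. b (edge_mult F i j) (\<phi> i) (\<phi> j)))"

lemma fin_dens_cong: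
  assumes "\<And>x. x \<in> V \<Longrightarrow> \<alpha> x = \<alpha>' x"
    and "\<And>k x y. x \<in> V \<Longrightarrow> y \<in> V \<Longrightarrow> b k x y = b' k x y"
  shows "fin_dens F V \<alpha> b = fin_dens F V \<alpha>' b'"
  unfolding fin_dens_def
proof (intro sum.cong refl arg_cong2[where f = "(*)"] prod.cong)
  fix \<phi> i assume "\<phi> \<in> nodes F \<rightarrow>\<^sub>E V" "i \<in> nodes F"
  then show "\<alpha> (\<phi> i) = \<alpha>' (\<phi> i)" using assms(1) by (auto simp: PiE_iff)
next
  fix \<phi> p assume "\<phi> \<in> nodes F \<rightarrow>\<^sub>E V" "p \<in> node_pairs F"
  then show "(case p of (i, j) \<Rightarrow> b (edge_mult F i j) (\<phi> i) (\<phi> j)) =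
      (case p of (i, j) \<Rightarrow> b' (edge_mult F i j) (\<phi> i) (\<phi> j))"
    using assms(2) by (auto simp: PiE_iff node_pairs_def)
qed

lemma prod_power_edge_count:
  "(\<Prod>(i, j)\<in>node_pairs F. c ^ edge_mult F i j * g i j) =
     c ^ edge_count F * (\<Prod>(i, j)\<in>node_pairs F. g i j :: real)"
  by (simp add: edge_count_def case_prod_beta prod.distrib power_sum)

lemma fin_dens_scale:
  "fin_dens F V \<alpha> (\<lambda>k x y. c ^ k * b k x y) = c ^ edge_count F * fin_dens F V \<alpha> b"
  unfolding fin_dens_def prod_power_edge_count
  by (simp add: sum_distrib_left mult.assoc mult.left_commute)

lemma t_weighted_eq_fin_dens:
  "t_weighted F H = fin_dens F (wnodes H)
     (\<lambda>i. nodeweight H i / (\<Sum>j\<in>wnodes H. nodeweight H j)) (\<lambda>k x y. edgeweight H x y ^ k)"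
  unfolding t_weighted_def hom_weighted_def fin_dens_def sum_divide_distrib
  by (intro sum.cong) (auto simp: prod_dividef)

text \<open>
  If the kernels factor through \<open>p\<close>, identifying the points with the same image under \<open>p\<close> and adding
  their weights does not change the density.
\<close>

lemma fin_dens_pushforward:
  assumes V: "finite V" and C: "finite C" and p: "p ` V \<subseteq> C"
  shows "fin_dens F V \<alpha> (\<lambda>k x y. b k (p x) (p y)) =
         fin_dens F C (\<lambda>c. \<Sum>x\<in>{x\<in>V. p x = c}. \<alpha> x) b"
proof -
  let ?N = "nodes F"
  define g where "g \<phi> = (\<Prod>(i, j)\<in>node_pairs F. b (edge_mult F i j) (\<phi> i) (\<phi> j))" for \<phi>
  have fibre: "{\<psi> \<in> ?N \<rightarrow>\<^sub>E V. (\<lambda>i\<in>?N. p (\<psi> i)) = \<phi>} = (\<Pi>\<^sub>E i\<in>?N. {x\<in>V. p x = \<phi> i})"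
    if "\<phi> \<in> ?N \<rightarrow>\<^sub>E C" for \<phi>
    using that by (fastforce simp: PiE_iff fun_eq_iff restrict_def extensional_def)
  have "fin_dens F C (\<lambda>c. \<Sum>x\<in>{x\<in>V. p x = c}. \<alpha> x) b =
      (\<Sum>\<phi>\<in>?N \<rightarrow>\<^sub>E C. \<Sum>\<psi>\<in>(\<Pi>\<^sub>E i\<in>?N. {x\<in>V. p x = \<phi> i}). (\<Prod>i\<in>?N. \<alpha> (\<psi> i)) * g \<phi>)"
    unfolding fin_dens_def g_def[symmetric]
    by (intro sum.cong refl) (simp add: prod_sum_PiE V sum_distrib_right)
  also have "\<dots> = (\<Sum>\<phi>\<in>?N \<rightarrow>\<^sub>E C. \<Sum>\<psi>\<in>{\<psi> \<in> ?N \<rightarrow>\<^sub>E V. (\<lambda>i\<in>?N. p (\<psi> i)) = \<phi>}.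
      (\<Prod>i\<in>?N. \<alpha> (\<psi> i)) * g (\<lambda>i\<in>?N. p (\<psi> i)))"
  proof (intro sum.cong)
    fix \<phi> \<psi> assume "\<phi> \<in> ?N \<rightarrow>\<^sub>E C" "\<psi> \<in> {\<psi> \<in> ?N \<rightarrow>\<^sub>E V. (\<lambda>i\<in>?N. p (\<psi> i)) = \<phi>}"
    then show "(\<Prod>i\<in>?N. \<alpha> (\<psi> i)) * g \<phi> = (\<Prod>i\<in>?N. \<alpha> (\<psi> i)) * g (\<lambda>i\<in>?N. p (\<psi> i))" by blast
  qed (auto simp: fibre)
  also have "\<dots> = (\<Sum>\<psi>\<in>?N \<rightarrow>\<^sub>E V. (\<Prod>i\<in>?N. \<alpha> (\<psi> i)) * g (\<lambda>i\<in>?N. p (\<psi> i)))"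
    by (rule sum.group) (use p in \<open>auto intro!: finite_PiE V C simp: PiE_iff image_subset_iff\<close>)
  also have "\<dots> = fin_dens F V \<alpha> (\<lambda>k x y. b k (p x) (p y))"
    unfolding fin_dens_def g_def
    by (intro sum.cong arg_cong2[where f = "(*)"] prod.cong) (auto simp: node_pairs_def)
  finally show ?thesis by simp
qed

lemma sum_PiE_insert:
  assumes "i \<notin> N"
  shows "(\<Sum>\<phi>\<in>insert i N \<rightarrow>\<^sub>E V. G \<phi>) = (\<Sum>\<phi>\<in>N \<rightarrow>\<^sub>E V. \<Sum>x\<in>V. G (\<phi>(i := x)))"
proof -
  have "(\<Sum>\<phi>\<in>insert i N \<rightarrow>\<^sub>E V. G \<phi>) = (\<Sum>(x, \<phi>)\<in>V \<times> (N \<rightarrow>\<^sub>E V). G (\<phi>(i := x)))"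
    unfolding PiE_insert_eq
    by (subst sum.reindex[OF inj_combinator[OF assms]]) (simp add: case_prod_beta comp_def)
  then show ?thesis by (simp add: sum.cartesian_product[symmetric] sum.swap[of _ V])
qed

subsection \<open>The cut norm and the counting lemma\<close>

text \<open>The bilinear form of the kernel \<open>D\<close> with respect to the weights \<open>\<alpha>\<close>.\<close>

definition bilin :: "'a set \<Rightarrow> ('a \<Rightarrow> real) \<Rightarrow> ('a \<Rightarrow> 'a \<Rightarrow> real) \<Rightarrow> ('a \<Rightarrow> real) \<Rightarrow> ('a \<Rightarrow> real) \<Rightarrow> real"
  where "bilin V \<alpha> D u v = (\<Sum>x\<in>V. \<Sum>y\<in>V. \<alpha> x * \<alpha> y * (u x * v y * D x y))"

text \<open>
  \<open>cut_le V \<alpha> D \<epsilon>\<close> says that the (\<open>L\<^sup>\<infinity> \<rightarrow> L\<^sup>1\<close>) cut norm of the kernel \<open>D\<close> is at most \<open>\<epsilon>\<close>.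
\<close>

definition cut_le :: "'a set \<Rightarrow> ('a \<Rightarrow> real) \<Rightarrow> ('a \<Rightarrow> 'a \<Rightarrow> real) \<Rightarrow> real \<Rightarrow> bool" where
  "cut_le V \<alpha> D \<epsilon> \<longleftrightarrow>
     (\<forall>u v. (\<forall>x. \<bar>u x\<bar> \<le> 1) \<longrightarrow> (\<forall>x. \<bar>v x\<bar> \<le> 1) \<longrightarrow> \<bar>bilin V \<alpha> D u v\<bar> \<le> \<epsilon>)"

lemma abs_prod_le_1:
  fixes f :: "'i \<Rightarrow> real"
  assumes "\<And>i. i \<in> I \<Longrightarrow> \<bar>f i\<bar> \<le> 1" shows "\<bar>prod f I\<bar> \<le> 1"
  unfolding abs_prod using assms by (intro prod_le_1) auto

text \<open>
  With all variables but \<open>\<phi> i\<close> and \<open>\<phi> j\<close> fixed, the other factors split into a function of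
  \<open>\<phi> i\<close> times a function of \<open>\<phi> j\<close>, since no other pair in \<open>P\<close> consists of \<open>i\<close> and \<open>j\<close>.
\<close>

lemma one_pair_cut:
  fixes h :: "nat \<times> nat \<Rightarrow> 'a \<Rightarrow> 'a \<Rightarrow> real"
  assumes V: "finite V" "\<And>x. x \<in> V \<Longrightarrow> 0 \<le> \<alpha> x" "(\<Sum>x\<in>V. \<alpha> x) = 1"
    and N: "finite N" and P: "finite P" "P \<subseteq> {(i, j). i \<in> N \<and> j \<in> N \<and> i < j}"
    and p: "(i, j) \<in> N \<times> N" "i < j" "(i, j) \<notin> P"
    and h: "\<And>q x y. q \<in> P \<Longrightarrow> \<bar>h q x y\<bar> \<le> 1"
    and D: "cut_le V \<alpha> D \<epsilon>"
  shows "\<bar>\<Sum>\<phi>\<in>N \<rightarrow>\<^sub>E V. (\<Prod>l\<in>N. \<alpha> (\<phi> l)) * (D (\<phi> i) (\<phi> j) *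
           (\<Prod>q\<in>P. h q (\<phi> (fst q)) (\<phi> (snd q))))\<bar> \<le> \<epsilon>"
proof -
  define M where "M = N - {i, j}"
  have NM: "N = insert i (insert j M)" and M: "i \<notin> insert j M" "j \<notin> M" "finite M"
    using p N by (auto simp: M_def)
  define G where "G \<phi> = D (\<phi> i) (\<phi> j) * (\<Prod>q\<in>P. h q (\<phi> (fst q)) (\<phi> (snd q)))" for \<phi> :: "nat \<Rightarrow> 'a"
  define P1 where "P1 = {q \<in> P. fst q = i \<or> snd q = i}"
  have P1: "P1 \<subseteq> P" by (auto simp: P1_def)
  have main: "\<bar>\<Sum>y\<in>V. \<Sum>x\<in>V. \<alpha> x * \<alpha> y * G (\<phi>(j := y, i := x))\<bar> \<le> \<epsilon>" for \<phi>
  proof -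
    define u where "u x = (\<Prod>q\<in>P1. h q ((\<phi>(i := x)) (fst q)) ((\<phi>(i := x)) (snd q)))" for x
    define v where "v y = (\<Prod>q\<in>P-P1. h q ((\<phi>(j := y)) (fst q)) ((\<phi>(j := y)) (snd q)))" for y
    have u: "\<bar>u x\<bar> \<le> 1" for x unfolding u_def using P1 h by (intro abs_prod_le_1) auto
    have v: "\<bar>v x\<bar> \<le> 1" for x unfolding v_def using P1 h by (intro abs_prod_le_1) auto
    have "G (\<phi>(j := y, i := x)) = u x * v y * D x y" for x y
    proof -
      let ?\<psi> = "\<phi>(j := y, i := x)"
      have "(\<Prod>q\<in>P. h q (?\<psi> (fst q)) (?\<psi> (snd q))) =
          (\<Prod>q\<in>P-P1. h q (?\<psi> (fst q)) (?\<psi> (snd q))) * (\<Prod>q\<in>P1. h q (?\<psi> (fst q)) (?\<psi> (snd q)))"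
        by (rule prod.subset_diff[OF P1 P(1)])
      also have "(\<Prod>q\<in>P1. h q (?\<psi> (fst q)) (?\<psi> (snd q))) = u x"
        unfolding u_def
      proof (intro prod.cong refl)
        fix q assume q: "q \<in> P1"
        then have "fst q < snd q" using P by (auto simp: P1_def)
        then have "fst q \<noteq> j \<and> snd q \<noteq> j" using q p(2,3)
          by (cases q) (auto simp: P1_def)
        then show "h q (?\<psi> (fst q)) (?\<psi> (snd q)) = h q ((\<phi>(i := x)) (fst q)) ((\<phi>(i := x)) (snd q))"
          by auto
      qed
      also have "(\<Prod>q\<in>P-P1. h q (?\<psi> (fst q)) (?\<psi> (snd q))) = v y"
        unfolding v_def by (intro prod.cong refl) (auto simp: P1_def)
      finally have "(\<Prod>q\<in>P. h q (?\<psi> (fst q)) (?\<psi> (snd q))) = v y * u x" .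
      moreover have "?\<psi> i = x" "?\<psi> j = y" using p(2) by auto
      ultimately show ?thesis unfolding G_def by (simp only: mult_ac)
    qed
    then have "(\<Sum>y\<in>V. \<Sum>x\<in>V. \<alpha> x * \<alpha> y * G (\<phi>(j := y, i := x))) = bilin V \<alpha> D u v"
      unfolding bilin_def by (subst sum.swap) simp
    then show ?thesis using D u v unfolding cut_le_def by metis
  qed
  have "(\<Sum>\<phi>\<in>N \<rightarrow>\<^sub>E V. (\<Prod>l\<in>N. \<alpha> (\<phi> l)) * G \<phi>) =
      (\<Sum>\<phi>\<in>M \<rightarrow>\<^sub>E V. \<Sum>y\<in>V. \<Sum>x\<in>V. (\<Prod>l\<in>N. \<alpha> ((\<phi>(j := y, i := x)) l)) * G (\<phi>(j := y, i := x)))"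
    unfolding NM by (simp only: sum_PiE_insert[OF M(1)] sum_PiE_insert[OF M(2)])
  also have "\<dots> = (\<Sum>\<phi>\<in>M \<rightarrow>\<^sub>E V. (\<Prod>l\<in>M. \<alpha> (\<phi> l)) * (\<Sum>y\<in>V. \<Sum>x\<in>V. \<alpha> x * \<alpha> y * G (\<phi>(j := y, i := x))))"
  proof (intro sum.cong refl, unfold sum_distrib_left, intro sum.cong refl)
    fix \<phi> x y
    have "(\<Prod>l\<in>M. \<alpha> ((\<phi>(j := y, i := x)) l)) = (\<Prod>l\<in>M. \<alpha> (\<phi> l))"
      using M by (intro prod.cong) auto
    then have "(\<Prod>l\<in>N. \<alpha> ((\<phi>(j := y, i := x)) l)) = \<alpha> x * \<alpha> y * (\<Prod>l\<in>M. \<alpha> (\<phi> l))"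
      unfolding NM using M by (simp del: fun_upd_apply) (simp add: mult_ac)
    then show "(\<Prod>l\<in>N. \<alpha> ((\<phi>(j := y, i := x)) l)) * G (\<phi>(j := y, i := x)) =
        (\<Prod>l\<in>M. \<alpha> (\<phi> l)) * (\<alpha> x * \<alpha> y * G (\<phi>(j := y, i := x)))" by simp
  qed
  also have "\<bar>\<dots>\<bar> \<le> (\<Sum>\<phi>\<in>M \<rightarrow>\<^sub>E V. (\<Prod>l\<in>M. \<alpha> (\<phi> l)) * \<epsilon>)"
  proof (intro order_trans[OF sum_abs] sum_mono, unfold abs_mult)
    fix \<phi> assume "\<phi> \<in> M \<rightarrow>\<^sub>E V"
    then have "0 \<le> (\<Prod>l\<in>M. \<alpha> (\<phi> l))" using V(2) by (intro prod_nonneg) (auto simp: PiE_iff)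
    then show "\<bar>\<Prod>l\<in>M. \<alpha> (\<phi> l)\<bar> * \<bar>\<Sum>y\<in>V. \<Sum>x\<in>V. \<alpha> x * \<alpha> y * G (\<phi>(j := y, i := x))\<bar>
        \<le> (\<Prod>l\<in>M. \<alpha> (\<phi> l)) * \<epsilon>"
      using main by (simp add: mult_left_mono)
  qed
  also have "\<dots> = (\<Prod>l\<in>M. \<Sum>x\<in>V. \<alpha> x) * \<epsilon>"
    by (subst prod_sum_PiE) (auto simp: V M sum_distrib_right simp del: prod_constant)
  also have "\<dots> = \<epsilon>" using V by simp
  finally show ?thesis unfolding G_def .
qed

text \<open>
  The kernels of the pairs of nodes are replaced one after another; each replacement changes the
  density by at most \<open>\<epsilon>\<close>.
\<close>

theorem counting_lemma:
  fixes b b' :: "nat \<Rightarrow> 'a \<Rightarrow> 'a \<Rightarrow> real" and \<epsilon> :: real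
  assumes V: "finite V" "\<And>x. x \<in> V \<Longrightarrow> 0 \<le> \<alpha> x" "(\<Sum>x\<in>V. \<alpha> x) = 1"
    and b: "\<And>k x y. \<bar>b k x y\<bar> \<le> 1" "\<And>k x y. \<bar>b' k x y\<bar> \<le> 1"
    and D: "\<And>i j. (i, j) \<in> node_pairs F \<Longrightarrow>
      cut_le V \<alpha> (\<lambda>x y. b (edge_mult F i j) x y - b' (edge_mult F i j) x y) \<epsilon>"
  shows "\<bar>fin_dens F V \<alpha> b - fin_dens F V \<alpha> b'\<bar> \<le> real (card (node_pairs F)) * \<epsilon>"
proof -
  let ?P = "node_pairs F" let ?N = "nodes F"
  define k where "k q = edge_mult F (fst q) (snd q)" for q
  \<comment> \<open>The kernels of the pairs in \<open>A\<close> have already been replaced.\<close>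
  define h where "h A q = (if q \<in> A then b' (k q) else b (k q))" for A q
  define S where "S A = (\<Sum>\<phi>\<in>?N \<rightarrow>\<^sub>E V. (\<Prod>l\<in>?N. \<alpha> (\<phi> l)) *
      (\<Prod>q\<in>?P. h A q (\<phi> (fst q)) (\<phi> (snd q))))" for A
  have "\<bar>S {} - S A\<bar> \<le> real (card A) * \<epsilon>" if "finite A" "A \<subseteq> ?P" for A
    using that
  proof (induction A rule: finite_induct)
    case (insert p A)
    obtain i j where p: "p = (i, j)" by (cases p)
    have pP: "p \<in> ?P" using insert by auto
    have "S A - S (insert p A) = (\<Sum>\<phi>\<in>?N \<rightarrow>\<^sub>E V. (\<Prod>l\<in>?N. \<alpha> (\<phi> l)) *
        ((b (k p) (\<phi> i) (\<phi> j) - b' (k p) (\<phi> i) (\<phi> j)) *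
         (\<Prod>q\<in>?P - {p}. h A q (\<phi> (fst q)) (\<phi> (snd q)))))"
      unfolding S_def sum_subtractf[symmetric]
    proof (intro sum.cong refl)
      fix \<phi>
      have *: "(\<Prod>q\<in>?P - {p}. h (insert p A) q (\<phi> (fst q)) (\<phi> (snd q))) =
            (\<Prod>q\<in>?P - {p}. h A q (\<phi> (fst q)) (\<phi> (snd q)))"
        by (intro prod.cong refl) (auto simp: h_def)
      have "h A p = b (k p)" "h (insert p A) p = b' (k p)" using insert by (auto simp: h_def)
      moreover have "(\<Prod>q\<in>?P. h B q (\<phi> (fst q)) (\<phi> (snd q))) =
          h B p (\<phi> i) (\<phi> j) * (\<Prod>q\<in>?P - {p}. h B q (\<phi> (fst q)) (\<phi> (snd q)))" for B
        using pP by (subst prod.remove[of ?P p]) (simp_all add: p)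
      ultimately show "(\<Prod>l\<in>?N. \<alpha> (\<phi> l)) * (\<Prod>q\<in>?P. h A q (\<phi> (fst q)) (\<phi> (snd q))) -
         (\<Prod>l\<in>?N. \<alpha> (\<phi> l)) * (\<Prod>q\<in>?P. h (insert p A) q (\<phi> (fst q)) (\<phi> (snd q))) =
        (\<Prod>l\<in>?N. \<alpha> (\<phi> l)) *
        ((b (k p) (\<phi> i) (\<phi> j) - b' (k p) (\<phi> i) (\<phi> j)) *
         (\<Prod>q\<in>?P - {p}. h A q (\<phi> (fst q)) (\<phi> (snd q))))"
        using * by (simp only:) (simp add: algebra_simps)
    qed
    also have "\<bar>\<dots>\<bar> \<le> \<epsilon>"
    proof (rule one_pair_cut[OF V])
      show "cut_le V \<alpha> (\<lambda>x y. b (k p) x y - b' (k p) x y) \<epsilon>"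
        using D[of i j] pP by (simp add: p k_def)
      show "finite (?P - {p})" by simp
    qed (use pP p b in \<open>auto simp: node_pairs_def h_def\<close>)
    finally have "\<bar>S A - S (insert p A)\<bar> \<le> \<epsilon>" .
    moreover have "\<bar>S {} - S A\<bar> \<le> real (card A) * \<epsilon>" using insert by auto
    ultimately show ?case using insert.hyps by (simp add: algebra_simps)
  qed simp
  moreover have "S {} = fin_dens F V \<alpha> b" "S ?P = fin_dens F V \<alpha> b'"
    unfolding S_def fin_dens_def by (simp_all add: h_def k_def case_prod_beta)
  ultimately show ?thesis by (metis finite_node_pairs order_refl)
qed

section \<open>Weak regularity for kernel families\<close>

text \<open>The weighted sum of \<open>f\<close> over pairs; if \<open>\<alpha>\<close> is a probability distribution, this is the mean.\<close>

definition avg2 :: "'a set \<Rightarrow> ('a \<Rightarrow> real) \<Rightarrow> ('a \<Rightarrow> 'a \<Rightarrow> real) \<Rightarrow> real" where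
  "avg2 V \<alpha> f = (\<Sum>x\<in>V. \<Sum>y\<in>V. \<alpha> x * \<alpha> y * f x y)"

lemma bilin_eq_avg2: "bilin V \<alpha> D u v = avg2 V \<alpha> (\<lambda>x y. u x * v y * D x y)"
  by (simp add: bilin_def avg2_def)

lemma avg2_add: "avg2 V \<alpha> (\<lambda>x y. f x y + g x y) = avg2 V \<alpha> f + avg2 V \<alpha> g"
  by (simp add: avg2_def sum.distrib distrib_left)

lemma avg2_diff: "avg2 V \<alpha> (\<lambda>x y. f x y - g x y) = avg2 V \<alpha> f - avg2 V \<alpha> g"
  by (simp add: avg2_def sum_subtractf right_diff_distrib)

lemma avg2_cmult: "avg2 V \<alpha> (\<lambda>x y. c * f x y) = c * avg2 V \<alpha> f"
  by (simp add: avg2_def sum_distrib_left mult_ac)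

lemma avg2_mono:
  assumes "\<And>x. x \<in> V \<Longrightarrow> 0 \<le> \<alpha> x" "\<And>x y. x \<in> V \<Longrightarrow> y \<in> V \<Longrightarrow> f x y \<le> g x y"
  shows "avg2 V \<alpha> f \<le> avg2 V \<alpha> g"
  unfolding avg2_def by (intro sum_mono mult_left_mono) (auto simp: assms)

lemma avg2_const: "(\<Sum>x\<in>V. \<alpha> x) = 1 \<Longrightarrow> avg2 V \<alpha> (\<lambda>x y. c) = c"
  by (simp add: avg2_def sum_distrib_left[symmetric] sum_distrib_right[symmetric])

text \<open>The Cauchy-Schwarz inequality, from the square of \<open>d - t * w\<close> with \<open>t\<close> the mean of \<open>w * d\<close>.\<close>

lemma avg2_square_le:
  assumes \<alpha>: "\<And>x. x \<in> V \<Longrightarrow> 0 \<le> \<alpha> x" "(\<Sum>x\<in>V. \<alpha> x) = 1"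
    and w: "\<And>x y. \<bar>w x y\<bar> \<le> 1"
  shows "(avg2 V \<alpha> (\<lambda>x y. w x y * d x y))\<^sup>2 \<le> avg2 V \<alpha> (\<lambda>x y. (d x y)\<^sup>2)"
proof -
  define t where "t = avg2 V \<alpha> (\<lambda>x y. w x y * d x y)"
  have "0 = avg2 V \<alpha> (\<lambda>x y. 0)" by (simp add: avg2_def)
  also have "\<dots> \<le> avg2 V \<alpha> (\<lambda>x y. (d x y - t * w x y)\<^sup>2)" by (rule avg2_mono) (auto simp: \<alpha>)
  also have "\<dots> \<le> avg2 V \<alpha> (\<lambda>x y. ((d x y)\<^sup>2 - 2 * t * (w x y * d x y)) + t\<^sup>2)"
  proof (rule avg2_mono)
    fix x y
    have "(w x y)\<^sup>2 \<le> 1" using w[of x y] by (simp add: abs_square_le_1)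
    then have "t\<^sup>2 * (w x y)\<^sup>2 \<le> t\<^sup>2 * 1" by (rule mult_left_mono) simp
    then show "(d x y - t * w x y)\<^sup>2 \<le> ((d x y)\<^sup>2 - 2 * t * (w x y * d x y)) + t\<^sup>2"
      by (simp add: power2_eq_square algebra_simps)
  qed (rule \<alpha>)
  also have "\<dots> = avg2 V \<alpha> (\<lambda>x y. (d x y)\<^sup>2) - 2 * t * t + t\<^sup>2"
    unfolding avg2_add avg2_diff avg2_cmult avg2_const[OF \<alpha>(2)] t_def by simp
  finally show ?thesis by (simp add: t_def power2_eq_square)
qed

text \<open>The weight of the cell with label \<open>a\<close> in the partition that is given by the labelling \<open>p\<close>.\<close>

definition cell_wt :: "'a set \<Rightarrow> ('a \<Rightarrow> real) \<Rightarrow> ('a \<Rightarrow> nat) \<Rightarrow> nat \<Rightarrow> real" where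
  "cell_wt V \<alpha> p a = (\<Sum>x\<in>{x\<in>V. p x = a}. \<alpha> x)"

text \<open>
  The partition is given by a labelling \<open>p\<close> of the nodes. The kernels of the quotient are the
  averages over pairs of cells. For cells of weight \<open>0\<close> the value \<open>0 ^ k\<close>, the \<open>k\<close>th
  moment of the point mass at \<open>0\<close>, is used, so that quotients of moment sequences are moment sequences.
\<close>

definition quot ::
    "'a set \<Rightarrow> ('a \<Rightarrow> real) \<Rightarrow> ('a \<Rightarrow> nat) \<Rightarrow> (nat \<Rightarrow> 'a \<Rightarrow> 'a \<Rightarrow> real) \<Rightarrow> nat \<Rightarrow> nat \<Rightarrow> nat \<Rightarrow> real" where
  "quot V \<alpha> p b k a c = (if cell_wt V \<alpha> p a * cell_wt V \<alpha> p c = 0 then 0 ^ k else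
     (\<Sum>x\<in>{x\<in>V. p x = a}. \<Sum>y\<in>{y\<in>V. p y = c}. \<alpha> x * \<alpha> y * b k x y) /
     (cell_wt V \<alpha> p a * cell_wt V \<alpha> p c))"

lemma quot_sym:
  assumes "\<And>x y. b k x y = b k y x"
  shows "quot V \<alpha> p b k a c = quot V \<alpha> p b k c a"
proof -
  have "(\<Sum>x\<in>A. \<Sum>y\<in>B. \<alpha> x * \<alpha> y * b k x y) = (\<Sum>x\<in>B. \<Sum>y\<in>A. \<alpha> x * \<alpha> y * b k x y)" for A B
    by (subst sum.swap, intro sum.cong refl, subst assms) simp
  from this[of "{x\<in>V. p x = a}" "{y\<in>V. p y = c}"] show ?thesis
    unfolding quot_def by (simp add: mult.commute)
qed

text \<open>A probability distribution \<open>\<alpha>\<close> on a finite set \<open>V\<close>.\<close>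

locale finite_prob =
  fixes V :: "'a set" and \<alpha> :: "'a \<Rightarrow> real"
  assumes finV [simp]: "finite V" and nonneg: "\<And>x. x \<in> V \<Longrightarrow> 0 \<le> \<alpha> x"
    and total: "(\<Sum>x\<in>V. \<alpha> x) = 1"
begin

lemma cell_wt_nonneg: "0 \<le> cell_wt V \<alpha> p a"
  unfolding cell_wt_def by (rule sum_nonneg) (auto simp: nonneg)

lemma quot_fibre:
  "(\<Sum>x\<in>{x\<in>V. p x = a}. \<Sum>y\<in>{y\<in>V. p y = c}. \<alpha> x * \<alpha> y * b k x y) =
     cell_wt V \<alpha> p a * cell_wt V \<alpha> p c * quot V \<alpha> p b k a c"
proof (cases "cell_wt V \<alpha> p a * cell_wt V \<alpha> p c = 0")
  case True
  have zero: "\<alpha> x = 0" if "cell_wt V \<alpha> p e = 0" "x \<in> V" "p x = e" for x e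
    using that unfolding cell_wt_def by (subst (asm) sum_nonneg_eq_0_iff) (auto simp: nonneg)
  have "(\<Sum>x\<in>{x\<in>V. p x = a}. \<Sum>y\<in>{y\<in>V. p y = c}. \<alpha> x * \<alpha> y * b k x y) = 0"
    using True zero[of a] zero[of c] by (intro sum.neutral ballI) auto
  then show ?thesis using True by simp
qed (simp add: quot_def)

lemma quot_abs_le:
  assumes "\<And>x y. \<bar>b k x y\<bar> \<le> 1"
  shows "\<bar>quot V \<alpha> p b k a c\<bar> \<le> 1"
proof (cases "cell_wt V \<alpha> p a * cell_wt V \<alpha> p c = 0")
  case True
  then show ?thesis by (simp add: quot_def power_0_left)
next
  case False
  then have pos: "0 < cell_wt V \<alpha> p a * cell_wt V \<alpha> p c"
    using cell_wt_nonneg[of p a] cell_wt_nonneg[of p c] by (simp add: less_le)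
  have "\<bar>\<Sum>x\<in>{x\<in>V. p x = a}. \<Sum>y\<in>{y\<in>V. p y = c}. \<alpha> x * \<alpha> y * b k x y\<bar> \<le>
      (\<Sum>x\<in>{x\<in>V. p x = a}. \<Sum>y\<in>{y\<in>V. p y = c}. \<alpha> x * \<alpha> y)"
    using assms
    by (intro order_trans[OF sum_abs] sum_mono) (auto simp: abs_mult nonneg intro!: mult_left_le)
  also have "\<dots> = cell_wt V \<alpha> p a * cell_wt V \<alpha> p c"
    by (simp add: cell_wt_def sum_product)
  finally have "\<bar>cell_wt V \<alpha> p a * cell_wt V \<alpha> p c * quot V \<alpha> p b k a c\<bar> \<le>
      cell_wt V \<alpha> p a * cell_wt V \<alpha> p c * 1"
    by (simp only: quot_fibre mult_1_right)
  then have "(cell_wt V \<alpha> p a * cell_wt V \<alpha> p c) * \<bar>quot V \<alpha> p b k a c\<bar> \<le>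
      (cell_wt V \<alpha> p a * cell_wt V \<alpha> p c) * 1"
    using pos by (simp only: abs_mult[of "_ * _" "quot _ _ _ _ _ _ _"] abs_of_pos)
  then show ?thesis by (simp only: mult_le_cancel_left_pos[OF pos])
qed

text \<open>The quotient is the conditional expectation with respect to the partition.\<close>

lemma quot_inner:
  "avg2 V \<alpha> (\<lambda>x y. b k x y * g (p x) (p y)) =
   avg2 V \<alpha> (\<lambda>x y. quot V \<alpha> p b k (p x) (p y) * g (p x) (p y))"
proof -
  have split: "avg2 V \<alpha> f = (\<Sum>a\<in>p ` V. \<Sum>c\<in>p ` V. \<Sum>x\<in>{x\<in>V. p x = a}. \<Sum>y\<in>{y\<in>V. p y = c}.
      \<alpha> x * \<alpha> y * f x y)" for f
  proof -
    have "(\<Sum>x\<in>V. \<Sum>y\<in>V. \<alpha> x * \<alpha> y * f x y) =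
        (\<Sum>a\<in>p ` V. \<Sum>x\<in>{x\<in>V. p x = a}. \<Sum>y\<in>V. \<alpha> x * \<alpha> y * f x y)"
      by (rule sum.image_gen[OF finV])
    also have "\<dots> = (\<Sum>a\<in>p ` V. \<Sum>x\<in>{x\<in>V. p x = a}. \<Sum>c\<in>p ` V. \<Sum>y\<in>{y\<in>V. p y = c}.
        \<alpha> x * \<alpha> y * f x y)"
      by (intro sum.cong refl sum.image_gen[OF finV])
    also have "\<dots> = (\<Sum>a\<in>p ` V. \<Sum>c\<in>p ` V. \<Sum>x\<in>{x\<in>V. p x = a}. \<Sum>y\<in>{y\<in>V. p y = c}.
        \<alpha> x * \<alpha> y * f x y)"
      by (intro sum.cong refl sum.swap)
    finally show ?thesis by (simp only: avg2_def)
  qed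
  have fib: "(\<Sum>x\<in>{x\<in>V. p x = a}. \<Sum>y\<in>{y\<in>V. p y = c}. \<alpha> x * \<alpha> y * (b k x y * g (p x) (p y))) =
    (\<Sum>x\<in>{x\<in>V. p x = a}. \<Sum>y\<in>{y\<in>V. p y = c}.
       \<alpha> x * \<alpha> y * (quot V \<alpha> p b k (p x) (p y) * g (p x) (p y)))" for a c
  proof -
    have "(\<Sum>x\<in>{x\<in>V. p x = a}. \<Sum>y\<in>{y\<in>V. p y = c}. \<alpha> x * \<alpha> y * (b k x y * g (p x) (p y))) =
      (\<Sum>x\<in>{x\<in>V. p x = a}. \<Sum>y\<in>{y\<in>V. p y = c}. \<alpha> x * \<alpha> y * b k x y) * g a c"
      by (simp add: sum_distrib_right mult.assoc)
    also have "\<dots> = (\<Sum>x\<in>{x\<in>V. p x = a}. \<Sum>y\<in>{y\<in>V. p y = c}. \<alpha> x * \<alpha> y) *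
        (quot V \<alpha> p b k a c * g a c)"
      unfolding quot_fibre by (simp add: cell_wt_def sum_product)
    also have "\<dots> = (\<Sum>x\<in>{x\<in>V. p x = a}. \<Sum>y\<in>{y\<in>V. p y = c}.
       \<alpha> x * \<alpha> y * (quot V \<alpha> p b k (p x) (p y) * g (p x) (p y)))"
      unfolding sum_distrib_right by (intro sum.cong refl) auto
    finally show ?thesis .
  qed
  show ?thesis unfolding split fib ..
qed

text \<open>Here \<open>p'\<close> is a refinement of the partition \<open>p\<close>.\<close>

lemma quot_pythagoras:
  assumes p: "\<And>x. p x = h (p' x)"
  shows "avg2 V \<alpha> (\<lambda>x y. (quot V \<alpha> p' b k (p' x) (p' y) - quot V \<alpha> p b k (p x) (p y))\<^sup>2) =
    avg2 V \<alpha> (\<lambda>x y. (quot V \<alpha> p' b k (p' x) (p' y))\<^sup>2) -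
    avg2 V \<alpha> (\<lambda>x y. (quot V \<alpha> p b k (p x) (p y))\<^sup>2)"
proof -
  let ?E = "\<lambda>x y. quot V \<alpha> p b k (p x) (p y)" and ?E' = "\<lambda>x y. quot V \<alpha> p' b k (p' x) (p' y)"
  have 1: "avg2 V \<alpha> (\<lambda>x y. ?E' x y * ?E x y) = avg2 V \<alpha> (\<lambda>x y. b k x y * ?E x y)"
    using quot_inner[of b k "\<lambda>a c. quot V \<alpha> p b k (h a) (h c)" p'] by (simp add: p)
  have 2: "avg2 V \<alpha> (\<lambda>x y. b k x y * ?E x y) = avg2 V \<alpha> (\<lambda>x y. ?E x y * ?E x y)"
    by (rule quot_inner)
  have "avg2 V \<alpha> (\<lambda>x y. (?E' x y - ?E x y)\<^sup>2) =
      avg2 V \<alpha> (\<lambda>x y. (?E' x y)\<^sup>2 - 2 * (?E' x y * ?E x y) + ?E x y * ?E x y)"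
    by (simp add: power2_eq_square algebra_simps)
  then show ?thesis
    unfolding avg2_add avg2_diff avg2_cmult 1 2 by (simp add: power2_eq_square)
qed

text \<open>The absolute value of a bilinear form on a product of cubes is maximal at a pair of sign vectors.\<close>

lemma bilin_signs:
  assumes "\<And>x. \<bar>u x\<bar> \<le> 1" "\<And>x. \<bar>v x\<bar> \<le> 1"
  obtains s t where "\<And>x. s x \<in> {-1, 1}" "\<And>x. t x \<in> {-1, 1}"
    "\<bar>bilin V \<alpha> D u v\<bar> \<le> bilin V \<alpha> D s t"
proof -
  have max: "\<bar>\<Sum>x\<in>V. \<alpha> x * (u x * c x)\<bar> \<le> (\<Sum>x\<in>V. \<alpha> x * ((if c x < 0 then -1 else 1) * c x))"
    if "\<And>x. \<bar>u x\<bar> \<le> 1" for u c :: "'a \<Rightarrow> real"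
  proof (intro order_trans[OF sum_abs] sum_mono)
    fix x assume "x \<in> V"
    have "\<bar>u x\<bar> * \<bar>c x\<bar> \<le> 1 * \<bar>c x\<bar>" by (rule mult_right_mono) (auto simp: that)
    then have "\<bar>u x * c x\<bar> \<le> (if c x < 0 then -1 else 1) * c x" by (auto simp: abs_mult)
    then show "\<bar>\<alpha> x * (u x * c x)\<bar> \<le> \<alpha> x * ((if c x < 0 then -1 else 1) * c x)"
      using nonneg[OF \<open>x \<in> V\<close>] by (simp add: abs_mult mult_left_mono)
  qed
  define c where "c x = (\<Sum>y\<in>V. \<alpha> y * (v y * D x y))" for x
  define s where "s x = (if c x < 0 then -1 else 1 :: real)" for x
  define e where "e y = (\<Sum>x\<in>V. \<alpha> x * (s x * D x y))" for y
  define t where "t y = (if e y < 0 then -1 else 1 :: real)" for y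
  have L: "bilin V \<alpha> D u' v = (\<Sum>x\<in>V. \<alpha> x * (u' x * c x))" for u'
    by (simp add: bilin_def c_def sum_distrib_left mult_ac)
  have R: "bilin V \<alpha> D s v' = (\<Sum>y\<in>V. \<alpha> y * (v' y * e y))" for v'
    unfolding bilin_def e_def by (subst sum.swap) (simp add: sum_distrib_left mult_ac)
  have "\<bar>bilin V \<alpha> D u v\<bar> \<le> bilin V \<alpha> D s v" unfolding L s_def by (rule max) (rule assms)
  also have "\<dots> \<le> bilin V \<alpha> D s t"
    unfolding R t_def using max[of v e] assms by (simp add: abs_le_iff)
  finally show thesis by (intro that[of s t]) (auto simp: s_def t_def)
qed

text \<open>
  A pair of sign vectors that witnesses irregularity divides each cell into \<open>4\<close> parts, with labels
  \<open>4 * p x + s x\<close>; the energy, the mean square of the quotient, increases by at least \<open>\<epsilon>\<^sup>2\<close>.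
\<close>

lemma cut_irregular_energy:
  fixes p :: "'a \<Rightarrow> nat"
  assumes b: "\<not> cut_le V \<alpha> (\<lambda>x y. b k x y - quot V \<alpha> p b k (p x) (p y)) \<epsilon>" and \<epsilon>: "0 \<le> \<epsilon>"
  obtains s where "\<And>x. s x < 4"
    "avg2 V \<alpha> (\<lambda>x y. (quot V \<alpha> p b k (p x) (p y))\<^sup>2) + \<epsilon>\<^sup>2 \<le>
     avg2 V \<alpha> (\<lambda>x y. (quot V \<alpha> (\<lambda>x. 4 * p x + s x) b k (4 * p x + s x) (4 * p y + s y))\<^sup>2)"
proof -
  let ?E = "\<lambda>x y. quot V \<alpha> p b k (p x) (p y)"
  let ?D = "\<lambda>x y. b k x y - ?E x y"
  from b obtain u0 v0 where uv0': "\<forall>x. \<bar>u0 x\<bar> \<le> 1" "\<forall>x. \<bar>v0 x\<bar> \<le> 1"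
      "\<not> \<bar>bilin V \<alpha> ?D u0 v0\<bar> \<le> \<epsilon>"
    unfolding cut_le_def by blast
  then have uv0: "\<And>x. \<bar>u0 x\<bar> \<le> 1" "\<And>x. \<bar>v0 x\<bar> \<le> 1" "\<epsilon> < \<bar>bilin V \<alpha> ?D u0 v0\<bar>"
    by (simp_all only: not_le)
  obtain u v where uv: "\<And>x. u x \<in> {-1, 1::real}" "\<And>x. v x \<in> {-1, 1::real}"
    "\<bar>bilin V \<alpha> ?D u0 v0\<bar> \<le> bilin V \<alpha> ?D u v"
    using bilin_signs[of u0 v0 ?D, OF uv0(1) uv0(2)] by blast
  have uv1: "\<bar>u x * v y\<bar> \<le> 1" for x y using uv(1)[of x] uv(2)[of y] by auto
  \<comment> \<open>The label modulo \<open>4\<close> encodes both signs, so that \<open>u\<close> and \<open>v\<close> are constant on the new cells.\<close>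
  define s where "s x = (if u x = 1 then 1 else 0) + (if v x = 1 then 2 else (0::nat))" for x
  define p' where "p' = (\<lambda>x. 4 * p x + s x)"
  have s: "s x < 4" for x by (simp add: s_def)
  have p: "p x = p' x div 4" for x using s[of x] by (simp add: p'_def)
  have u: "u x = (if odd (p' x) then 1 else -1)" for x
    using uv(1)[of x] by (auto simp: p'_def s_def)
  have "p' x mod 4 = s x" for x using s[of x] by (simp add: p'_def)
  then have v: "v x = (if 2 \<le> p' x mod 4 then 1 else -1)" for x
    using uv(2)[of x] by (auto simp: s_def)
  let ?E' = "\<lambda>x y. quot V \<alpha> p' b k (p' x) (p' y)"
  have "avg2 V \<alpha> (\<lambda>x y. b k x y * (u x * v y)) = avg2 V \<alpha> (\<lambda>x y. ?E' x y * (u x * v y))"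
    using quot_inner[of b k "\<lambda>a c. (if odd a then 1 else -1) * (if 2 \<le> c mod 4 then 1 else -1)" p']
    by (simp only: u v)
  then have "bilin V \<alpha> ?D u v = avg2 V \<alpha> (\<lambda>x y. (u x * v y) * (?E' x y - ?E x y))"
    unfolding bilin_eq_avg2 right_diff_distrib avg2_diff by (simp add: mult_ac)
  then have "\<epsilon>\<^sup>2 \<le> (avg2 V \<alpha> (\<lambda>x y. (u x * v y) * (?E' x y - ?E x y)))\<^sup>2"
    using uv0(3) uv(3) \<epsilon> by (intro power_mono) auto
  also have "\<dots> \<le> avg2 V \<alpha> (\<lambda>x y. (?E' x y - ?E x y)\<^sup>2)"
    by (rule avg2_square_le[OF nonneg total uv1])
  also have "\<dots> = avg2 V \<alpha> (\<lambda>x y. (?E' x y)\<^sup>2) - avg2 V \<alpha> (\<lambda>x y. (?E x y)\<^sup>2)"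
    using p by (rule quot_pythagoras)
  finally show thesis using s unfolding p'_def by (intro that[of s]) auto
qed

lemma quot_mult4:
  "quot V \<alpha> (\<lambda>x. 4 * p x) b k (4 * a) (4 * c) = quot V \<alpha> p b k a c"
  by (simp add: quot_def cell_wt_def)

text \<open>
  Energy increment: \<open>t\<close> refinements of each cell into \<open>4\<close> parts produce a regular partition or
  raise the energy by \<open>t * \<epsilon>\<^sup>2\<close>. The number of parts depends only on \<open>t\<close>; if the partition is
  regular early, the remaining refinements are trivial, that is, they only change the labels.
\<close>

lemma energy_increment:
  fixes p :: "'a \<Rightarrow> nat" and K :: nat and b :: "nat \<Rightarrow> 'a \<Rightarrow> 'a \<Rightarrow> real"
  assumes \<epsilon>: "0 \<le> \<epsilon>"
  defines "energy \<equiv> \<lambda>p. \<Sum>k<K. avg2 V \<alpha> (\<lambda>x y. (quot V \<alpha> p b k (p x) (p y))\<^sup>2)"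
    and "regular \<equiv> \<lambda>p. \<forall>k<K. cut_le V \<alpha> (\<lambda>x y. b k x y - quot V \<alpha> p b k (p x) (p y)) \<epsilon>"
  shows "\<exists>s. (\<forall>x. s x < 4 ^ t) \<and>
    (regular (\<lambda>x. 4 ^ t * p x + s x) \<or> real t * \<epsilon>\<^sup>2 \<le> energy (\<lambda>x. 4 ^ t * p x + s x))"
proof (induction t)
  case 0
  have "0 \<le> avg2 V \<alpha> (\<lambda>x y. (quot V \<alpha> p b k (p x) (p y))\<^sup>2)" for k
    using avg2_mono[of V \<alpha> "\<lambda>x y. 0"] nonneg by (simp add: avg2_def)
  then show ?case by (intro exI[of _ "\<lambda>_. 0"]) (auto simp: energy_def intro!: sum_nonneg)
next
  case (Suc t)
  then obtain s where s: "\<And>x. s x < 4 ^ t"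
    "regular (\<lambda>x. 4 ^ t * p x + s x) \<or> real t * \<epsilon>\<^sup>2 \<le> energy (\<lambda>x. 4 ^ t * p x + s x)" by auto
  define r where "r x = 4 ^ t * p x + s x" for x
  have r: "4 ^ Suc t * p x + (4 * s x + e x) = 4 * r x + e x" for x e by (simp add: r_def)
  have bound: "4 * s x + e < 4 ^ Suc t" if "e < 4" for x e using s(1)[of x] that by simp
  show ?case
  proof (cases "regular r")
    case True
    then have "regular (\<lambda>x. 4 * r x)" by (simp add: regular_def quot_mult4)
    then show ?thesis using r[of _ "\<lambda>_. 0"] bound[of 0] by (intro exI[of _ "\<lambda>x. 4 * s x"]) simp
  next
    case False
    then have en: "real t * \<epsilon>\<^sup>2 \<le> energy r" using s(2) unfolding r_def by blast
    from False obtain l where l: "l < K"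
      "\<not> cut_le V \<alpha> (\<lambda>x y. b l x y - quot V \<alpha> r b l (r x) (r y)) \<epsilon>" by (auto simp: regular_def)
    obtain e where e: "\<And>x. e x < 4"
      "avg2 V \<alpha> (\<lambda>x y. (quot V \<alpha> r b l (r x) (r y))\<^sup>2) + \<epsilon>\<^sup>2 \<le>
       avg2 V \<alpha> (\<lambda>x y. (quot V \<alpha> (\<lambda>x. 4 * r x + e x) b l (4 * r x + e x) (4 * r y + e y))\<^sup>2)"
      using cut_irregular_energy[OF l(2) \<epsilon>] by blast
    define r' where "r' = (\<lambda>x. 4 * r x + e x)"
    have r': "r x = r' x div 4" for x using e(1)[of x] by (simp add: r'_def)
    have mono: "avg2 V \<alpha> (\<lambda>x y. (quot V \<alpha> r b k (r x) (r y))\<^sup>2) \<le>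
        avg2 V \<alpha> (\<lambda>x y. (quot V \<alpha> r' b k (r' x) (r' y))\<^sup>2)" for k
    proof -
      have "0 \<le> avg2 V \<alpha> (\<lambda>x y. (quot V \<alpha> r' b k (r' x) (r' y) - quot V \<alpha> r b k (r x) (r y))\<^sup>2)"
        using avg2_mono[of V \<alpha> "\<lambda>x y. 0"] nonneg by (simp add: avg2_def)
      then show ?thesis using quot_pythagoras[of r "\<lambda>x. x div 4" r' b k, OF r'] by simp
    qed
    have rem: "energy q = (\<Sum>k\<in>{..<K}-{l}. avg2 V \<alpha> (\<lambda>x y. (quot V \<alpha> q b k (q x) (q y))\<^sup>2)) +
        avg2 V \<alpha> (\<lambda>x y. (quot V \<alpha> q b l (q x) (q y))\<^sup>2)" for q
      using l(1) by (simp only: energy_def sum.remove[of "{..<K}" l] finite_lessThan lessThan_iff add.commute)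
    have "energy r + \<epsilon>\<^sup>2 \<le> energy r'"
      unfolding rem add.assoc using e(2) by (intro add_mono sum_mono mono) (simp add: r'_def)
    then have "real (Suc t) * \<epsilon>\<^sup>2 \<le> energy r'" using en by (simp add: algebra_simps)
    then have "real (Suc t) * \<epsilon>\<^sup>2 \<le> energy (\<lambda>x. 4 ^ Suc t * p x + (4 * s x + e x))"
      unfolding r r'_def .
    then show ?thesis using bound e(1) by (intro exI[of _ "\<lambda>x. 4 * s x + e x"]) blast
  qed
qed

text \<open>
  The energy of \<open>K\<close> kernels is at most \<open>K\<close>, so \<open>T > K / \<epsilon>\<^sup>2\<close> refinements suffice to make all the kernels
  regular at once.
\<close>

theorem weak_regularity:
  fixes p :: "'a \<Rightarrow> nat" and K :: nat and b :: "nat \<Rightarrow> 'a \<Rightarrow> 'a \<Rightarrow> real"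
  assumes \<epsilon>: "0 \<le> \<epsilon>" and T: "real K < real T * \<epsilon>\<^sup>2" and b: "\<And>k x y. \<bar>b k x y\<bar> \<le> 1"
  obtains s where "\<And>x. s x < 4 ^ T"
    "\<And>k. k < K \<Longrightarrow> cut_le V \<alpha> (\<lambda>x y. b k x y -
       quot V \<alpha> (\<lambda>x. 4 ^ T * p x + s x) b k (4 ^ T * p x + s x) (4 ^ T * p y + s y)) \<epsilon>"
proof -
  have "(\<Sum>k<K. avg2 V \<alpha> (\<lambda>x y. (quot V \<alpha> p' b k (p' x) (p' y))\<^sup>2)) < real T * \<epsilon>\<^sup>2" for p' :: "'a \<Rightarrow> nat"
  proof -
    have "avg2 V \<alpha> (\<lambda>x y. (quot V \<alpha> p' b k (p' x) (p' y))\<^sup>2) \<le> 1" for k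
    proof -
      have "avg2 V \<alpha> (\<lambda>x y. (quot V \<alpha> p' b k (p' x) (p' y))\<^sup>2) \<le> avg2 V \<alpha> (\<lambda>x y. 1)"
        using quot_abs_le[of b k p'] b by (intro avg2_mono nonneg) (auto simp: abs_square_le_1)
      then show ?thesis by (simp add: avg2_const total)
    qed
    then have "(\<Sum>k<K. avg2 V \<alpha> (\<lambda>x y. (quot V \<alpha> p' b k (p' x) (p' y))\<^sup>2)) \<le> (\<Sum>k<K. 1)"
      by (intro sum_mono)
    then show ?thesis using T by simp
  qed
  then show thesis
    using energy_increment[OF \<epsilon>, of T K b p] that by (fastforce simp: not_le[symmetric])
qed

end

section \<open>Quasirandom blow-ups\<close>

text \<open>The second moment bound on the cut norm, by two applications of the Cauchy-Schwarz inequality.\<close>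

lemma (in finite_prob) cut_le_second_moment:
  assumes \<epsilon>: "0 \<le> \<epsilon>"
    and D: "(\<Sum>y\<in>V. \<Sum>z\<in>V. \<alpha> y * \<alpha> z * \<bar>\<Sum>x\<in>V. \<alpha> x * (D x y * D x z)\<bar>) \<le> \<epsilon>\<^sup>2"
  shows "cut_le V \<alpha> D \<epsilon>"
  unfolding cut_le_def
proof (intro allI impI)
  fix u v :: "'a \<Rightarrow> real"
  assume u: "\<forall>x. \<bar>u x\<bar> \<le> 1" and v: "\<forall>x. \<bar>v x\<bar> \<le> 1"
  define c where "c x = (\<Sum>y\<in>V. \<alpha> y * (v y * D x y))" for x
  define t where "t = (\<Sum>x\<in>V. \<alpha> x * (u x * c x))"
  have t: "bilin V \<alpha> D u v = t"
    by (simp add: bilin_def t_def c_def sum_distrib_left mult_ac)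
  have "0 \<le> (\<Sum>x\<in>V. \<alpha> x * (c x - t * u x)\<^sup>2)" by (intro sum_nonneg) (auto simp: nonneg)
  also have "\<dots> \<le> (\<Sum>x\<in>V. \<alpha> x * ((c x)\<^sup>2 - 2 * t * (u x * c x) + t\<^sup>2))"
  proof (intro sum_mono mult_left_mono nonneg)
    fix x
    have "(u x)\<^sup>2 \<le> 1" using u by (simp add: abs_square_le_1)
    then have "t\<^sup>2 * (u x)\<^sup>2 \<le> t\<^sup>2 * 1" by (rule mult_left_mono) simp
    then show "(c x - t * u x)\<^sup>2 \<le> (c x)\<^sup>2 - 2 * t * (u x * c x) + t\<^sup>2"
      by (simp add: power2_eq_square algebra_simps)
  qed
  also have "\<dots> = (\<Sum>x\<in>V. \<alpha> x * (c x)\<^sup>2 - (2 * t) * (\<alpha> x * (u x * c x)) + \<alpha> x * t\<^sup>2)"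
    by (intro sum.cong refl) (simp add: algebra_simps)
  also have "\<dots> = (\<Sum>x\<in>V. \<alpha> x * (c x)\<^sup>2) - 2 * t * t + t\<^sup>2"
    unfolding sum.distrib sum_subtractf sum_distrib_left[symmetric] sum_distrib_right[symmetric] total
      t_def[symmetric] by simp
  finally have "t\<^sup>2 \<le> (\<Sum>x\<in>V. \<alpha> x * (c x)\<^sup>2)" by (simp add: power2_eq_square)
  also have "\<dots> = (\<Sum>x\<in>V. \<Sum>y\<in>V. \<Sum>z\<in>V. \<alpha> y * \<alpha> z * (v y * v z * (\<alpha> x * (D x y * D x z))))"
    unfolding c_def power2_eq_square sum_product unfolding sum_distrib_left
    by (intro sum.cong refl) (simp add: mult_ac)
  also have "\<dots> = (\<Sum>y\<in>V. \<Sum>x\<in>V. \<Sum>z\<in>V. \<alpha> y * \<alpha> z * (v y * v z * (\<alpha> x * (D x y * D x z))))"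
    by (rule sum.swap)
  also have "\<dots> = (\<Sum>y\<in>V. \<Sum>z\<in>V. \<Sum>x\<in>V. \<alpha> y * \<alpha> z * (v y * v z * (\<alpha> x * (D x y * D x z))))"
    by (intro sum.cong refl sum.swap)
  also have "\<dots> = (\<Sum>y\<in>V. \<Sum>z\<in>V. \<alpha> y * \<alpha> z * (v y * v z * (\<Sum>x\<in>V. \<alpha> x * (D x y * D x z))))"
    by (simp only: sum_distrib_left)
  also have "\<dots> \<le> (\<Sum>y\<in>V. \<Sum>z\<in>V. \<alpha> y * \<alpha> z * \<bar>\<Sum>x\<in>V. \<alpha> x * (D x y * D x z)\<bar>)"
  proof (intro sum_mono mult_left_mono)
    fix y z
    let ?s = "\<Sum>x\<in>V. \<alpha> x * (D x y * D x z)"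
    have "\<bar>v y * v z\<bar> \<le> 1 * 1" unfolding abs_mult using v by (intro mult_mono) auto
    then have "\<bar>v y * v z\<bar> * \<bar>?s\<bar> \<le> 1 * \<bar>?s\<bar>" by (intro mult_right_mono) auto
    then have "\<bar>v y * v z * ?s\<bar> \<le> \<bar>?s\<bar>" by (simp only: abs_mult mult_1_left)
    then show "v y * v z * ?s \<le> \<bar>?s\<bar>" by linarith
  qed (auto simp: nonneg)
  also have "\<dots> \<le> \<epsilon>\<^sup>2" by (rule D)
  finally show "\<bar>bilin V \<alpha> D u v\<bar> \<le> \<epsilon>" 
    unfolding t by (rule abs_le_square_iff[THEN iffD2, of t \<epsilon>, unfolded abs_of_nonneg[OF \<epsilon>]])
qed

text \<open>A shift modulo \<open>Q\<close> permutes the residues.\<close>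

lemma sum_shift_mod:
  fixes Q :: nat
  shows "(\<Sum>z<Q. G ((z + c) mod Q)) = (\<Sum>z<Q. G z)"
proof (rule sum.reindex_bij_witness[of _ "\<lambda>z. (z + (Q - c mod Q)) mod Q" "\<lambda>z. (z + c) mod Q"])
  fix z assume "z \<in> {..<Q}"
  then have Q: "z < Q" "0 < Q" by auto
  then have le: "c mod Q \<le> Q" by (simp add: less_imp_le)
  have "(c + (Q - c mod Q)) mod Q = (c mod Q + (Q - c mod Q)) mod Q"
    by (simp only: mod_add_left_eq)
  then have 0: "(c + (Q - c mod Q)) mod Q = 0" using le by simp
  have inv: "(z + (c + (Q - c mod Q))) mod Q = z"
    using Q by (subst mod_add_right_eq[symmetric], subst 0) simp
  have "((z + c) mod Q + (Q - c mod Q)) mod Q = (z + (c + (Q - c mod Q))) mod Q"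
    by (simp only: mod_add_left_eq add.assoc)
  then show "((z + c) mod Q + (Q - c mod Q)) mod Q = z" using inv by simp
  have "((z + (Q - c mod Q)) mod Q + c) mod Q = (z + (c + (Q - c mod Q))) mod Q"
    by (simp only: mod_add_left_eq) (simp only: ac_simps)
  then show "((z + (Q - c mod Q)) mod Q + c) mod Q = z" using inv by simp
qed auto

text \<open>
  The nodes of the blow-up are triples \<open>(a, s, \<phi>)\<close> of a cell \<open>a < N\<close>, an index \<open>s < S\<close>, and a
  function \<open>\<phi>\<close> from indices to residues modulo \<open>Q\<close>. The pair \<open>(a, s, \<phi>)\<close>, \<open>(a', s', \<phi>')\<close> has
  the colour \<open>\<phi> s' + \<phi>' s\<close>, which is symmetric. For fixed \<open>(a', s', \<phi>')\<close> and \<open>(a'', s'', \<phi>'')\<close> with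
  \<open>s' \<noteq> s''\<close> the two colours are independent and uniform when \<open>\<phi>\<close> is random.
\<close>

type_synonym bnode = "nat \<times> nat \<times> (nat \<Rightarrow> nat)"

definition blowup :: "nat \<Rightarrow> nat \<Rightarrow> nat \<Rightarrow> bnode set" where
  "blowup N S Q = {..<N} \<times> {..<S} \<times> ({..<S} \<rightarrow>\<^sub>E {..<Q})"

fun colour :: "nat \<Rightarrow> bnode \<Rightarrow> bnode \<Rightarrow> nat" where
  "colour Q (a, s, \<phi>) (a', s', \<phi>') = (\<phi> s' + \<phi>' s) mod Q"

lemma colour_sym: "colour Q x y = colour Q y x"
  by (cases x; cases y) (simp add: add.commute)

lemma finite_blowup [simp]: "finite (blowup N S Q)"
  by (auto simp: blowup_def intro!: finite_PiE)

lemma card_blowup: "card (blowup N S Q) = N * S * Q ^ S"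
  by (simp add: blowup_def card_cartesian_product card_PiE)

lemma card_blowup_cell:
  assumes "a < N" shows "card {x \<in> blowup N S Q. fst x = a} = S * Q ^ S"
proof -
  have "{x \<in> blowup N S Q. fst x = a} = {a} \<times> {..<S} \<times> ({..<S} \<rightarrow>\<^sub>E {..<Q})"
    using assms by (intro set_eqI) (simp only: blowup_def mem_Times_iff mem_Collect_eq, simp, metis)
  then show ?thesis by (simp add: card_cartesian_product card_PiE)
qed

lemma card_blowup_index:
  assumes "s < S" shows "card {x \<in> blowup N S Q. fst (snd x) = s} = N * Q ^ S"
proof -
  have "{x \<in> blowup N S Q. fst (snd x) = s} = {..<N} \<times> {s} \<times> ({..<S} \<rightarrow>\<^sub>E {..<Q})"
    using assms by (intro set_eqI) (simp only: blowup_def mem_Times_iff mem_Collect_eq, simp, metis)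
  then show ?thesis by (simp add: card_cartesian_product card_PiE)
qed

text \<open>
  Two nodes of the blow-up have the same index with probability \<open>1 / S\<close>. For all other pairs the second
  moments of the centred kernel vanish by independence of the colours, whatever values \<open>g\<close> assigns to the colours.
\<close>

theorem quasirandom_blowup:
  fixes g :: "nat \<Rightarrow> nat \<Rightarrow> nat \<Rightarrow> real"
  assumes pos: "0 < N" "0 < S" "0 < Q" and \<epsilon>: "0 \<le> \<epsilon>" "4 / S \<le> \<epsilon>\<^sup>2"
    and g: "\<And>a c z. \<bar>g a c z\<bar> \<le> 1"
  shows "cut_le (blowup N S Q) (\<lambda>_. 1 / card (blowup N S Q))
     (\<lambda>x y. g (fst x) (fst y) (colour Q x y) - (\<Sum>z<Q. g (fst x) (fst y) z) / Q) \<epsilon>"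
proof -
  let ?V = "blowup N S Q"
  define w where "w = 1 / real (card ?V)"
  have card: "real (card ?V) = real N * real S * real Q ^ S" by (simp add: card_blowup)
  have w: "0 < w" "w * real N * real S * real Q ^ S = 1"
    unfolding w_def card using pos by (simp_all add: nonzero_eq_divide_eq mult_ac)
  interpret finite_prob ?V "\<lambda>_. w"
  proof unfold_locales
    show "(\<Sum>x\<in>?V. w) = 1" using w(2) by (simp add: card mult_ac)
  qed (use w in auto)
  define G where "G a c z = g a c z - (\<Sum>z<Q. g a c z) / Q" for a c z
  define D where "D x y = G (fst x) (fst y) (colour Q x y)" for x y
  have sumG: "(\<Sum>z<Q. G a c z) = 0" for a c using pos by (simp add: G_def sum_subtractf)
  have G: "\<bar>G a c z\<bar> \<le> 2" for a c z
  proof -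
    have "\<bar>\<Sum>z<Q. g a c z\<bar> \<le> (\<Sum>z<Q. 1)" by (intro order_trans[OF sum_abs] sum_mono g)
    then have "\<bar>(\<Sum>z<Q. g a c z) / Q\<bar> \<le> 1" using pos by (simp add: field_simps)
    then show ?thesis using g[of a c z] unfolding G_def by linarith
  qed
  have indep: "(\<Sum>x\<in>?V. D x y * D x z) = 0"
    if yz: "y \<in> ?V" "z \<in> ?V" "fst (snd y) \<noteq> fst (snd z)" for y z
  proof -
    obtain b t \<psi> b' t' \<psi>' where y: "y = (b, t, \<psi>)" and z: "z = (b', t', \<psi>')" by (cases y; cases z) auto
    define M where "M = {..<S} - {t}"
    have M: "{..<S} = insert t M" "t \<notin> M" "t \<noteq> t'" using yz by (auto simp: y z blowup_def M_def)
    have "(\<Sum>\<phi>\<in>{..<S} \<rightarrow>\<^sub>E {..<Q}. D (a, s, \<phi>) y * D (a, s, \<phi>) z) = 0" for a s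
    proof -
      have "(\<Sum>\<phi>\<in>{..<S} \<rightarrow>\<^sub>E {..<Q}. D (a, s, \<phi>) y * D (a, s, \<phi>) z) =
         (\<Sum>\<phi>\<in>M \<rightarrow>\<^sub>E {..<Q}. \<Sum>r<Q. G a b ((r + \<psi> s) mod Q) * G a b' ((\<phi> t' + \<psi>' s) mod Q))"
        using M(3) unfolding M(1) sum_PiE_insert[OF M(2)]
        by (intro sum.cong refl) (simp add: D_def y z)
      also have "\<dots> = 0"
        by (simp add: sum_distrib_right[symmetric] sum_shift_mod[of "G a b" "\<psi> _" Q] sumG)
      finally show ?thesis .
    qed
    moreover have "(\<Sum>x\<in>?V. f x) = (\<Sum>a<N. \<Sum>s<S. \<Sum>\<phi>\<in>{..<S} \<rightarrow>\<^sub>E {..<Q}. f (a, s, \<phi>))"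
      for f :: "bnode \<Rightarrow> real"
      by (simp add: blowup_def sum.cartesian_product split_beta)
    ultimately show ?thesis by simp
  qed
  have bound: "\<bar>\<Sum>x\<in>?V. w * (D x y * D x z)\<bar> \<le> (if fst (snd z) = fst (snd y) then 4 else 0)"
    if "y \<in> ?V" "z \<in> ?V" for y z
  proof (cases "fst (snd z) = fst (snd y)")
    case True
    have "\<bar>\<Sum>x\<in>?V. w * (D x y * D x z)\<bar> \<le> (\<Sum>x\<in>?V. w * 4)"
    proof (intro order_trans[OF sum_abs] sum_mono)
      fix x
      have "\<bar>D x y * D x z\<bar> \<le> 2 * 2" unfolding abs_mult D_def by (intro mult_mono G) auto
      then show "\<bar>w * (D x y * D x z)\<bar> \<le> w * 4" using w(1) by (simp add: abs_mult)
    qed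
    also have "\<dots> = 4" using total by (simp add: sum_distrib_right[symmetric] del: sum_constant)
    finally show ?thesis using True by simp
  next
    case False
    then show ?thesis using indep[of y z] that by (simp add: sum_distrib_left[symmetric])
  qed
  have inner: "(\<Sum>z\<in>?V. w * w * \<bar>\<Sum>x\<in>?V. w * (D x y * D x z)\<bar>) \<le> w * (4 / S)"
    if y: "y \<in> ?V" for y
  proof -
    have yS: "fst (snd y) < S" using y unfolding blowup_def by (metis SigmaE lessThan_iff fst_conv snd_conv)
    have "(\<Sum>z\<in>?V. w * w * \<bar>\<Sum>x\<in>?V. w * (D x y * D x z)\<bar>) \<le>
        (\<Sum>z\<in>?V. w * w * (if fst (snd z) = fst (snd y) then 4 else 0))"
      using w(1) y by (intro sum_mono mult_left_mono bound) auto
    also have "\<dots> = w * w * (\<Sum>z\<in>?V. if fst (snd z) = fst (snd y) then 4 else 0)"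
      by (simp only: sum_distrib_left)
    also have "(\<Sum>z\<in>?V. if fst (snd z) = fst (snd y) then 4 else 0 :: real) =
        4 * real (card {z\<in>?V. fst (snd z) = fst (snd y)})"
      by (simp add: sum.If_cases Int_def)
    also have "w * w * (4 * real (card {z\<in>?V. fst (snd z) = fst (snd y)})) = w * (4 / S)"
    proof -
      have "w * (real N * real Q ^ S) = 1 / S"
        using w(2) pos by (simp add: nonzero_eq_divide_eq mult_ac)
      moreover have "w * w * (4 * real (N * Q ^ S)) = w * 4 * (w * (real N * real Q ^ S))" by simp
      ultimately show ?thesis unfolding card_blowup_index[OF yS] by simp
    qed
    finally show ?thesis .
  qed
  have "(\<Sum>y\<in>?V. \<Sum>z\<in>?V. w * w * \<bar>\<Sum>x\<in>?V. w * (D x y * D x z)\<bar>) \<le> (\<Sum>y\<in>?V. w * (4 / S))"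
    by (rule sum_mono) (rule inner)
  also have "\<dots> = 4 / S" using total by (simp only: sum_distrib_right[symmetric] mult_1_left)
  also have "\<dots> \<le> \<epsilon>\<^sup>2" by (rule \<epsilon>)
  finally have D: "(\<Sum>y\<in>?V. \<Sum>z\<in>?V. w * w * \<bar>\<Sum>x\<in>?V. w * (D x y * D x z)\<bar>) \<le> \<epsilon>\<^sup>2" .
  have "cut_le ?V (\<lambda>_. w) D \<epsilon>" by (rule cut_le_second_moment[OF \<epsilon>(1) D])
  then show ?thesis unfolding D_def G_def w_def .
qed

section \<open>Densities of kernel families on the unit interval\<close>

text \<open>
  Lebesgue measure on \<open>[0, 1]\<close> and on the unit square, restricted to the Borel sets. Borel versions of the kernels
  make it possible to use product measures instead of their completions.
\<close>

abbreviation I01 :: "real measure" where "I01 \<equiv> restrict_space lborel {0..1}"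

abbreviation SQ :: "(real \<times> real) measure" where "SQ \<equiv> I01 \<Otimes>\<^sub>M I01"

text \<open>
  The density of a multigraph in a kernel family on \<open>[0, 1]\<close>; as before, \<open>b k\<close> is used for the pairs of nodes
  that are joined by exactly \<open>k\<close> edges.
\<close>

definition graph_dens :: "multigraph \<Rightarrow> (nat \<Rightarrow> real \<Rightarrow> real \<Rightarrow> real) \<Rightarrow> real" where
  "graph_dens F b = (\<integral>x. (\<Prod>(i, j)\<in>node_pairs F. b (edge_mult F i j) (x i) (x j))
     \<partial>(\<Pi>\<^sub>M i\<in>nodes F. I01))"

lemma prob_space_I01: "prob_space I01"
  by (rule prob_space_restrict_space) auto

lemma space_I01 [simp]: "space I01 = {0..1}"
  by (simp add: space_restrict_space)

interpretation I01: prob_space I01 by (rule prob_space_I01)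
interpretation SQ: pair_prob_space I01 I01 ..
interpretation PI01: product_prob_space "\<lambda>_::nat. I01" "UNIV" ..

lemma space_SQ: "space SQ = {0..1} \<times> {0..1}"
  by (simp add: space_pair_measure)

lemma measurable_SQ_ident: "(\<lambda>p. p) \<in> SQ \<rightarrow>\<^sub>M borel"
proof -
  have [measurable]: "(\<lambda>x. x) \<in> I01 \<rightarrow>\<^sub>M borel" by (rule measurable_restrict_space1) simp
  have "(\<lambda>p. (fst p, snd p)) \<in> SQ \<rightarrow>\<^sub>M borel \<Otimes>\<^sub>M borel"
    by (intro measurable_Pair measurable_compose[OF measurable_fst] measurable_compose[OF measurable_snd])
       (rule measurable_restrict_space1, simp)+
  then show ?thesis by (simp add: borel_prod)
qed

lemma borel_measurable_SQ: "f \<in> borel_measurable borel \<Longrightarrow> f \<in> borel_measurable SQ"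
  using measurable_compose[OF measurable_SQ_ident] by blast

lemma distr_SQ: "distr SQ borel (\<lambda>p. p) = density lborel (indicator ({0..1} \<times> {0..1}))"
proof (rule measure_eqI)
  fix A assume "A \<in> sets (distr SQ borel (\<lambda>p. p))"
  then have A: "A \<in> sets borel" by simp
  have A': "A \<inter> space SQ \<in> sets SQ"
    using measurable_sets[OF measurable_SQ_ident A] by (simp add: vimage_def Int_def)
  have sq: "{0..1} \<times> {0..1} \<in> sets (borel :: (real \<times> real) measure)"
    by (intro borel_closed closed_Times) auto
  have m: "A \<inter> {0..1} \<times> {0..1} \<in> sets (lborel \<Otimes>\<^sub>M lborel)"
    unfolding lborel_prod using A sq by simp
  have "emeasure SQ (A \<inter> space SQ) = (\<integral>\<^sup>+x. emeasure I01 (Pair x -` (A \<inter> space SQ)) \<partial>I01)"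
    by (rule I01.emeasure_pair_measure_alt[OF A'])
  also have "\<dots> = (\<integral>\<^sup>+x. emeasure lborel (Pair x -` (A \<inter> {0..1} \<times> {0..1})) * indicator {0..1} x \<partial>lborel)"
    by (subst nn_integral_restrict_space, simp, intro nn_integral_cong, unfold space_SQ,
        subst emeasure_restrict_space) (auto split: split_indicator)
  also have "\<dots> = (\<integral>\<^sup>+x. emeasure lborel (Pair x -` (A \<inter> {0..1} \<times> {0..1})) \<partial>lborel)"
    by (intro nn_integral_cong) (auto split: split_indicator)
  also have "\<dots> = emeasure (lborel \<Otimes>\<^sub>M lborel) (A \<inter> {0..1} \<times> {0..1})"
    by (rule lborel.emeasure_pair_measure_alt[OF m, symmetric])
  also have "\<dots> = emeasure (density lborel (indicator ({0..1} \<times> {0..1}))) A"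
    using A sq by (subst emeasure_density) (auto simp: lborel_prod nn_integral_indicator[symmetric]
        indicator_inter_arith mult.commute simp del: nn_integral_indicator)
  finally show "emeasure (distr SQ borel (\<lambda>p. p)) A = emeasure (density lborel (indicator ({0..1} \<times> {0..1}))) A"
    using A measurable_SQ_ident by (simp add: emeasure_distr)
qed simp

lemma AE_lborel_imp_AE_SQ:
  assumes "AE p in lborel. p \<in> {0..1} \<times> {0..1} \<longrightarrow> P p"
  shows "AE p in SQ. P p"
proof -
  have sq: "{0..1} \<times> {0..1} \<in> sets (borel :: (real \<times> real) measure)"
    by (intro borel_closed closed_Times) auto
  have "AE p in density lborel (indicator ({0..1} \<times> {0..1})). P p"
    using assms sq by (subst AE_density) (auto simp: indicator_def elim: eventually_mono)
  then have "AE p in distr SQ borel (\<lambda>p. p). P p" by (simp only: distr_SQ)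
  then show ?thesis using measurable_SQ_ident by (auto dest: AE_distrD)
qed

lemma distr_two_coords:
  fixes N :: "nat set"
  assumes N: "finite N" "i \<in> N" "j \<in> N" "i \<noteq> j"
  shows "distr (\<Pi>\<^sub>M i\<in>N. I01) SQ (\<lambda>x. (x i, x j)) = SQ"
proof -
  let ?f = "\<lambda>b. if b then i else j"
  have eq: "(\<lambda>x::nat \<Rightarrow> real. (x i, x j)) = (\<lambda>y. (y True, y False)) \<circ> (\<lambda>\<omega>. \<lambda>n\<in>UNIV. \<omega> (?f n))"
    by (simp add: fun_eq_iff)
  have "distr (\<Pi>\<^sub>M i\<in>N. I01) SQ (\<lambda>x. (x i, x j)) =
      distr (distr (\<Pi>\<^sub>M i\<in>N. I01) (\<Pi>\<^sub>M b\<in>UNIV. I01) (\<lambda>\<omega>. \<lambda>n\<in>UNIV. \<omega> (?f n))) SQ (\<lambda>y. (y True, y False))"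
    unfolding eq using N
    by (subst distr_distr)
       (auto intro!: measurable_Pair measurable_component_singleton measurable_PiM_single')
  also have "distr (\<Pi>\<^sub>M i\<in>N. I01) (\<Pi>\<^sub>M b\<in>UNIV. I01) (\<lambda>\<omega>. \<lambda>n\<in>UNIV. \<omega> (?f n)) = (\<Pi>\<^sub>M b\<in>UNIV. I01)"
    using N by (intro distr_PiM_reindex) (auto simp: inj_on_def prob_space_I01)
  also have "distr (\<Pi>\<^sub>M b\<in>UNIV. I01) SQ (\<lambda>y. (y True, y False)) = SQ"
  proof -
    have "case_bool I01 I01 = (\<lambda>_. I01)" by (auto simp: fun_eq_iff split: bool.split)
    then show ?thesis
      using pair_measure_eq_distr_PiM[OF I01.sigma_finite_measure_axioms I01.sigma_finite_measure_axioms]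
      by simp
  qed
  finally show ?thesis .
qed

lemma measurable_two_coords:
  "i \<in> N \<Longrightarrow> j \<in> N \<Longrightarrow> (\<lambda>x. (x i, x j)) \<in> (\<Pi>\<^sub>M i\<in>N. I01) \<rightarrow>\<^sub>M SQ"
  by (intro measurable_Pair measurable_component_singleton)

lemma AE_two_coords:
  fixes N :: "nat set"
  assumes "finite N" "i \<in> N" "j \<in> N" "i \<noteq> j" and P: "AE p in SQ. P p"
  shows "AE x in (\<Pi>\<^sub>M i\<in>N. I01). P (x i, x j)"
  using P measurable_two_coords[OF assms(2,3)]
  by (subst (asm) distr_two_coords[OF assms(1-4), symmetric]) (rule AE_distrD)

lemma graph_dens_measurable:
  fixes b :: "nat \<Rightarrow> real \<Rightarrow> real \<Rightarrow> real"
  assumes "\<And>k. (\<lambda>p. b k (fst p) (snd p)) \<in> borel_measurable SQ"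
  shows "(\<lambda>x. \<Prod>(i, j)\<in>node_pairs F. b (edge_mult F i j) (x i) (x j))
    \<in> borel_measurable (\<Pi>\<^sub>M i\<in>nodes F. I01)"
proof (rule borel_measurable_prod)
  fix q assume "q \<in> node_pairs F"
  then obtain i j where q: "q = (i, j)" "i \<in> nodes F" "j \<in> nodes F" by (auto simp: node_pairs_def)
  show "(\<lambda>x. case q of (i, j) \<Rightarrow> b (edge_mult F i j) (x i) (x j)) \<in> borel_measurable (\<Pi>\<^sub>M i\<in>nodes F. I01)"
    using measurable_compose[OF measurable_two_coords[OF q(2,3)] assms[of "edge_mult F i j"]]
    by (simp add: q)
qed

text \<open>
  A product of factors in \<open>[-1, 1]\<close> changes by at most the sum of the changes of the factors, and two coordinates of a random
  point of the cube are a random point of the square.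
\<close>

theorem graph_dens_L1:
  fixes b b' :: "nat \<Rightarrow> real \<Rightarrow> real \<Rightarrow> real"
  assumes m: "\<And>k. (\<lambda>p. b k (fst p) (snd p)) \<in> borel_measurable SQ"
      "\<And>k. (\<lambda>p. b' k (fst p) (snd p)) \<in> borel_measurable SQ"
    and b: "\<And>k x y. \<bar>b k x y\<bar> \<le> 1" "\<And>k x y. \<bar>b' k x y\<bar> \<le> 1"
  shows "\<bar>graph_dens F b - graph_dens F b'\<bar> \<le>
    (\<Sum>(i, j)\<in>node_pairs F. \<integral>p. \<bar>b (edge_mult F i j) (fst p) (snd p) - b' (edge_mult F i j) (fst p) (snd p)\<bar> \<partial>SQ)"
proof -
  let ?M = "\<Pi>\<^sub>M i\<in>nodes F. I01"
  interpret M: prob_space ?M by (rule prob_space_PiM) (rule prob_space_I01)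
  let ?p = "\<lambda>b x. \<Prod>(i, j)\<in>node_pairs F. b (edge_mult F i j) (x i) (x j)"
  define D where "D q p = \<bar>b (edge_mult F (fst q) (snd q)) (fst p) (snd p) -
      b' (edge_mult F (fst q) (snd q)) (fst p) (snd p)\<bar>" for q p
  have Dm: "D q \<in> borel_measurable SQ" for q
    unfolding D_def by (intro borel_measurable_abs borel_measurable_diff m)
  have D2: "\<bar>D q p\<bar> \<le> 2" for q p
    unfolding D_def using b(1)[of "edge_mult F (fst q) (snd q)" "fst p" "snd p"]
      b(2)[of "edge_mult F (fst q) (snd q)" "fst p" "snd p"] by linarith
  have p1: "\<bar>?p b x\<bar> \<le> 1" if "\<And>k x y. \<bar>b k x y\<bar> \<le> 1" for b :: "nat \<Rightarrow> real \<Rightarrow> real \<Rightarrow> real" and x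
    using that by (intro abs_prod_le_1) auto
  have "integrable ?M (?p h)"
    if h: "\<And>k. (\<lambda>p. h k (fst p) (snd p)) \<in> borel_measurable SQ" "\<And>k x y. \<bar>h k x y\<bar> \<le> 1"
    for h :: "nat \<Rightarrow> real \<Rightarrow> real \<Rightarrow> real"
  proof (rule M.integrable_const_bound[of _ 1])
    show "AE x in ?M. norm (?p h x) \<le> 1" using p1[of h, OF h(2)] by (simp del: abs_prod)
    show "?p h \<in> borel_measurable ?M" by (rule graph_dens_measurable) (rule h)
  qed
  then have int: "integrable ?M (?p b)" "integrable ?M (?p b')" using m b by blast+
  have Dq: "integrable ?M (\<lambda>x. D q (x (fst q), x (snd q)))"
    "(\<integral>x. D q (x (fst q), x (snd q)) \<partial>?M) = (\<integral>p. D q p \<partial>SQ)" if q: "q \<in> node_pairs F" for q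
  proof -
    have q': "fst q \<in> nodes F" "snd q \<in> nodes F" "fst q \<noteq> snd q" using q by (auto simp: node_pairs_def)
    note m2 = measurable_two_coords[OF q'(1,2)]
    show "integrable ?M (\<lambda>x. D q (x (fst q), x (snd q)))"
      by (rule M.integrable_const_bound[of _ 2]) (use D2 measurable_compose[OF m2 Dm] in auto)
    show "(\<integral>x. D q (x (fst q), x (snd q)) \<partial>?M) = (\<integral>p. D q p \<partial>SQ)"
      by (subst distr_two_coords[OF finite_nodes q', symmetric], subst integral_distr[OF m2 Dm]) simp
  qed
  have "\<bar>graph_dens F b - graph_dens F b'\<bar> = \<bar>\<integral>x. ?p b x - ?p b' x \<partial>?M\<bar>"
    unfolding graph_dens_def by (subst Bochner_Integration.integral_diff[OF int]) simp
  also have "\<dots> \<le> (\<integral>x. \<bar>?p b x - ?p b' x\<bar> \<partial>?M)" by (rule integral_abs_bound)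
  also have "\<dots> \<le> (\<integral>x. (\<Sum>q\<in>node_pairs F. D q (x (fst q), x (snd q))) \<partial>?M)"
  proof (rule integral_mono)
    show "integrable ?M (\<lambda>x. \<bar>?p b x - ?p b' x\<bar>)" using int by auto
    show "integrable ?M (\<lambda>x. \<Sum>q\<in>node_pairs F. D q (x (fst q), x (snd q)))"
      using Dq(1) by (rule Bochner_Integration.integrable_sum)
    fix x
    show "\<bar>?p b x - ?p b' x\<bar> \<le> (\<Sum>q\<in>node_pairs F. D q (x (fst q), x (snd q)))"
      using norm_prod_diff[of "node_pairs F" "\<lambda>(i, j). b (edge_mult F i j) (x i) (x j)"
          "\<lambda>(i, j). b' (edge_mult F i j) (x i) (x j)"] b
      by (simp add: D_def case_prod_beta)
  qed
  also have "\<dots> = (\<Sum>q\<in>node_pairs F. \<integral>p. D q p \<partial>SQ)"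
    using Dq by (subst Bochner_Integration.integral_sum) auto
  finally show ?thesis by (simp add: D_def case_prod_beta)
qed

text \<open>A step kernel has the density of the finite kernel family given by its steps.\<close>

theorem graph_dens_step:
  fixes b :: "nat \<Rightarrow> nat \<Rightarrow> nat \<Rightarrow> real"
  assumes c: "c \<in> I01 \<rightarrow>\<^sub>M count_space UNIV" "\<And>x. x \<in> {0..1} \<Longrightarrow> c x < M"
    and w: "\<And>a. a < M \<Longrightarrow> measure I01 {x\<in>{0..1}. c x = a} = w a"
  shows "graph_dens F (\<lambda>k x y. b k (c x) (c y)) = fin_dens F {..<M} w b"
proof -
  let ?N = "nodes F"
  let ?M = "\<Pi>\<^sub>M i\<in>?N. I01"
  interpret M: prob_space ?M by (rule prob_space_PiM) (rule prob_space_I01)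
  define g where "g \<phi> = (\<Prod>(i, j)\<in>node_pairs F. b (edge_mult F i j) (\<phi> i) (\<phi> j))" for \<phi> :: "nat \<Rightarrow> nat"
  define I where "I a x = indicat_real {x\<in>{0..1}. c x = a} x" for a x
  have set: "{x\<in>{0..1}. c x = a} \<in> sets I01" for a
    using measurable_sets[OF c(1), of "{a}"] by (simp add: vimage_def Int_def conj_commute)
  have I: "integrable I01 (I a)" for a
    unfolding I_def by (rule integrable_real_indicator) (use set in \<open>auto simp: I01.emeasure_eq_measure\<close>)
  have Iw: "(\<integral>x. I a x \<partial>I01) = w a" if "a < M" for a
  proof -
    have "{x\<in>{0..1}. c x = a} \<inter> {0..1} = {x\<in>{0..1}. c x = a}" by auto
    then show ?thesis using w[OF that] by (simp only: I_def Bochner_Integration.integral_indicator space_I01)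
  qed
  have "graph_dens F (\<lambda>k x y. b k (c x) (c y)) = (\<integral>x. (\<Sum>\<phi>\<in>?N \<rightarrow>\<^sub>E {..<M}. (\<Prod>i\<in>?N. I (\<phi> i) (x i)) * g \<phi>) \<partial>?M)"
    unfolding graph_dens_def
  proof (rule Bochner_Integration.integral_cong[OF refl])
    fix x assume "x \<in> space ?M"
    then have x: "\<And>i. i \<in> ?N \<Longrightarrow> x i \<in> {0..1}" by (auto simp: space_PiM PiE_iff)
    let ?\<phi> = "\<lambda>i\<in>?N. c (x i)"
    have "(\<Sum>\<phi>\<in>?N \<rightarrow>\<^sub>E {..<M}. (\<Prod>i\<in>?N. I (\<phi> i) (x i)) * g \<phi>) =
        (\<Sum>\<phi>\<in>?N \<rightarrow>\<^sub>E {..<M}. if \<phi> = ?\<phi> then g \<phi> else 0)"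
    proof (intro sum.cong refl)
      fix \<phi> assume \<phi>: "\<phi> \<in> ?N \<rightarrow>\<^sub>E {..<M}"
      show "(\<Prod>i\<in>?N. I (\<phi> i) (x i)) * g \<phi> = (if \<phi> = ?\<phi> then g \<phi> else 0)"
      proof (cases "\<phi> = ?\<phi>")
        case True
        then show ?thesis using x by (simp add: I_def)
      next
        case False
        then obtain i where "i \<in> ?N" "\<phi> i \<noteq> c (x i)"
          using \<phi> by (metis PiE_restrict restrict_ext)
        then have "(\<Prod>i\<in>?N. I (\<phi> i) (x i)) = 0"
          by (intro prod_zero bexI[of _ i]) (simp_all add: I_def)
        then show ?thesis using False by simp
      qed
    qed
    also have "\<dots> = g ?\<phi>" using x c(2) by (subst sum.delta) (auto intro!: finite_PiE simp: restrict_PiE_iff)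
    also have "\<dots> = (\<Prod>(i, j)\<in>node_pairs F. b (edge_mult F i j) (c (x i)) (c (x j)))"
      unfolding g_def by (intro prod.cong) (auto simp: node_pairs_def)
    finally show "(\<Prod>(i, j)\<in>node_pairs F. b (edge_mult F i j) (c (x i)) (c (x j))) =
        (\<Sum>\<phi>\<in>?N \<rightarrow>\<^sub>E {..<M}. (\<Prod>i\<in>?N. I (\<phi> i) (x i)) * g \<phi>)" by simp
  qed
  also have "\<dots> = (\<Sum>\<phi>\<in>?N \<rightarrow>\<^sub>E {..<M}. (\<integral>x. (\<Prod>i\<in>?N. I (\<phi> i) (x i)) \<partial>?M) * g \<phi>)"
    by (subst Bochner_Integration.integral_sum)
       (auto intro!: PI01.product_integrable_prod I)
  also have "\<dots> = (\<Sum>\<phi>\<in>?N \<rightarrow>\<^sub>E {..<M}. (\<Prod>i\<in>?N. w (\<phi> i)) * g \<phi>)"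
    by (intro sum.cong refl arg_cong2[where f = "(*)"], subst PI01.product_integral_prod)
       (auto intro!: I Iw prod.cong simp: PiE_iff)
  finally show ?thesis by (simp add: fin_dens_def g_def)
qed

lemma borel_measurable_SQ_step:
  fixes G :: "nat \<Rightarrow> nat \<Rightarrow> real"
  assumes c: "c \<in> I01 \<rightarrow>\<^sub>M count_space UNIV"
  shows "(\<lambda>p. G (c (fst p)) (c (snd p))) \<in> borel_measurable SQ"
proof -
  have "(\<lambda>p. (c (fst p), c (snd p))) \<in> SQ \<rightarrow>\<^sub>M count_space UNIV \<Otimes>\<^sub>M count_space UNIV"
    by (intro measurable_Pair measurable_compose[OF measurable_fst c] measurable_compose[OF measurable_snd c])
  then have "(\<lambda>p. (c (fst p), c (snd p))) \<in> SQ \<rightarrow>\<^sub>M count_space UNIV"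
    by (simp add: pair_measure_countable)
  from measurable_compose[OF this, of "\<lambda>(a, c). G a c" borel] show ?thesis by simp
qed

lemma integral_SQ_step:
  fixes c :: "real \<Rightarrow> nat"
  assumes c: "c \<in> I01 \<rightarrow>\<^sub>M count_space UNIV" "\<And>x. x \<in> {0..1} \<Longrightarrow> c x < M"
    and w: "\<And>a. a < M \<Longrightarrow> measure I01 {x\<in>{0..1}. c x = a} = w a"
  shows "(\<integral>p. G (c (fst p)) (c (snd p)) \<partial>SQ) = (\<Sum>a<M. \<Sum>e<M. w a * w e * G a e :: real)"
proof -
  define A where "A a = {x\<in>{0..1}. c x = a}" for a
  have set: "A a \<in> sets I01" for a
    using measurable_sets[OF c(1), of "{a}"] by (simp add: vimage_def Int_def conj_commute A_def)
  have "(\<integral>p. G (c (fst p)) (c (snd p)) \<partial>SQ) =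
      (\<integral>p. (\<Sum>a<M. \<Sum>e<M. indicator (A a \<times> A e) p * G a e) \<partial>SQ)"
  proof (rule Bochner_Integration.integral_cong[OF refl])
    fix p assume "p \<in> space SQ"
    then have p: "fst p \<in> {0..1}" "snd p \<in> {0..1}" unfolding space_SQ by auto
    have "(\<Sum>a<M. \<Sum>e<M. indicator (A a \<times> A e) p * G a e) =
        (\<Sum>a<M. if c (fst p) = a then (\<Sum>e<M. if c (snd p) = e then G a e else 0) else 0)"
      using p by (intro sum.cong refl) (auto simp: A_def indicator_def mem_Times_iff intro!: sum.cong)
    also have "\<dots> = G (c (fst p)) (c (snd p))"
      using c(2)[OF p(1)] c(2)[OF p(2)] by (simp add: sum.delta')
    finally show "G (c (fst p)) (c (snd p)) = (\<Sum>a<M. \<Sum>e<M. indicator (A a \<times> A e) p * G a e)" by simp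
  qed
  also have "\<dots> = (\<Sum>a<M. \<Sum>e<M. measure SQ (A a \<times> A e) * G a e)"
  proof -
    have set2: "A a \<times> A e \<in> sets SQ" for a e by (intro pair_measureI set)
    have int: "integrable SQ (\<lambda>p. indicat_real (A a \<times> A e) p * G a e)" for a e
      using set2 by (intro integrable_mult_left integrable_real_indicator)
        (auto simp: SQ.emeasure_eq_measure)
    have val: "(\<integral>p. indicat_real (A a \<times> A e) p * G a e \<partial>SQ) = measure SQ (A a \<times> A e) * G a e" for a e
      using sets.sets_into_space[OF set2, of a e]
      by (simp only: integral_mult_left_zero Bochner_Integration.integral_indicator Int_absorb2)
    show ?thesis
      using int by (simp only: Bochner_Integration.integral_sum Bochner_Integration.integrable_sum val)
  qed
  also have "\<dots> = (\<Sum>a<M. \<Sum>e<M. w a * w e * G a e)"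
  proof (intro sum.cong refl)
    fix a e assume "a \<in> {..<M}" "e \<in> {..<M}"
    then show "measure SQ (A a \<times> A e) * G a e = w a * w e * G a e"
      using w[folded A_def, of a] w[folded A_def, of e] set
      by (simp add: measure_def I01.emeasure_pair_measure_Times enn2real_mult)
  qed
  finally show ?thesis .
qed

section \<open>Borel versions of the moments of a graphon\<close>

text \<open>Clamping to \<open>[l, u]\<close> makes the bounds hold everywhere.\<close>

lemma borel_version_on_square:
  fixes f :: "real \<times> real \<Rightarrow> real"
  assumes f: "f \<in> borel_measurable (lebesgue_on ({0..1} \<times> {0..1}))"
    and bd: "\<And>p. p \<in> {0..1} \<times> {0..1} \<Longrightarrow> l \<le> f p \<and> f p \<le> u" and lu: "l \<le> u"
  obtains g where "g \<in> borel_measurable borel" "\<And>p. l \<le> g p \<and> g p \<le> u" "AE p in SQ. f p = g p"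
proof -
  have sq: "{0..1} \<times> {0..1} \<in> sets (borel :: (real \<times> real) measure)"
    by (intro borel_closed closed_Times) auto
  have "(\<lambda>p. if p \<in> {0..1} \<times> {0..1} then f p else 0) \<in> borel_measurable lebesgue"
    using f sq by (intro borel_measurable_if_I) auto
  from completion_ex_borel_measurable_real[OF this] obtain g where g: "g \<in> borel_measurable lborel"
    "AE p in lborel. (if p \<in> {0..1} \<times> {0..1} then f p else 0) = g p" by blast
  show thesis
  proof (rule that)
    show "(\<lambda>p. max l (min u (g p))) \<in> borel_measurable borel" using g(1) by simp
    show "l \<le> max l (min u (g p)) \<and> max l (min u (g p)) \<le> u" for p using lu by auto
    show "AE p in SQ. f p = max l (min u (g p))"
    proof (rule AE_lborel_imp_AE_SQ)
      show "AE p in lborel. p \<in> {0..1} \<times> {0..1} \<longrightarrow> f p = max l (min u (g p))"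
        using g(2)
      proof eventually_elim
        case (elim p)
        then show ?case using bd[of p] by auto
      qed
    qed
  qed
qed

text \<open>
  Measurability of \<open>f\<close> is not assumed; it follows because all subsets of null sets are measurable in the completion.
\<close>

lemma integral_completion_AE:
  fixes f g :: "'a \<Rightarrow> real"
  assumes g: "g \<in> borel_measurable M" and eq: "AE x in M. f x = g x"
  shows "integral\<^sup>L (completion M) f = integral\<^sup>L M g"
proof -
  from eq obtain N where N: "{x\<in>space M. f x \<noteq> g x} \<subseteq> N" "N \<in> null_sets M"
    by (auto elim!: AE_E simp: null_sets_def)
  have "f \<in> borel_measurable (completion M)"
  proof (rule measurableI)
    fix A :: "real set" assume A: "A \<in> sets borel"
    have "f -` A \<inter> space M = (g -` A \<inter> space M - N) \<union> (f -` A \<inter> space M \<inter> N)"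
      using N(1) by auto
    moreover have "g -` A \<inter> space M - N \<in> sets (completion M)"
      using measurable_sets[OF g A] N(2) by auto
    moreover have "f -` A \<inter> space M \<inter> N \<in> sets (completion M)"
      using N(2) by (rule null_sets_completion) auto
    ultimately have "f -` A \<inter> space M \<in> sets (completion M)" by (metis sets.Un)
    then show "f -` A \<inter> space (completion M) \<in> sets (completion M)" by simp
  qed simp
  then have "integral\<^sup>L (completion M) f = integral\<^sup>L (completion M) g"
    using g AE_completion[OF eq] by (intro integral_cong_AE) (auto intro: measurable_completion)
  then show ?thesis using integral_completion[OF g] by simp
qed

text \<open>
  The density of a graphon can be computed from Borel kernels that agree almost everywhere with its
  moments, up to normalisation by powers of \<open>c\<close>.
\<close>

theorem t_graphon_eq_graph_dens:
  assumes b: "\<And>k. (\<lambda>p. b k (fst p) (snd p)) \<in> borel_measurable SQ"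
    and eq: "\<And>k. AE p in SQ. moment k W (fst p) (snd p) = c ^ k * b k (fst p) (snd p)"
  shows "t_graphon F W = c ^ edge_count F * graph_dens F b"
proof -
  let ?M = "\<Pi>\<^sub>M i\<in>nodes F. I01"
  have "AE x in ?M. \<forall>q\<in>node_pairs F. moment (edge_mult F (fst q) (snd q)) W (x (fst q)) (x (snd q)) =
      c ^ edge_mult F (fst q) (snd q) * b (edge_mult F (fst q) (snd q)) (x (fst q)) (x (snd q))"
  proof (rule AE_finite_allI[OF finite_node_pairs])
    fix q assume "q \<in> node_pairs F"
    then have q: "fst q \<in> nodes F" "snd q \<in> nodes F" "fst q \<noteq> snd q" by (auto simp: node_pairs_def)
    show "AE x in ?M. moment (edge_mult F (fst q) (snd q)) W (x (fst q)) (x (snd q)) =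
      c ^ edge_mult F (fst q) (snd q) * b (edge_mult F (fst q) (snd q)) (x (fst q)) (x (snd q))"
      using AE_two_coords[OF finite_nodes q eq[of "edge_mult F (fst q) (snd q)"]] by simp
  qed
  then have "AE x in ?M. (\<Prod>(i, j)\<in>node_pairs F. moment (edge_mult F i j) W (x i) (x j)) =
      c ^ edge_count F * (\<Prod>(i, j)\<in>node_pairs F. b (edge_mult F i j) (x i) (x j))"
  proof eventually_elim
    case (elim x)
    then show ?case unfolding prod_power_edge_count[symmetric] by (intro prod.cong refl) auto
  qed
  then have "t_graphon F W = (\<integral>x. c ^ edge_count F * (\<Prod>(i, j)\<in>node_pairs F. b (edge_mult F i j) (x i) (x j)) \<partial>?M)"
    unfolding t_graphon_def lebesgue_cube_def
    by (intro integral_completion_AE borel_measurable_times graph_dens_measurable b) auto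
  then show ?thesis by (simp add: graph_dens_def)
qed

section \<open>Moment sequences and measurability of graphons\<close>

text \<open>Moment sequences of probability measures on \<open>[-d, d]\<close>, normalised to have values in \<open>[-1, 1]\<close>.\<close>

definition moment_seq :: "real \<Rightarrow> (nat \<Rightarrow> real) \<Rightarrow> bool" where
  "moment_seq d z \<longleftrightarrow> (\<exists>\<mu>\<in>prob_measures d. \<forall>k. (\<integral>s. s ^ k \<partial>\<mu>) = d ^ k * z k)"

lemma prob_measuresD:
  assumes "\<mu> \<in> prob_measures d"
  shows "prob_space \<mu>" "sets \<mu> = sets (restrict_space borel {-d..d})" "space \<mu> = {-d..d}"
proof -
  show *: "prob_space \<mu>" "sets \<mu> = sets (restrict_space borel {-d..d})"
    using assms by (auto simp: prob_measures_def)
  show "space \<mu> = {-d..d}" using sets_eq_imp_space_eq[OF *(2)] by (simp add: space_restrict_space)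
qed

lemma integrable_prob_measures:
  fixes f :: "real \<Rightarrow> real"
  assumes \<mu>: "\<mu> \<in> prob_measures d" and f: "continuous_on {-d..d} f"
  shows "integrable \<mu> f"
proof -
  interpret prob_space \<mu> using prob_measuresD[OF \<mu>] by blast
  have "compact (f ` {-d..d})" using f by (intro compact_continuous_image) auto
  then obtain B where B: "\<And>s. s \<in> {-d..d} \<Longrightarrow> norm (f s) \<le> B"
    by (meson bounded_iff compact_imp_bounded imageI)
  have "f \<in> borel_measurable \<mu>"
    using borel_measurable_continuous_on_restrict[OF f] prob_measuresD(2)[OF \<mu>]
    by (simp cong: measurable_cong_sets)
  then show ?thesis
    using B prob_measuresD(3)[OF \<mu>] by (intro integrable_const_bound[of _ B]) auto
qed

lemma integral_prob_measures_bounds: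
  fixes f :: "real \<Rightarrow> real"
  assumes \<mu>: "\<mu> \<in> prob_measures d" and f: "continuous_on {-d..d} f"
    and bd: "\<And>s. s \<in> {-d..d} \<Longrightarrow> l \<le> f s \<and> f s \<le> u"
  shows "l \<le> (\<integral>s. f s \<partial>\<mu>) \<and> (\<integral>s. f s \<partial>\<mu>) \<le> u"
proof -
  interpret prob_space \<mu> using prob_measuresD[OF \<mu>] by blast
  note i = integrable_prob_measures[OF \<mu> f]
  have "AE s in \<mu>. l \<le> f s" "AE s in \<mu>. f s \<le> u"
    using bd prob_measuresD(3)[OF \<mu>] by (auto intro!: AE_I2)
  then show ?thesis using integral_ge_const[OF i] integral_le_const[OF i] by blast
qed

lemma integral_prob_measures_abs_diff:
  fixes f g :: "real \<Rightarrow> real"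
  assumes \<mu>: "\<mu> \<in> prob_measures d" and f: "continuous_on {-d..d} f" and g: "continuous_on {-d..d} g"
    and fg: "\<And>s. s \<in> {-d..d} \<Longrightarrow> \<bar>f s - g s\<bar> \<le> e"
  shows "\<bar>(\<integral>s. f s \<partial>\<mu>) - (\<integral>s. g s \<partial>\<mu>)\<bar> \<le> e"
proof -
  have "- e \<le> (\<integral>s. f s - g s \<partial>\<mu>) \<and> (\<integral>s. f s - g s \<partial>\<mu>) \<le> e"
  proof (rule integral_prob_measures_bounds[OF \<mu>])
    fix s assume "s \<in> {-d..d}"
    then show "- e \<le> f s - g s \<and> f s - g s \<le> e" using fg[of s] by linarith
  qed (intro continuous_on_diff f g)
  then show ?thesis
    by (simp add: Bochner_Integration.integral_diff integrable_prob_measures[OF \<mu>] f g abs_le_iff)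
qed

lemma moment_seq_bounds:
  assumes d: "0 < d" and "moment_seq d z"
  shows "\<bar>z k\<bar> \<le> 1"
proof -
  from assms(2) obtain \<mu> where \<mu>: "\<mu> \<in> prob_measures d" "(\<integral>s. s ^ k \<partial>\<mu>) = d ^ k * z k"
    by (auto simp: moment_seq_def)
  have "- (d ^ k) \<le> (\<integral>s. s ^ k \<partial>\<mu>) \<and> (\<integral>s. s ^ k \<partial>\<mu>) \<le> d ^ k"
  proof (rule integral_prob_measures_bounds[OF \<mu>(1)])
    fix s assume "s \<in> {-d..d}"
    then have "\<bar>s\<bar> ^ k \<le> d ^ k" by (intro power_mono) auto
    then have "\<bar>s ^ k\<bar> \<le> d ^ k" by (simp only: power_abs)
    then show "- (d ^ k) \<le> s ^ k \<and> s ^ k \<le> d ^ k" by linarith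
  qed (intro continuous_intros)
  then have "\<bar>d ^ k * z k\<bar> \<le> d ^ k" unfolding \<mu>(2) by linarith
  then have "d ^ k * \<bar>z k\<bar> \<le> d ^ k * 1" using d by (simp add: abs_mult)
  then show ?thesis using d by (simp only: mult_le_cancel_left_pos zero_less_power)
qed

text \<open>The measure with mass \<open>\<omega> x\<close> at the points \<open>d * \<beta> x\<close>.\<close>

lemma moment_seq_finite:
  assumes X: "finite X" "\<And>x. x \<in> X \<Longrightarrow> 0 \<le> \<omega> x" "(\<Sum>x\<in>X. \<omega> x) = 1"
    and \<beta>: "\<And>x. x \<in> X \<Longrightarrow> \<bar>\<beta> x\<bar> \<le> 1" and d: "0 < d"
  shows "moment_seq d (\<lambda>k. \<Sum>x\<in>X. \<omega> x * \<beta> x ^ k)"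
proof -
  let ?P = "point_measure X \<omega>"
  interpret P: prob_space ?P
    by (rule prob_spaceI) (use X in \<open>simp add: space_point_measure emeasure_point_measure_finite sum_ennreal\<close>)
  have "d * \<beta> x \<in> {-d..d}" if "x \<in> X" for x
  proof -
    have "\<bar>d * \<beta> x\<bar> \<le> d" using \<beta>[OF that] d by (simp add: abs_mult)
    then show ?thesis by (auto simp: abs_le_iff)
  qed
  then have m: "(\<lambda>x. d * \<beta> x) \<in> ?P \<rightarrow>\<^sub>M restrict_space borel {-d..d}"
    by (simp add: space_restrict_space Pi_iff)
  let ?\<mu> = "distr ?P (restrict_space borel {-d..d}) (\<lambda>x. d * \<beta> x)"
  have "?\<mu> \<in> prob_measures d"
    using P.prob_space_distr[OF m] by (simp add: prob_measures_def)
  moreover have "(\<integral>s. s ^ k \<partial>?\<mu>) = d ^ k * (\<Sum>x\<in>X. \<omega> x * \<beta> x ^ k)" for k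
  proof -
    have "(\<lambda>s. s ^ k) \<in> borel_measurable (restrict_space borel {-d..d})"
      by (rule measurable_restrict_space1) simp
    then have "(\<integral>s. s ^ k \<partial>?\<mu>) = (\<integral>x. (d * \<beta> x) ^ k \<partial>?P)" using m by (subst integral_distr) auto
    also have "\<dots> = (\<Sum>x\<in>X. \<omega> x *\<^sub>R (d * \<beta> x) ^ k)"
      using X by (subst lebesgue_integral_point_measure_finite) auto
    finally show ?thesis by (simp add: sum_distrib_left power_mult_distrib mult_ac)
  qed
  ultimately show ?thesis unfolding moment_seq_def by blast
qed

lemma moment_seq_zero: "0 < d \<Longrightarrow> moment_seq d (\<lambda>k. 0 ^ k)"
  using moment_seq_finite[of "{()}" "\<lambda>_. 1" "\<lambda>_. 0" d] by simp

text \<open>Closedness of the set of moment sequences is Helly's theorem.\<close>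

lemma moment_seq_closed:
  assumes d: "0 < d" and z: "\<And>n. moment_seq d (z n)" and lim: "\<And>k. (\<lambda>n. z n k) \<longlonglongrightarrow> y k"
  shows "moment_seq d y"
proof -
  from z obtain \<mu> where \<mu>: "\<And>n. \<mu> n \<in> prob_measures d" "\<And>n k. (\<integral>s. s ^ k \<partial>\<mu> n) = d ^ k * z n k"
    unfolding moment_seq_def by metis
  have id: "(\<lambda>s. s) \<in> \<mu> n \<rightarrow>\<^sub>M borel" for n
    using prob_measuresD(2)[OF \<mu>(1), of n] measurable_restrict_space1[of "\<lambda>s. s" borel borel "{-d..d}"]
    by (simp cong: measurable_cong_sets)
  define \<nu> where "\<nu> n = distr (\<mu> n) borel (\<lambda>s. s)" for n
  have rd: "real_distribution (\<nu> n)" for n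
    unfolding \<nu>_def using prob_space.real_distribution_distr[OF prob_measuresD(1)[OF \<mu>(1)] id] .
  have "tight \<nu>"
    unfolding tight_def
  proof (intro conjI allI impI rd, rule exI[of _ "-d-1"], rule exI[of _ d], intro conjI allI)
    fix \<epsilon> :: real and n assume "0 < \<epsilon>"
    have "measure (\<nu> n) {-d-1<..d} = measure (\<mu> n) (space (\<mu> n))"
      unfolding \<nu>_def by (subst measure_distr[OF id], simp)
        (intro arg_cong2[where f = measure] refl, auto simp: prob_measuresD(3)[OF \<mu>(1)])
    also have "\<dots> = 1" using prob_space.prob_space[OF prob_measuresD(1)[OF \<mu>(1)]] .
    finally show "1 - \<epsilon> < measure (\<nu> n) {-d-1<..d}" using \<open>0 < \<epsilon>\<close> by simp
  qed (use d in auto)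
  from tight_imp_convergent_subsubsequence[OF this, of "\<lambda>n. n"] obtain r N where r: "strict_mono r"
    and N: "real_distribution N" and conv: "weak_conv_m (\<nu> \<circ> r) N"
    by (auto simp: strict_mono_def comp_def)
  interpret N: real_distribution N by (rule N)
  \<comment> \<open>Truncation to \<open>[-d, d]\<close> turns \<open>s ^ k\<close> into a bounded continuous test function on the line.\<close>
  define cl where "cl s = max (-d) (min d s)" for s
  have clm: "cl \<in> N \<rightarrow>\<^sub>M restrict_space borel {-d..d}"
    using d by (intro measurable_restrict_space2) (auto simp: cl_def[abs_def])
  let ?\<mu> = "distr N (restrict_space borel {-d..d}) cl"
  have "?\<mu> \<in> prob_measures d" using N.prob_space_distr[OF clm] by (simp add: prob_measures_def)
  moreover have "(\<integral>s. s ^ k \<partial>?\<mu>) = d ^ k * y k" for k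
  proof -
    have bd: "norm (cl s ^ k) \<le> d ^ k" for s
    proof -
      have "\<bar>cl s\<bar> \<le> d" using d by (auto simp: cl_def)
      then show ?thesis by (simp only: real_norm_def power_abs power_mono abs_ge_zero)
    qed
    have "(\<lambda>n. \<integral>s. cl s ^ k \<partial>(\<nu> \<circ> r) n) \<longlonglongrightarrow> (\<integral>s. cl s ^ k \<partial>N)"
    proof (rule weak_conv_imp_integral_bdd_continuous_conv[where B = "d ^ k", OF _ N conv])
      show "real_distribution ((\<nu> \<circ> r) n)" for n using rd by simp
      show "isCont (\<lambda>s. cl s ^ k) s" for s unfolding cl_def by (intro continuous_intros)
    qed (rule bd)
    moreover have "(\<integral>s. cl s ^ k \<partial>(\<nu> \<circ> r) n) = d ^ k * z (r n) k" for n
    proof -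
      have "(\<integral>s. cl s ^ k \<partial>(\<nu> \<circ> r) n) = (\<integral>s. cl s ^ k \<partial>\<mu> (r n))"
        unfolding \<nu>_def comp_def by (subst integral_distr[OF id]) (auto simp: cl_def[abs_def])
      also have "\<dots> = (\<integral>s. s ^ k \<partial>\<mu> (r n))"
        using d by (intro Bochner_Integration.integral_cong refl) (auto simp: prob_measuresD(3)[OF \<mu>(1)] cl_def)
      finally show ?thesis using \<mu>(2) by simp
    qed
    moreover have "(\<lambda>n. d ^ k * z (r n) k) \<longlonglongrightarrow> d ^ k * y k"
      using LIMSEQ_subseq_LIMSEQ[OF lim r, of k] by (intro tendsto_mult_left) (simp add: comp_def)
    ultimately have eq: "(\<integral>s. cl s ^ k \<partial>N) = d ^ k * y k" using LIMSEQ_unique by simp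
    have "(\<lambda>s. s ^ k) \<in> borel_measurable (restrict_space borel {-d..d})"
      by (rule measurable_restrict_space1) simp
    then show ?thesis using eq by (subst integral_distr[OF clm]) auto
  qed
  ultimately show ?thesis unfolding moment_seq_def by blast
qed

text \<open>The weak topology on \<open>\<P>[-d, d]\<close> is generated by the moments, because polynomials are dense.\<close>

lemma weak_open_moment_nbhd:
  assumes "openin (weak_topology d) U" "\<mu> \<in> U"
  shows "\<exists>K \<epsilon>. 0 < \<epsilon> \<and> (\<forall>\<nu>\<in>prob_measures d. (\<forall>k\<le>K. \<bar>(\<integral>s. s ^ k \<partial>\<nu>) - (\<integral>s. s ^ k \<partial>\<mu>)\<bar> < \<epsilon>) \<longrightarrow> \<nu> \<in> U)"
proof -
  have "generate_topology_on {{M \<in> prob_measures d. (\<integral>s. f s \<partial>M) \<in> U} | f U.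
          continuous_on {-d..d} (f :: real \<Rightarrow> real) \<and> open (U :: real set)} U"
    using assms(1) by (simp add: weak_topology_def openin_topology_generated_by_iff)
  then show ?thesis using assms(2)
  proof (induction arbitrary: \<mu>)
    case Empty
    then show ?case by simp
  next
    case (Int A B)
    obtain K1 \<epsilon>1 where 1: "0 < \<epsilon>1"
      "\<forall>\<nu>\<in>prob_measures d. (\<forall>k\<le>K1. \<bar>(\<integral>s. s ^ k \<partial>\<nu>) - (\<integral>s. s ^ k \<partial>\<mu>)\<bar> < \<epsilon>1) \<longrightarrow> \<nu> \<in> A"
      using Int.IH(1)[of \<mu>] Int.prems by blast
    obtain K2 \<epsilon>2 where 2: "0 < \<epsilon>2"
      "\<forall>\<nu>\<in>prob_measures d. (\<forall>k\<le>K2. \<bar>(\<integral>s. s ^ k \<partial>\<nu>) - (\<integral>s. s ^ k \<partial>\<mu>)\<bar> < \<epsilon>2) \<longrightarrow> \<nu> \<in> B"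
      using Int.IH(2)[of \<mu>] Int.prems by blast
    show ?case
      by (rule exI[of _ "max K1 K2"], rule exI[of _ "min \<epsilon>1 \<epsilon>2"]) (use 1 2 in simp)
  next
    case (UN \<K>)
    then obtain B where B: "B \<in> \<K>" "\<mu> \<in> B" by auto
    obtain K \<epsilon> where K: "0 < \<epsilon>"
      "\<forall>\<nu>\<in>prob_measures d. (\<forall>k\<le>K. \<bar>(\<integral>s. s ^ k \<partial>\<nu>) - (\<integral>s. s ^ k \<partial>\<mu>)\<bar> < \<epsilon>) \<longrightarrow> \<nu> \<in> B"
      using UN.IH[OF B] by auto
    show ?case
    proof (rule exI[of _ K], rule exI[of _ \<epsilon>], intro conjI ballI impI K(1))
      fix \<nu> assume "\<nu> \<in> prob_measures d" "\<forall>k\<le>K. \<bar>(\<integral>s. s ^ k \<partial>\<nu>) - (\<integral>s. s ^ k \<partial>\<mu>)\<bar> < \<epsilon>"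
      then have "\<nu> \<in> B" using K(2) by simp
      then show "\<nu> \<in> \<Union>\<K>" using B(1) by (rule UnionI[rotated])
    qed
  next
    case (Basis A)
    from Basis(1) obtain f :: "real \<Rightarrow> real" and V :: "real set" where A: "A = {M \<in> prob_measures d. (\<integral>s. f s \<partial>M) \<in> V}"
      and f: "continuous_on {-d..d} f" and V: "open V" by blast
    have \<mu>: "\<mu> \<in> prob_measures d" "(\<integral>s. f s \<partial>\<mu>) \<in> V"
      using Basis(2) unfolding A by simp_all
    from V \<mu>(2) have "\<exists>e>0. \<forall>y. dist y (\<integral>s. f s \<partial>\<mu>) < e \<longrightarrow> y \<in> V" by (simp add: open_dist)
    then obtain e where e: "0 < e" "\<And>y. \<bar>y - (\<integral>s. f s \<partial>\<mu>)\<bar> < e \<Longrightarrow> y \<in> V"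
      by (auto simp: dist_real_def)
    have "0 < e / 3" using e(1) by simp
    from Stone_Weierstrass_real_polynomial_function[OF compact_Icc f this] obtain g where
      g: "real_polynomial_function g" "\<And>s. s \<in> {-d..d} \<Longrightarrow> \<bar>f s - g s\<bar> < e / 3" by blast
    then obtain a n where g_eq: "g = (\<lambda>s. \<Sum>i\<le>n. a i * s ^ i)" by (auto simp: real_polynomial_function_iff_sum)
    have gc: "continuous_on {-d..d} g" unfolding g_eq by (intro continuous_intros)
    have ig: "(\<integral>s. g s \<partial>\<nu>) = (\<Sum>i\<le>n. a i * (\<integral>s. s ^ i \<partial>\<nu>))" if "\<nu> \<in> prob_measures d" for \<nu>
      unfolding g_eq
      by (subst Bochner_Integration.integral_sum)
         (auto intro!: integrable_mult_right integrable_prob_measures[OF that] continuous_intros)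
    have fg: "\<bar>(\<integral>s. f s \<partial>\<nu>) - (\<integral>s. g s \<partial>\<nu>)\<bar> \<le> e / 3" if "\<nu> \<in> prob_measures d" for \<nu>
      using g(2) by (intro integral_prob_measures_abs_diff[OF that f gc]) (simp add: less_imp_le)
    define T where "T = 1 + (\<Sum>i\<le>n. \<bar>a i\<bar>)"
    have "0 \<le> (\<Sum>i\<le>n. \<bar>a i\<bar>)" by (intro sum_nonneg) auto
    then have T: "0 < T" unfolding T_def by linarith
    define \<epsilon> where "\<epsilon> = e / 3 / T"
    have \<epsilon>: "0 < \<epsilon>" "T * \<epsilon> = e / 3" unfolding \<epsilon>_def using e(1) T by simp_all
    show ?case
    proof (rule exI[of _ n], rule exI[of _ \<epsilon>], intro conjI ballI impI \<epsilon>(1))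
      fix \<nu> assume \<nu>: "\<nu> \<in> prob_measures d"
        and close: "\<forall>k\<le>n. \<bar>(\<integral>s. s ^ k \<partial>\<nu>) - (\<integral>s. s ^ k \<partial>\<mu>)\<bar> < \<epsilon>"
      have "\<bar>(\<integral>s. g s \<partial>\<nu>) - (\<integral>s. g s \<partial>\<mu>)\<bar> = \<bar>\<Sum>i\<le>n. a i * ((\<integral>s. s ^ i \<partial>\<nu>) - (\<integral>s. s ^ i \<partial>\<mu>))\<bar>"
        by (simp add: ig[OF \<nu>] ig[OF \<mu>(1)] sum_subtractf right_diff_distrib)
      also have "\<dots> \<le> (\<Sum>i\<le>n. \<bar>a i\<bar> * \<epsilon>)"
      proof (intro order_trans[OF sum_abs] sum_mono)
        fix i assume "i \<in> {..n}"
        then have "\<bar>(\<integral>s. s ^ i \<partial>\<nu>) - (\<integral>s. s ^ i \<partial>\<mu>)\<bar> \<le> \<epsilon>" using close by (simp add: less_imp_le)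
        then show "\<bar>a i * ((\<integral>s. s ^ i \<partial>\<nu>) - (\<integral>s. s ^ i \<partial>\<mu>))\<bar> \<le> \<bar>a i\<bar> * \<epsilon>"
          unfolding abs_mult by (rule mult_left_mono) simp
      qed
      also have "\<dots> = (\<Sum>i\<le>n. \<bar>a i\<bar>) * \<epsilon>" by (simp add: sum_distrib_right)
      also have "\<dots> < e / 3" using \<epsilon> unfolding T_def distrib_right by linarith
      finally have "\<bar>(\<integral>s. f s \<partial>\<nu>) - (\<integral>s. f s \<partial>\<mu>)\<bar> < e" using fg[OF \<nu>] fg[OF \<mu>(1)] by linarith
      then show "\<nu> \<in> A" using e(2) \<nu> by (simp add: A)
    qed
  qed
qed

lemma open_sets_weak_topology: "{U. openin (weak_topology d) U} \<subseteq> Pow (prob_measures d)"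
  using openin_subset[of "weak_topology d"] by (auto simp: topspace_weak_topology)

lemma space_borel_prob_measures [simp]: "space (borel_prob_measures d) = prob_measures d"
  unfolding borel_prob_measures_def by (rule space_measure_of[OF open_sets_weak_topology])

text \<open>
  A map into \<open>\<P>[-d, d]\<close> is measurable if its moments are: an open set of measures is the preimage of an
  open set of sequences under the map that sends a measure to its moments.
\<close>

theorem measurable_borel_prob_measuresI:
  assumes W: "\<And>x. x \<in> space M \<Longrightarrow> W x \<in> prob_measures d"
    and m: "\<And>k. (\<lambda>x. \<integral>s. s ^ k \<partial>W x) \<in> borel_measurable M"
  shows "W \<in> M \<rightarrow>\<^sub>M borel_prob_measures d"
  unfolding borel_prob_measures_def
proof (rule measurable_measure_of[OF open_sets_weak_topology])
  show "W \<in> space M \<rightarrow> prob_measures d" using W by blast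
  fix U assume "U \<in> {U. openin (weak_topology d) U}"
  then have U: "openin (weak_topology d) U" "U \<subseteq> prob_measures d" using open_sets_weak_topology by auto
  define \<Phi> where "\<Phi> \<mu> k = (\<integral>s. s ^ k \<partial>\<mu>)" for \<mu> :: "real measure" and k :: nat
  from weak_open_moment_nbhd[OF U(1)] obtain K \<epsilon> where K: "\<And>\<mu>. \<mu> \<in> U \<Longrightarrow> 0 < \<epsilon> \<mu>"
    "\<And>\<mu> \<nu>. \<mu> \<in> U \<Longrightarrow> \<nu> \<in> prob_measures d \<Longrightarrow> \<forall>k\<le>K \<mu>. \<bar>\<Phi> \<nu> k - \<Phi> \<mu> k\<bar> < \<epsilon> \<mu> \<Longrightarrow> \<nu> \<in> U"
    unfolding \<Phi>_def by metis
  define O' where "O' = (\<Union>\<mu>\<in>U. \<Inter>k\<in>{..K \<mu>}. (\<lambda>z :: nat \<Rightarrow> real. z k) -` {t. \<bar>t - \<Phi> \<mu> k\<bar> < \<epsilon> \<mu>})"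
  have "open {t. \<bar>t - c\<bar> < e}" for c e :: real
    by (intro open_Collect_less continuous_intros)
  then have "open O'"
    unfolding O'_def
    by (intro open_UN ballI open_INT finite_atMost open_vimage continuous_on_product_coordinates)
  moreover have "(\<lambda>x. \<Phi> (W x)) \<in> borel_measurable M"
    by (rule measurable_coordinatewise_then_product) (simp add: \<Phi>_def m)
  ultimately have "(\<lambda>x. \<Phi> (W x)) -` O' \<inter> space M \<in> sets M" by (auto intro: measurable_sets)
  also have "(\<lambda>x. \<Phi> (W x)) -` O' \<inter> space M = W -` U \<inter> space M"
  proof (intro set_eqI iffI)
    fix x assume "x \<in> (\<lambda>x. \<Phi> (W x)) -` O' \<inter> space M"
    then obtain \<mu> where "x \<in> space M" "\<mu> \<in> U" "\<forall>k\<le>K \<mu>. \<bar>\<Phi> (W x) k - \<Phi> \<mu> k\<bar> < \<epsilon> \<mu>"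
      by (auto simp: O'_def)
    then show "x \<in> W -` U \<inter> space M" using K(2)[of \<mu> "W x"] W by simp
  next
    fix x assume x: "x \<in> W -` U \<inter> space M"
    then have "\<Phi> (W x) \<in> (\<Inter>k\<in>{..K (W x)}. (\<lambda>z. z k) -` {t. \<bar>t - \<Phi> (W x) k\<bar> < \<epsilon> (W x)})"
      using K(1)[of "W x"] by simp
    then show "x \<in> (\<lambda>x. \<Phi> (W x)) -` O' \<inter> space M" using x unfolding O'_def by blast
  qed
  finally show "W -` U \<inter> space M \<in> sets M" .
qed

lemma measurable_integral_borel_prob_measures:
  assumes f: "continuous_on {-d..d} (f :: real \<Rightarrow> real)"
  shows "(\<lambda>\<mu>. \<integral>s. f s \<partial>\<mu>) \<in> borel_measurable (borel_prob_measures d)"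
proof (rule borel_measurableI)
  fix S :: "real set" assume "open S"
  then have "openin (weak_topology d) {M \<in> prob_measures d. (\<integral>s. f s \<partial>M) \<in> S}"
    unfolding weak_topology_def openin_topology_generated_by_iff
    by (intro generate_topology_on.Basis) (use f in blast)
  then have "{M \<in> prob_measures d. (\<integral>s. f s \<partial>M) \<in> S} \<in> sets (borel_prob_measures d)"
    unfolding borel_prob_measures_def by (subst sets_measure_of[OF open_sets_weak_topology]) auto
  then show "(\<lambda>\<mu>. \<integral>s. f s \<partial>\<mu>) -` S \<inter> space (borel_prob_measures d) \<in> sets (borel_prob_measures d)"
    by (simp add: vimage_def Int_def conj_commute)
qed

section \<open>Interval partitions\<close>

text \<open>
  The intervals of the partition of \<open>[0, 1]\<close> into \<open>M\<close> consecutive intervals of lengths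
  \<open>w 0, w 1, \<dots>\<close> are the level sets of \<open>cellmap M w\<close>. The intervals are closed on the left, and the last one also
  on the right, so that they cover \<open>[0, 1]\<close>; intervals of length \<open>0\<close> are allowed.
\<close>

definition cellmap :: "nat \<Rightarrow> (nat \<Rightarrow> real) \<Rightarrow> real \<Rightarrow> nat" where
  "cellmap M w x = Max {a. a < M \<and> (\<Sum>b<a. w b) \<le> x}"

locale interval_partition =
  fixes M :: nat and w :: "nat \<Rightarrow> real"
  assumes w_nonneg: "\<And>a. a < M \<Longrightarrow> 0 \<le> w a" and w_total: "(\<Sum>a<M. w a) = 1"
begin

lemma M_pos: "0 < M"
  using w_total by (cases M) auto

lemma cum_mono: "a \<le> b \<Longrightarrow> b \<le> M \<Longrightarrow> (\<Sum>i<a. w i) \<le> (\<Sum>i<b. w i)"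
  using w_nonneg by (intro sum_mono2) auto

lemma cellmap_iff:
  assumes x: "0 \<le> x"
  shows "cellmap M w x = a \<longleftrightarrow> a < M \<and> (\<Sum>b<a. w b) \<le> x \<and> (Suc a = M \<or> x < (\<Sum>b<Suc a. w b))"
proof -
  let ?S = "{a. a < M \<and> (\<Sum>b<a. w b) \<le> x}"
  have S: "finite ?S" "?S \<noteq> {}" using x M_pos by (auto intro!: exI[of _ 0])
  show ?thesis
  proof
    assume a: "cellmap M w x = a"
    then have "a \<in> ?S" using Max_in[OF S] by (simp add: cellmap_def)
    moreover have "Suc a \<notin> ?S" using Max_ge[OF S(1), of "Suc a"] a unfolding cellmap_def by (metis Suc_n_not_le_n)
    ultimately show "a < M \<and> (\<Sum>b<a. w b) \<le> x \<and> (Suc a = M \<or> x < (\<Sum>b<Suc a. w b))" by auto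
  next
    assume a: "a < M \<and> (\<Sum>b<a. w b) \<le> x \<and> (Suc a = M \<or> x < (\<Sum>b<Suc a. w b))"
    show "cellmap M w x = a"
      unfolding cellmap_def
    proof (rule Max_eqI[OF S(1)])
      fix b assume b: "b \<in> ?S"
      show "b \<le> a"
      proof (rule ccontr)
        assume "\<not> b \<le> a"
        then have "(\<Sum>i<Suc a. w i) \<le> (\<Sum>i<b. w i)" using b by (intro cum_mono) auto
        then show False using a b \<open>\<not> b \<le> a\<close> by auto
      qed
    qed (use a in auto)
  qed
qed

lemma cellmap_less: "0 \<le> x \<Longrightarrow> cellmap M w x < M"
  using cellmap_iff[of x "cellmap M w x"] by simp

lemma cellmap_fibre:
  assumes "a < M"
  shows "{x\<in>{0..1}. cellmap M w x = a} =
    (if Suc a = M then {(\<Sum>b<a. w b)..1} else {(\<Sum>b<a. w b)..<(\<Sum>b<Suc a. w b)})"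
proof -
  have "0 \<le> (\<Sum>b<a. w b)" using cum_mono[of 0 a] assms by simp
  moreover have "(\<Sum>b<Suc a. w b) \<le> 1" using cum_mono[of "Suc a" M] assms w_total by simp
  ultimately have bd: "0 \<le> (\<Sum>b<a. w b)" "(\<Sum>b<Suc a. w b) \<le> 1" .
  show ?thesis
  proof (intro set_eqI)
    fix x
    show "x \<in> {x\<in>{0..1}. cellmap M w x = a} \<longleftrightarrow>
      x \<in> (if Suc a = M then {(\<Sum>b<a. w b)..1} else {(\<Sum>b<a. w b)..<(\<Sum>b<Suc a. w b)})"
    proof (cases "0 \<le> x")
      case True
      show ?thesis unfolding mem_Collect_eq cellmap_iff[OF True] using True assms bd by auto
    next
      case False
      then show ?thesis using bd by auto
    qed
  qed
qed

lemma measure_cellmap_fibre: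
  assumes "a < M"
  shows "measure I01 {x\<in>{0..1}. cellmap M w x = a} = w a"
proof -
  let ?A = "{x\<in>{0..1}. cellmap M w x = a}"
  have "(\<Sum>b<Suc a. w b) \<le> 1" using cum_mono[of "Suc a" M] assms w_total by simp
  have "measure I01 ?A = measure lborel ?A"
    by (rule measure_restrict_space) auto
  also have "\<dots> = w a"
  proof (cases "Suc a = M")
    case True
    then have "(\<Sum>b<a. w b) + w a = 1" using w_total by (metis sum.lessThan_Suc)
    then show ?thesis using w_nonneg[OF assms] by (simp only: cellmap_fibre[OF assms] True) auto
  next
    case False
    then show ?thesis using w_nonneg[OF assms] by (simp only: cellmap_fibre[OF assms] if_False) auto
  qed
  finally show ?thesis .
qed

lemma cellmap_measurable: "cellmap M w \<in> I01 \<rightarrow>\<^sub>M count_space UNIV"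
proof -
  have "cellmap M w -` {a} \<inter> space I01 \<in> sets I01" for a
  proof (cases "a < M")
    case True
    have "cellmap M w -` {a} \<inter> space I01 = {x\<in>{0..1}. cellmap M w x = a}" by auto
    moreover have "{x\<in>{0..1}. cellmap M w x = a} \<in> sets I01"
    proof (subst sets_restrict_space_iff)
      show "{x\<in>{0..1}. cellmap M w x = a} \<subseteq> {0..1} \<and> {x\<in>{0..1}. cellmap M w x = a} \<in> sets lborel"
        by (intro conjI, blast) (simp only: cellmap_fibre[OF True], simp)
    qed simp
    ultimately show ?thesis by simp
  next
    case False
    then have "cellmap M w -` {a} \<inter> space I01 = {}" using cellmap_less by auto
    then show ?thesis by simp
  qed
  then show ?thesis by (subst measurable_count_space_eq2_countable) auto
qed

text \<open>A refinement, in which the cell \<open>a\<close> is divided into the cells \<open>a * q, \<dots>, a * q + q - 1\<close>.\<close>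

lemma cellmap_refine:
  assumes w': "interval_partition (M * q) w'" and q: "0 < q"
    and eq: "\<And>a. a < M \<Longrightarrow> w a = (\<Sum>r<q. w' (a * q + r))"
    and x: "0 \<le> x"
  shows "cellmap M w x = cellmap (M * q) w' x div q"
proof -
  interpret w': interval_partition "M * q" w' by (rule w')
  have cum: "(\<Sum>b<a. w b) = (\<Sum>b<a * q. w' b)" if "a \<le> M" for a
  proof -
    have "(\<Sum>b<a. w b) = (\<Sum>b<a. sum w' {b * q..<b * q + q})"
      using that by (intro sum.cong refl)
        (simp add: eq sum.shift_bounds_nat_ivl[of w' 0 _ q, simplified] add.commute lessThan_atLeast0)
    then show ?thesis by (simp add: sum.nat_group)
  qed
  define a' where "a' = cellmap (M * q) w' x"
  define a where "a = a' div q"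
  have a': "a' < M * q" "(\<Sum>b<a'. w' b) \<le> x" "Suc a' = M * q \<or> x < (\<Sum>b<Suc a'. w' b)"
    using w'.cellmap_iff[OF x, of a'] by (auto simp: a'_def)
  have a: "a < M" using a'(1) q by (simp add: a_def less_mult_imp_div_less)
  have le: "a * q \<le> a'" "Suc a' \<le> Suc a * q"
    using q by (auto simp: a_def div_times_less_eq_dividend) (metis Suc_leI add.commute dividend_less_div_times)
  have "(\<Sum>b<a. w b) \<le> x"
    using a cum[of a] w'.cum_mono[OF le(1)] a'(1,2) by simp
  moreover have "Suc a = M \<or> x < (\<Sum>b<Suc a. w b)"
  proof (rule disjCI)
    assume "\<not> x < (\<Sum>b<Suc a. w b)"
    then have "(\<Sum>b<Suc a * q. w' b) \<le> x" using cum[of "Suc a"] a by (simp del: sum.lessThan_Suc mult_Suc)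
    moreover have "Suc a * q \<le> M * q" using a by (intro mult_right_mono) auto
    ultimately have "(\<Sum>b<Suc a'. w' b) \<le> x" using w'.cum_mono[OF le(2)] by linarith
    then have "Suc a' = M * q" using a'(3) by simp
    then show "Suc a = M" using le(2) a q by (metis Suc_leI le_antisym mult_le_cancel2)
  qed
  ultimately show ?thesis using cellmap_iff[OF x, of a] a by (simp add: a_def a'_def)
qed

end

section \<open>Limits of refining step graphons\<close>

lemma sum_lessThan_mult:
  fixes f :: "nat \<Rightarrow> real"
  shows "(\<Sum>a<M * q. f a) = (\<Sum>a<M. \<Sum>r<q. f (a * q + r))"
proof -
  have "(\<Sum>r<q. f (a * q + r)) = sum f {a * q..<a * q + q}" for a
    using sum.shift_bounds_nat_ivl[of f 0 "a * q" q] by (simp add: add.commute lessThan_atLeast0)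
  then show ?thesis by (simp add: sum.nat_group)
qed

lemma (in prob_space) L1_le_L2:
  fixes f :: "'a \<Rightarrow> real"
  assumes f: "f \<in> borel_measurable M" "\<And>x. \<bar>f x\<bar> \<le> B"
  shows "(expectation (\<lambda>x. \<bar>f x\<bar>))\<^sup>2 \<le> expectation (\<lambda>x. (f x)\<^sup>2)"
proof -
  have "integrable M (\<lambda>x. \<bar>f x\<bar>)" by (rule integrable_const_bound[of _ B]) (use f in auto)
  moreover have "integrable M (\<lambda>x. \<bar>f x\<bar>\<^sup>2)"
  proof (rule integrable_const_bound[of _ "B\<^sup>2"])
    have "\<bar>f x\<bar>\<^sup>2 \<le> B\<^sup>2" for x using f(2) by (intro power_mono) auto
    then show "AE x in M. norm (\<bar>f x\<bar>\<^sup>2) \<le> B\<^sup>2" by simp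
  qed (use f in simp)
  ultimately have "variance (\<lambda>x. \<bar>f x\<bar>) = expectation (\<lambda>x. \<bar>f x\<bar>\<^sup>2) - (expectation (\<lambda>x. \<bar>f x\<bar>))\<^sup>2"
    by (rule variance_eq)
  then show ?thesis using variance_positive[of "\<lambda>x. \<bar>f x\<bar>"] by simp
qed

text \<open>
  The step kernels \<open>U m\<close> on successively refined partitions form a martingale: \<open>U m\<close> is the
  average of \<open>U (m + 1)\<close> over the cells of level \<open>m\<close>.
\<close>

locale refining =
  fixes d :: real and q M :: "nat \<Rightarrow> nat" and w :: "nat \<Rightarrow> nat \<Rightarrow> real"
    and U :: "nat \<Rightarrow> nat \<Rightarrow> nat \<Rightarrow> nat \<Rightarrow> real"
  assumes d: "0 < d" and q: "\<And>m. 0 < q m" and M_Suc: "\<And>m. M (Suc m) = M m * q m"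
    and part: "\<And>m. interval_partition (M m) (w m)"
    and refine: "\<And>m a. a < M m \<Longrightarrow> w m a = (\<Sum>r<q m. w (Suc m) (a * q m + r))"
    and U_sym: "\<And>m k a c. U m k a c = U m k c a"
    and U_moments: "\<And>m a c. moment_seq d (\<lambda>k. U m k a c)"
    and martingale: "\<And>m k a c. a < M m \<Longrightarrow> c < M m \<Longrightarrow> w m a * w m c * U m k a c =
      (\<Sum>r<q m. \<Sum>s<q m. w (Suc m) (a * q m + r) * w (Suc m) (c * q m + s) *
         U (Suc m) k (a * q m + r) (c * q m + s))"
begin

abbreviation cell :: "nat \<Rightarrow> real \<Rightarrow> nat" where "cell m \<equiv> cellmap (M m) (w m)"

text \<open>The step kernel of level \<open>m\<close> for the \<open>k\<close>th moment, as a function on the unit square.\<close>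

definition u :: "nat \<Rightarrow> nat \<Rightarrow> real \<times> real \<Rightarrow> real" where
  "u m k p = U m k (cell m (fst p)) (cell m (snd p))"

lemma u_bound: "\<bar>u m k p\<bar> \<le> 1"
  unfolding u_def by (rule moment_seq_bounds[OF d U_moments])

lemma cell_measurable: "cell m \<in> I01 \<rightarrow>\<^sub>M count_space UNIV"
  by (rule interval_partition.cellmap_measurable[OF part])

lemma cell_less: "x \<in> {0..1} \<Longrightarrow> cell m x < M m"
  by (simp add: interval_partition.cellmap_less[OF part])

lemma cell_fibre: "a < M m \<Longrightarrow> measure I01 {x\<in>{0..1}. cell m x = a} = w m a"
  by (rule interval_partition.measure_cellmap_fibre[OF part])

lemma step_measurable: "(\<lambda>p. G (cell m (fst p)) (cell m (snd p)) :: real) \<in> borel_measurable SQ"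
  by (rule borel_measurable_SQ_step[OF cell_measurable])

lemma u_measurable: "u m k \<in> borel_measurable SQ"
  unfolding u_def[abs_def] by (rule step_measurable)

lemma step_integral:
  "(\<integral>p. G (cell m (fst p)) (cell m (snd p)) \<partial>SQ) = (\<Sum>a<M m. \<Sum>e<M m. w m a * w m e * G a e :: real)"
  by (rule integral_SQ_step[OF cell_measurable cell_less cell_fibre])

lemma cell_Suc: "0 \<le> x \<Longrightarrow> cell m x = cell (Suc m) x div q m"
  using interval_partition.cellmap_refine[OF part, of m "q m" "w (Suc m)" x] part[of "Suc m"] q refine
  by (simp add: M_Suc)

text \<open>
  The martingale property in the form of an inner product with a function \<open>G\<close> that is constant on the cells of level \<open>m\<close>;
  \<open>inner_le\<close> extends it to all later levels.
\<close>

lemma inner_Suc: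
  "(\<integral>p. u (Suc m) k p * G (cell m (fst p)) (cell m (snd p)) \<partial>SQ) =
   (\<integral>p. u m k p * G (cell m (fst p)) (cell m (snd p)) \<partial>SQ)"
proof -
  let ?q = "q m"
  have "(\<integral>p. u (Suc m) k p * G (cell m (fst p)) (cell m (snd p)) \<partial>SQ) =
    (\<integral>p. (\<lambda>a c. U (Suc m) k a c * G (a div ?q) (c div ?q)) (cell (Suc m) (fst p)) (cell (Suc m) (snd p)) \<partial>SQ)"
    by (intro Bochner_Integration.integral_cong refl) (auto simp: u_def cell_Suc[of _ m] space_SQ)
  also have "\<dots> = (\<Sum>a<M (Suc m). \<Sum>c<M (Suc m). w (Suc m) a * w (Suc m) c *
      (U (Suc m) k a c * G (a div ?q) (c div ?q)))"
    by (rule step_integral)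
  also have "\<dots> = (\<Sum>a<M m. \<Sum>r<?q. \<Sum>c<M m. \<Sum>s<?q. w (Suc m) (a * ?q + r) * w (Suc m) (c * ?q + s) *
      (U (Suc m) k (a * ?q + r) (c * ?q + s) * G a c))"
    unfolding M_Suc sum_lessThan_mult by (intro sum.cong refl) (simp add: q)
  also have "\<dots> = (\<Sum>a<M m. \<Sum>c<M m. \<Sum>r<?q. \<Sum>s<?q. w (Suc m) (a * ?q + r) * w (Suc m) (c * ?q + s) *
      (U (Suc m) k (a * ?q + r) (c * ?q + s) * G a c))"
    by (intro sum.cong refl sum.swap)
  also have "\<dots> = (\<Sum>a<M m. \<Sum>c<M m. w m a * w m c * (U m k a c * G a c))"
  proof (intro sum.cong refl)
    fix a c assume "a \<in> {..<M m}" "c \<in> {..<M m}"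
    then have "w m a * w m c * U m k a c * G a c =
      (\<Sum>r<?q. \<Sum>s<?q. w (Suc m) (a * ?q + r) * w (Suc m) (c * ?q + s) *
         U (Suc m) k (a * ?q + r) (c * ?q + s)) * G a c"
      by (simp only: martingale lessThan_iff)
    then show "(\<Sum>r<?q. \<Sum>s<?q. w (Suc m) (a * ?q + r) * w (Suc m) (c * ?q + s) *
      (U (Suc m) k (a * ?q + r) (c * ?q + s) * G a c)) = w m a * w m c * (U m k a c * G a c)"
      by (simp only: sum_distrib_right mult.assoc)
  qed
  also have "\<dots> = (\<integral>p. (\<lambda>a c. U m k a c * G a c) (cell m (fst p)) (cell m (snd p)) \<partial>SQ)"
    by (rule step_integral[symmetric])
  finally show ?thesis by (simp add: u_def)
qed

lemma inner_le:
  assumes "m \<le> n"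
  shows "(\<exists>h. \<forall>x\<ge>0. cell m x = h (cell n x)) \<and>
    (\<forall>G. (\<integral>p. u n k p * G (cell m (fst p)) (cell m (snd p)) \<partial>SQ) =
         (\<integral>p. u m k p * G (cell m (fst p)) (cell m (snd p)) \<partial>SQ))"
  using assms
proof (induction rule: dec_induct)
  case base
  show ?case by (intro conjI exI[of _ "\<lambda>a. a"]) auto
next
  case (step n)
  then obtain h where h: "\<And>x. 0 \<le> x \<Longrightarrow> cell m x = h (cell n x)" by blast
  have "(\<integral>p. u (Suc n) k p * G (cell m (fst p)) (cell m (snd p)) \<partial>SQ) =
      (\<integral>p. u m k p * G (cell m (fst p)) (cell m (snd p)) \<partial>SQ)" for G
  proof -
    have eq: "(\<integral>p. u i k p * G (cell m (fst p)) (cell m (snd p)) \<partial>SQ) =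
      (\<integral>p. u i k p * (\<lambda>a c. G (h a) (h c)) (cell n (fst p)) (cell n (snd p)) \<partial>SQ)" for i
      by (intro Bochner_Integration.integral_cong refl) (auto simp: h space_SQ)
    have "(\<integral>p. u (Suc n) k p * G (cell m (fst p)) (cell m (snd p)) \<partial>SQ) =
        (\<integral>p. u n k p * G (cell m (fst p)) (cell m (snd p)) \<partial>SQ)"
      unfolding eq by (rule inner_Suc)
    also have "\<dots> = (\<integral>p. u m k p * G (cell m (fst p)) (cell m (snd p)) \<partial>SQ)"
      by (rule step.IH[THEN conjunct2, THEN spec])
    finally show ?thesis .
  qed
  moreover have "\<forall>x\<ge>0. cell m x = h (cell (Suc n) x div q n)" using h cell_Suc[of _ n] by simp
  then have "\<exists>h. \<forall>x\<ge>0. cell m x = h (cell (Suc n) x)" by (intro exI[of _ "\<lambda>a. h (a div q n)"])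
  ultimately show ?case by blast
qed

text \<open>The mean square of the step kernel. By orthogonality of the increments it increases with the level, and it is at most \<open>1\<close>.\<close>

definition energy :: "nat \<Rightarrow> nat \<Rightarrow> real" where "energy k m = (\<integral>p. (u m k p)\<^sup>2 \<partial>SQ)"

lemma integrable_u_mult: "integrable SQ (\<lambda>p. u m k p * u n k p)"
proof (rule SQ.integrable_const_bound[of _ 1])
  have "\<bar>u m k p\<bar> * \<bar>u n k p\<bar> \<le> 1 * 1" for p by (intro mult_mono u_bound) auto
  then show "AE p in SQ. norm (u m k p * u n k p) \<le> 1" by (simp add: abs_mult)
qed (intro borel_measurable_times u_measurable)

lemma energy_diff:
  assumes "m \<le> n"
  shows "(\<integral>p. (u n k p - u m k p)\<^sup>2 \<partial>SQ) = energy k n - energy k m"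
proof -
  have eq: "(\<integral>p. u n k p * u m k p \<partial>SQ) = (\<integral>p. u m k p * u m k p \<partial>SQ)"
    using inner_le[OF assms, of k, THEN conjunct2, THEN spec, of "U m k"] by (simp only: u_def[of m])
  have "(\<integral>p. (u n k p - u m k p)\<^sup>2 \<partial>SQ) =
    (\<integral>p. u n k p * u n k p - 2 * (u n k p * u m k p) + u m k p * u m k p \<partial>SQ)"
    by (simp add: power2_eq_square algebra_simps)
  also have "\<dots> = (\<integral>p. u n k p * u n k p \<partial>SQ) - 2 * (\<integral>p. u n k p * u m k p \<partial>SQ) +
      (\<integral>p. u m k p * u m k p \<partial>SQ)"
    by (simp add: Bochner_Integration.integral_add Bochner_Integration.integral_diff integrable_u_mult
        Bochner_Integration.integrable_diff)
  finally show ?thesis unfolding eq energy_def by (simp add: power2_eq_square)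
qed

lemma energy_mono: "m \<le> n \<Longrightarrow> energy k m \<le> energy k n"
proof -
  assume "m \<le> n"
  have "0 \<le> (\<integral>p. (u n k p - u m k p)\<^sup>2 \<partial>SQ)" by (rule Bochner_Integration.integral_nonneg) simp
  then show ?thesis using energy_diff[OF \<open>m \<le> n\<close>, of k] by simp
qed

lemma energy_le: "energy k m \<le> 1"
proof -
  have "(u m k p)\<^sup>2 \<le> 1" for p using u_bound by (simp add: abs_square_le_1)
  then show ?thesis unfolding energy_def power2_eq_square
    by (intro SQ.integral_le_const integrable_u_mult) (simp add: power2_eq_square)
qed

lemma L1_diff_le:
  assumes "m \<le> n"
  shows "(\<integral>p. \<bar>u n k p - u m k p\<bar> \<partial>SQ)\<^sup>2 \<le> energy k n - energy k m"
  unfolding energy_diff[OF assms, symmetric]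
proof (rule SQ.L1_le_L2)
  show "\<bar>u n k p - u m k p\<bar> \<le> 2" for p using u_bound[of n k p] u_bound[of m k p] by linarith
qed (intro borel_measurable_diff u_measurable)

text \<open>
  A diagonal choice: the first \<open>j + 1\<close> moments are controlled at the \<open>j\<close>th step, so that for each \<open>k\<close> all but finitely many
  increments are small.
\<close>

lemma fast_subsequence:
  obtains R where "strict_mono R"
    "\<And>k j. k \<le> j \<Longrightarrow> (\<integral>p. \<bar>u (R (Suc j)) k p - u (R j) k p\<bar> \<partial>SQ) \<le> (1/2) ^ j"
proof -
  have "\<exists>N. \<forall>m\<ge>N. \<forall>n\<ge>m. energy k n - energy k m \<le> (1/4) ^ j" for k j :: nat
  proof -
    have "Cauchy (energy k)"
      using incseq_convergent[of "energy k" 1] energy_mono energy_le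
      by (metis LIMSEQ_imp_Cauchy incseq_def)
    then obtain N where N: "\<forall>m\<ge>N. \<forall>n\<ge>N. dist (energy k m) (energy k n) < (1/4) ^ j"
      unfolding Cauchy_def by (metis zero_less_power zero_less_divide_1_iff zero_less_numeral)
    have "energy k n - energy k m \<le> (1/4) ^ j" if "N \<le> m" "m \<le> n" for m n
    proof -
      have "dist (energy k m) (energy k n) < (1/4) ^ j" using N that order_trans[OF that] by blast
      then show ?thesis by (simp add: dist_real_def)
    qed
    then show ?thesis by blast
  qed
  then obtain N where N: "\<And>k j m n. N k j \<le> m \<Longrightarrow> m \<le> n \<Longrightarrow> energy k n - energy k m \<le> (1/4) ^ j"
    by metis
  define R where "R j = (\<Sum>i\<le>j. \<Sum>k\<le>i. N k i) + j" for j
  have R: "strict_mono R" unfolding strict_mono_Suc_iff R_def by simp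
  have "(\<integral>p. \<bar>u (R (Suc j)) k p - u (R j) k p\<bar> \<partial>SQ) \<le> (1/2) ^ j" if "k \<le> j" for k j
  proof -
    have "N k j \<le> (\<Sum>k\<le>j. N k j)" using that by (intro member_le_sum) auto
    also have "\<dots> \<le> (\<Sum>i\<le>j. \<Sum>k\<le>i. N k i)" by (rule member_le_sum) auto
    finally have "N k j \<le> R j" by (simp add: R_def)
    moreover have le: "R j \<le> R (Suc j)" using R by (simp add: strict_mono_Suc_iff less_imp_le)
    ultimately have "(\<integral>p. \<bar>u (R (Suc j)) k p - u (R j) k p\<bar> \<partial>SQ)\<^sup>2 \<le> (1/4) ^ j"
      using L1_diff_le[OF le, of k] N[of k j "R j" "R (Suc j)"] by linarith
    also have "(1/4) ^ j = ((1/2 :: real) ^ j)\<^sup>2" by (simp add: power2_eq_square flip: power_mult_distrib)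
    finally show ?thesis by (rule power2_le_imp_le) simp
  qed
  with R show thesis by (rule that)
qed

lemma AE_convergent:
  assumes R: "\<And>k j. k \<le> j \<Longrightarrow> (\<integral>p. \<bar>u (R (Suc j)) k p - u (R j) k p\<bar> \<partial>SQ) \<le> (1/2) ^ j"
  shows "AE p in SQ. \<forall>k. convergent (\<lambda>j. u (R j) k p)"
proof (subst AE_all_countable, rule allI)
  fix k
  let ?D = "\<lambda>j p. \<bar>u (R (Suc j)) k p - u (R j) k p\<bar>"
  have m: "?D j \<in> borel_measurable SQ" for j by (intro borel_measurable_abs borel_measurable_diff u_measurable)
  have bd: "?D j p \<le> 2" for j p using u_bound[of "R (Suc j)" k p] u_bound[of "R j" k p] by linarith
  have int: "integrable SQ (?D j)" for j
    by (rule SQ.integrable_const_bound[of _ 2]) (use m bd in auto)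
  have "summable (\<lambda>j. \<integral>p. ?D j p \<partial>SQ)"
  proof (rule summable_comparison_test')
    show "summable (\<lambda>j. (1/2 :: real) ^ j)" by (simp add: summable_geometric)
    show "norm (\<integral>p. ?D j p \<partial>SQ) \<le> (1/2) ^ j" if "k \<le> j" for j using R[OF that] by simp
  qed
  then have fin: "(\<Sum>j. ennreal (\<integral>p. ?D j p \<partial>SQ)) \<noteq> \<infinity>"
    unfolding infinity_ennreal_def
    by (rule ennreal_suminf_neq_top) (rule Bochner_Integration.integral_nonneg, rule abs_ge_zero)
  have em: "(\<lambda>p. ennreal (?D j p)) \<in> borel_measurable SQ" for j
    using m by (rule measurable_compose) simp
  have "(\<integral>\<^sup>+p. ennreal (?D j p) \<partial>SQ) = ennreal (\<integral>p. ?D j p \<partial>SQ)" for j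
    by (rule nn_integral_eq_integral[OF int]) simp
  then have "(\<integral>\<^sup>+p. (\<Sum>j. ennreal (?D j p)) \<partial>SQ) \<noteq> \<infinity>"
    unfolding nn_integral_suminf[OF em] using fin by simp
  then have "AE p in SQ. (\<Sum>j. ennreal (?D j p)) \<noteq> \<infinity>"
    by (rule nn_integral_noteq_infinite[rotated]) (rule borel_measurable_suminf_order, rule em)
  then show "AE p in SQ. convergent (\<lambda>j. u (R j) k p)"
  proof eventually_elim
    case (elim p)
    then have "summable (\<lambda>j. ?D j p)" by (intro summable_suminf_not_top) auto
    then have "summable (\<lambda>j. u (R (Suc j)) k p - u (R j) k p)" by (rule summable_rabs_cancel)
    then have "convergent (\<lambda>n. u (R n) k p - u (R 0) k p)"
      by (simp add: summable_iff_convergent sum_lessThan_telescope[of "\<lambda>n. u (R n) k p"])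
    from convergent_add[OF this convergent_const[of "u (R 0) k p"]] show ?case by simp
  qed
qed

text \<open>
  The graphon is the almost everywhere limit of the step graphons. Where some moment diverges, the point mass at \<open>0\<close>
  is used. The value \<open>W x y\<close> is chosen as a function of the moment sequence alone, so that symmetry is inherited.
\<close>

theorem limit_graphon:
  obtains W R where "is_graphon d W" "strict_mono R"
    "\<And>F. (\<lambda>j. d ^ edge_count F * fin_dens F {..<M (R j)} (w (R j)) (U (R j))) \<longlonglongrightarrow> t_graphon F W"
proof -
  obtain R where R: "strict_mono R"
    "\<And>k j. k \<le> j \<Longrightarrow> (\<integral>p. \<bar>u (R (Suc j)) k p - u (R j) k p\<bar> \<partial>SQ) \<le> (1/2) ^ j"
    using fast_subsequence by blast
  define z where "z k p = (if \<forall>k. convergent (\<lambda>j. u (R j) k p) then lim (\<lambda>j. u (R j) k p) else 0 ^ k)" for k p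
  have z_lim: "(\<lambda>j. u (R j) k p) \<longlonglongrightarrow> z k p" if "\<forall>k. convergent (\<lambda>j. u (R j) k p)" for k p
  proof -
    have "z k p = lim (\<lambda>j. u (R j) k p)" unfolding z_def using that by (rule if_P)
    moreover have "(\<lambda>j. u (R j) k p) \<longlonglongrightarrow> lim (\<lambda>j. u (R j) k p)"
      using that unfolding convergent_LIMSEQ_iff by (rule spec)
    ultimately show ?thesis by (simp only:)
  qed
  have "AE p in SQ. \<forall>k. convergent (\<lambda>j. u (R j) k p)" by (rule AE_convergent) (rule R(2))
  then have conv: "AE p in SQ. (\<lambda>j. u (R j) k p) \<longlonglongrightarrow> z k p" for k
  proof eventually_elim
    case (elim p)
    then show ?case by (rule z_lim)
  qed
  have z_meas: "z k \<in> borel_measurable SQ" for k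
  proof -
    have "Measurable.pred SQ (\<lambda>p. convergent (\<lambda>j. u (R j) i p))" for i
      unfolding Cauchy_convergent_iff[symmetric] using u_measurable by measurable
    then have "Measurable.pred SQ (\<lambda>p. \<forall>k. convergent (\<lambda>j. u (R j) k p))" by measurable
    moreover have "(\<lambda>p. lim (\<lambda>j. u (R j) k p)) \<in> borel_measurable SQ"
      by (intro borel_measurable_lim_metric u_measurable)
    ultimately show ?thesis unfolding z_def[abs_def] by measurable
  qed
  have z_mom: "moment_seq d (\<lambda>k. z k p)" for p
  proof (cases "\<forall>k. convergent (\<lambda>j. u (R j) k p)")
    case True
    then have "(\<lambda>j. u (R j) k p) \<longlonglongrightarrow> z k p" for k by (rule z_lim)
    moreover have "moment_seq d (\<lambda>k. u (R j) k p)" for j unfolding u_def by (rule U_moments)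
    ultimately show ?thesis by (rule moment_seq_closed[OF d, rotated])
  next
    case False
    have "z k p = 0 ^ k" for k unfolding z_def using False by (rule if_not_P)
    then show ?thesis using moment_seq_zero[OF d] by (simp only:)
  qed
  have z_sym: "z k (x, y) = z k (y, x)" for k x y
  proof -
    have "u m k (x, y) = u m k (y, x)" for m k unfolding u_def fst_conv snd_conv by (rule U_sym)
    then show ?thesis by (simp add: z_def)
  qed
  define P where "P s \<mu> \<longleftrightarrow> \<mu> \<in> prob_measures d \<and> (\<forall>k. (\<integral>s. s ^ k \<partial>\<mu>) = d ^ k * s k)"
    for s :: "nat \<Rightarrow> real" and \<mu>
  define W where "W x y = (SOME \<mu>. P (\<lambda>k. z k (x, y)) \<mu>)" for x y
  have W: "W x y \<in> prob_measures d" "(\<integral>s. s ^ k \<partial>W x y) = d ^ k * z k (x, y)" for x y k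
  proof -
    have "\<exists>\<mu>. P (\<lambda>k. z k (x, y)) \<mu>" using z_mom[of "(x, y)"] unfolding moment_seq_def P_def by blast
    then have "P (\<lambda>k. z k (x, y)) (W x y)" unfolding W_def by (rule someI_ex)
    then show "W x y \<in> prob_measures d" "(\<integral>s. s ^ k \<partial>W x y) = d ^ k * z k (x, y)"
      unfolding P_def by auto
  qed
  have ident: "(\<lambda>p. p) \<in> lebesgue_on ({0..1} \<times> {0..1}) \<rightarrow>\<^sub>M SQ"
  proof -
    have "(\<lambda>p. f p) \<in> lebesgue_on ({0..1} \<times> {0..1}) \<rightarrow>\<^sub>M I01"
      if f: "f \<in> borel \<rightarrow>\<^sub>M borel" "\<And>p. p \<in> {0..1} \<times> {0..1} \<Longrightarrow> f p \<in> {0..1}"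
      for f :: "real \<times> real \<Rightarrow> real"
    proof (rule measurable_restrict_space2)
      have "f \<in> lebesgue \<rightarrow>\<^sub>M lborel" using f(1) by (intro measurable_completion) simp
      then show "f \<in> lebesgue_on ({0..1} \<times> {0..1}) \<rightarrow>\<^sub>M lborel" by (rule measurable_restrict_space1)
    qed (use f(2) in \<open>auto simp: space_restrict_space\<close>)
    from this[of fst] this[of snd] have "(\<lambda>p. (fst p, snd p)) \<in> lebesgue_on ({0..1} \<times> {0..1}) \<rightarrow>\<^sub>M SQ"
      by (intro measurable_Pair) (auto simp: borel_measurable_continuous_onI continuous_on_fst continuous_on_snd)
    then show ?thesis by simp
  qed
  have graphon: "is_graphon d W"
    unfolding is_graphon_def
  proof (intro conjI ballI)
    show "W x y = W y x" for x y unfolding W_def by (simp add: z_sym[of _ x y])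
    show "(\<lambda>(x, y). W x y) \<in> lebesgue_on ({0..1} \<times> {0..1}) \<rightarrow>\<^sub>M borel_prob_measures d"
    proof (rule measurable_borel_prob_measuresI)
      fix k
      have "(\<lambda>p. d ^ k * z k p) \<in> borel_measurable (lebesgue_on ({0..1} \<times> {0..1}))"
        by (intro borel_measurable_times borel_measurable_const measurable_compose[OF ident z_meas])
      then show "(\<lambda>p. \<integral>s. s ^ k \<partial>(case p of (x, y) \<Rightarrow> W x y)) \<in> borel_measurable (lebesgue_on ({0..1} \<times> {0..1}))"
        by (simp add: case_prod_beta W(2))
    qed (auto simp: W(1))
  qed
  have "(\<lambda>j. d ^ edge_count F * fin_dens F {..<M (R j)} (w (R j)) (U (R j))) \<longlonglongrightarrow> t_graphon F W" for F
  proof -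
    define b where "b m k x y = u m k (x, y)" for m k x y
    define y where "y k x y' = z k (x, y')" for k x y'
    have y: "t_graphon F W = d ^ edge_count F * graph_dens F y"
      by (rule t_graphon_eq_graph_dens) (simp_all add: y_def z_meas moment_def W(2))
    have b: "fin_dens F {..<M m} (w m) (U m) = graph_dens F (b m)" for m
      unfolding b_def u_def fst_conv snd_conv
      by (rule graph_dens_step[OF cell_measurable cell_less cell_fibre, symmetric])
    define e where "e k j = (\<integral>p. \<bar>u (R j) k p - z k p\<bar> \<partial>SQ)" for k j
    have e: "e k \<longlonglongrightarrow> 0" for k
    proof -
      have "(\<lambda>j. \<integral>p. \<bar>u (R j) k p - z k p\<bar> \<partial>SQ) \<longlonglongrightarrow> (\<integral>p. 0 \<partial>SQ)"
      proof (rule integral_dominated_convergence[where w = "\<lambda>_. 2"])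
        show "AE p in SQ. (\<lambda>j. \<bar>u (R j) k p - z k p\<bar>) \<longlonglongrightarrow> 0"
          using conv[of k] by eventually_elim (simp add: LIM_zero tendsto_rabs_zero)
        show "AE p in SQ. norm \<bar>u (R j) k p - z k p\<bar> \<le> 2" for j
        proof (rule AE_I2)
          fix p show "norm \<bar>u (R j) k p - z k p\<bar> \<le> 2"
            using u_bound[of "R j" k p] moment_seq_bounds[OF d z_mom, of k p] by simp
        qed
      qed (auto intro!: borel_measurable_abs borel_measurable_diff u_measurable z_meas)
      then show ?thesis by (simp add: e_def[abs_def])
    qed
    have "(\<lambda>j. graph_dens F (b (R j)) - graph_dens F y) \<longlonglongrightarrow> 0"
    proof (rule Lim_null_comparison)
      show "\<forall>\<^sub>F j in sequentially. norm (graph_dens F (b (R j)) - graph_dens F y) \<le>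
          (\<Sum>(i, l)\<in>node_pairs F. e (edge_mult F i l) j)"
      proof (intro always_eventually allI)
        fix j
        show "norm (graph_dens F (b (R j)) - graph_dens F y) \<le> (\<Sum>(i, l)\<in>node_pairs F. e (edge_mult F i l) j)"
          using graph_dens_L1[of "b (R j)" y F] u_measurable z_meas u_bound moment_seq_bounds[OF d z_mom]
          by (simp add: b_def y_def e_def)
      qed
      show "(\<lambda>j. \<Sum>(i, l)\<in>node_pairs F. e (edge_mult F i l) j) \<longlonglongrightarrow> 0"
        by (rule tendsto_null_sum) (auto simp: e)
    qed
    then have "(\<lambda>j. d ^ edge_count F * graph_dens F (b (R j))) \<longlonglongrightarrow> d ^ edge_count F * graph_dens F y"
      by (intro tendsto_mult_left) (rule LIM_zero_cancel)
    then show ?thesis unfolding y b .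
  qed
  with graphon R(1) show thesis by (rule that)
qed

end

section \<open>Convergent sequences of weighted graphs have limit graphons\<close>

text \<open>Tychonoff's theorem for a countable product of intervals, in sequential form.\<close>

lemma bounded_family_convergent_subseq:
  fixes X :: "nat \<Rightarrow> 'i::countable \<Rightarrow> real"
  assumes "\<And>n i. \<bar>X n i\<bar> \<le> 1"
  obtains s Y where "strict_mono s" "\<And>i. (\<lambda>n. X (s n) i) \<longlonglongrightarrow> Y i"
proof -
  let ?K = "PiE UNIV (\<lambda>_::'i. {-1..1::real})"
  have "compactin (product_topology (\<lambda>_. euclidean) UNIV) ?K"
    by (simp add: compactin_PiE)
  then have "compact ?K" by (simp add: euclidean_product_topology)
  then have "seq_compact ?K" by (simp add: compact_eq_seq_compact_metric)
  moreover have "\<forall>n. X n \<in> ?K" using assms by (auto simp: PiE_UNIV_domain abs_le_iff minus_le_iff)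
  ultimately obtain Y s where "strict_mono s" and lim: "(X \<circ> s) \<longlonglongrightarrow> Y"
    by (rule seq_compactE)
  moreover have "(\<lambda>n. X (s n) i) \<longlonglongrightarrow> Y i" for i
    using continuous_on_tendsto_compose[OF continuous_on_product_coordinates[of i] lim] by simp
  ultimately show thesis using that by blast
qed

text \<open>Nodeweights with total \<open>1\<close>, and edgeweights divided by \<open>d\<close>, extended by \<open>0\<close>.\<close>

definition mean_weight :: "weighted_graph \<Rightarrow> nat \<Rightarrow> real" where
  "mean_weight H i = nodeweight H i / (\<Sum>j\<in>wnodes H. nodeweight H j)"

definition scaled_weight :: "real \<Rightarrow> weighted_graph \<Rightarrow> nat \<Rightarrow> nat \<Rightarrow> real" where
  "scaled_weight d H x y = (if x \<in> wnodes H \<and> y \<in> wnodes H then edgeweight H x y / d else 0)"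

lemma
  assumes H: "is_weighted_graph d H" and d: "0 < d"
  shows finite_prob_mean_weight: "finite_prob (wnodes H) (mean_weight H)"
    and scaled_weight_le: "\<bar>scaled_weight d H x y\<bar> \<le> 1"
    and scaled_weight_sym: "scaled_weight d H x y = scaled_weight d H y x"
    and t_weighted_scaled: "t_weighted F H =
      d ^ edge_count F * fin_dens F (wnodes H) (mean_weight H) (\<lambda>k x y. scaled_weight d H x y ^ k)"
proof -
  have pos: "0 < (\<Sum>j\<in>wnodes H. nodeweight H j)"
    using H by (intro sum_pos) (auto simp: is_weighted_graph_def)
  show "finite_prob (wnodes H) (mean_weight H)"
    using H pos
    by unfold_locales (auto simp: is_weighted_graph_def mean_weight_def sum_divide_distrib[symmetric] less_imp_le)
  show "\<bar>scaled_weight d H x y\<bar> \<le> 1" "scaled_weight d H x y = scaled_weight d H y x"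
    using H d by (auto simp: is_weighted_graph_def scaled_weight_def abs_le_iff field_simps)
  have "d ^ k * scaled_weight d H x y ^ k = edgeweight H x y ^ k" if "x \<in> wnodes H" "y \<in> wnodes H" for k x y
    using that d by (simp add: scaled_weight_def power_mult_distrib[symmetric])
  then have "fin_dens F (wnodes H) (mean_weight H) (\<lambda>k x y. d ^ k * scaled_weight d H x y ^ k) =
      fin_dens F (wnodes H) (mean_weight H) (\<lambda>k x y. edgeweight H x y ^ k)"
    by (intro fin_dens_cong) auto
  then show "t_weighted F H =
      d ^ edge_count F * fin_dens F (wnodes H) (mean_weight H) (\<lambda>k x y. scaled_weight d H x y ^ k)"
    unfolding t_weighted_eq_fin_dens fin_dens_scale[symmetric] by (simp add: mean_weight_def[abs_def])
qed

text \<open>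
  The numbers of parts in the nested regular partitions depend only on the level \<open>m\<close>; level \<open>m + 1\<close> is
  regular with error \<open>1 / (m + 1)\<close> for the first \<open>m + 1\<close> moments. The exponent in \<open>parts m\<close> is the number of
  energy increments, which has to exceed \<open>(m + 1) / (1 / (m + 1))\<^sup>2\<close>.
\<close>

definition parts :: "nat \<Rightarrow> nat" where "parts m = 4 ^ (Suc m ^ 3 + 1)"

definition cells :: "nat \<Rightarrow> nat" where "cells m = (\<Prod>i<m. parts i)"

lemma cells_Suc: "cells (Suc m) = cells m * parts m"
  by (simp add: cells_def)

lemma parts_pos: "0 < parts m"
  by (simp add: parts_def)

text \<open>
  The averages of the powers of \<open>\<beta>\<close> over a pair of cells are the moments of the distribution of \<open>d * \<beta> x y\<close> for a random pair of points of
  these cells.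
\<close>

lemma (in finite_prob) quot_moment_seq:
  assumes \<beta>: "\<And>x y. \<bar>\<beta> x y\<bar> \<le> 1" and d: "0 < d"
  shows "moment_seq d (\<lambda>k. quot V \<alpha> p (\<lambda>k x y. \<beta> x y ^ k) k a c)"
proof (cases "cell_wt V \<alpha> p a * cell_wt V \<alpha> p c = 0")
  case True
  then show ?thesis using moment_seq_zero[OF d] by (simp add: quot_def)
next
  case False
  let ?A = "{x\<in>V. p x = a}" and ?C = "{y\<in>V. p y = c}"
  let ?w = "cell_wt V \<alpha> p a * cell_wt V \<alpha> p c"
  have "0 < ?w" using False cell_wt_nonneg[of p a] cell_wt_nonneg[of p c] by (simp add: less_le)
  have one: "(\<Sum>(x, y)\<in>?A \<times> ?C. \<alpha> x * \<alpha> y / ?w) = 1"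
  proof -
    have "(\<Sum>(x, y)\<in>?A \<times> ?C. \<alpha> x * \<alpha> y / ?w) = (\<Sum>x\<in>?A. \<Sum>y\<in>?C. \<alpha> x * \<alpha> y) / ?w"
      by (simp add: sum.cartesian_product sum_divide_distrib case_prod_beta)
    also have "(\<Sum>x\<in>?A. \<Sum>y\<in>?C. \<alpha> x * \<alpha> y) = ?w" by (simp add: cell_wt_def sum_product)
    finally show ?thesis using False by simp
  qed
  have "moment_seq d (\<lambda>k. \<Sum>e\<in>?A \<times> ?C. \<alpha> (fst e) * \<alpha> (snd e) / ?w * \<beta> (fst e) (snd e) ^ k)"
    using \<open>0 < ?w\<close> one \<beta> d
    by (intro moment_seq_finite) (auto simp: nonneg case_prod_beta)
  moreover have "(\<Sum>e\<in>?A \<times> ?C. \<alpha> (fst e) * \<alpha> (snd e) / ?w * \<beta> (fst e) (snd e) ^ k) =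
      quot V \<alpha> p (\<lambda>k x y. \<beta> x y ^ k) k a c" for k
    using False by (simp add: quot_def sum.cartesian_product sum_divide_distrib case_prod_beta)
  ultimately show ?thesis by simp
qed

text \<open>
  All the data of the step kernels are indexed independently of \<open>H\<close>, which is what compactness needs.
\<close>

theorem regular_quotients:
  assumes H: "is_weighted_graph d H" and d: "0 < d"
  obtains w U where "refining d parts cells w U"
    "\<And>F m. (\<And>i j. (i, j) \<in> node_pairs F \<Longrightarrow> edge_mult F i j \<le> m) \<Longrightarrow>
       \<bar>t_weighted F H - d ^ edge_count F * fin_dens F {..<cells (Suc m)} (w (Suc m)) (U (Suc m))\<bar> \<le>
       d ^ edge_count F * (real (card (node_pairs F)) * (1 / real (Suc m)))"
proof -
  define V where "V = wnodes H"
  define \<alpha> where "\<alpha> = mean_weight H"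
  define \<beta> where "\<beta> = scaled_weight d H"
  define b where "b k x y = \<beta> x y ^ k" for k x y
  have \<beta>: "\<bar>\<beta> x y\<bar> \<le> 1" "\<beta> x y = \<beta> y x" for x y
    unfolding \<beta>_def by (rule scaled_weight_le[OF H d] scaled_weight_sym[OF H d])+
  have b: "\<bar>b k x y\<bar> \<le> 1" for k x y
    unfolding b_def power_abs using \<beta>(1) by (intro power_le_one) auto
  interpret finite_prob V \<alpha> unfolding V_def \<alpha>_def by (rule finite_prob_mean_weight[OF H d])
  define good where "good m p p' \<longleftrightarrow> (\<exists>s. (\<forall>x. s x < parts m) \<and> p' = (\<lambda>x. parts m * p x + s x)) \<and>
      (\<forall>k<Suc m. cut_le V \<alpha> (\<lambda>x y. b k x y - quot V \<alpha> p' b k (p' x) (p' y)) (1 / real (Suc m)))"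
    for m and p p' :: "nat \<Rightarrow> nat"
  have "\<exists>p'. good m p p'" for m p
  proof -
    have lt: "real (Suc m) < real (Suc m ^ 3 + 1) * (1 / real (Suc m))\<^sup>2"
    proof -
      define x where "x = real (Suc m)"
      have x: "0 < x" by (simp add: x_def)
      have "real (Suc m ^ 3 + 1) * (1 / x)\<^sup>2 = (x ^ 3 + 1) * (1 / x)\<^sup>2" by (simp add: x_def)
      also have "\<dots> = x + (1 / x)\<^sup>2"
        using x by (simp add: power2_eq_square power3_eq_cube field_simps)
      also have "x < x + (1 / x)\<^sup>2" using x by simp
      finally show ?thesis by (simp only: x_def)
    qed
    have "0 \<le> 1 / real (Suc m)" by simp
    then obtain s where s: "\<And>x. s x < 4 ^ (Suc m ^ 3 + 1)"
      "\<And>k. k < Suc m \<Longrightarrow> cut_le V \<alpha> (\<lambda>x y. b k x y - quot V \<alpha> (\<lambda>x. 4 ^ (Suc m ^ 3 + 1) * p x + s x) b k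
         (4 ^ (Suc m ^ 3 + 1) * p x + s x) (4 ^ (Suc m ^ 3 + 1) * p y + s y)) (1 / real (Suc m))"
      using weak_regularity[of "1 / real (Suc m)" "Suc m" "Suc m ^ 3 + 1" b p, OF _ lt b] by blast
    have "good m p (\<lambda>x. parts m * p x + s x)"
      unfolding good_def parts_def using s by blast
    then show ?thesis by blast
  qed
  then obtain step where step: "\<And>m p. good m p (step m p)" by metis
  define p where "p = rec_nat (\<lambda>_. 0) step"
  have p0: "p 0 = (\<lambda>_. 0)" and "p (Suc m) = step m (p m)" for m by (simp_all add: p_def)
  then have good: "good m (p m) (p (Suc m))" for m using step by simp
  then have ps: "\<exists>s. (\<forall>x. s x < parts m) \<and> p (Suc m) = (\<lambda>x. parts m * p m x + s x)" for m
    unfolding good_def by blast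
  have cut: "cut_le V \<alpha> (\<lambda>x y. b k x y - quot V \<alpha> (p (Suc m)) b k (p (Suc m) x) (p (Suc m) y)) (1 / real (Suc m))"
    if "k < Suc m" for m k
    using good[of m] that unfolding good_def by blast
  have div: "p m x = p (Suc m) x div parts m" for m x
  proof -
    from ps[of m] obtain s where s: "\<forall>x. s x < parts m" "p (Suc m) = (\<lambda>x. parts m * p m x + s x)"
      by blast
    then have "s x < parts m" "p (Suc m) x = parts m * p m x + s x" by auto
    then show ?thesis by simp
  qed
  have p_less: "p m x < cells m" for m x
  proof (induction m)
    case (Suc m)
    then show ?case using div[of m x] parts_pos[of m] by (simp add: cells_Suc div_less_iff_less_mult)
  qed (simp add: p0 cells_def)
  \<comment> \<open>A sum over a cell splits into the sums over its parts.\<close>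
  have split: "(\<Sum>x\<in>{x\<in>V. p m x = a}. h x) = (\<Sum>r<parts m. \<Sum>x\<in>{x\<in>V. p (Suc m) x = a * parts m + r}. h x)"
    for m a and h :: "nat \<Rightarrow> real"
  proof -
    have "(\<Sum>r<parts m. \<Sum>x\<in>{x\<in>{x\<in>V. p m x = a}. p (Suc m) x mod parts m = r}. h x) =
        (\<Sum>x\<in>{x\<in>V. p m x = a}. h x)"
      using parts_pos[of m] by (intro sum.group) auto
    moreover have "{x\<in>{x\<in>V. p m x = a}. p (Suc m) x mod parts m = r} = {x\<in>V. p (Suc m) x = a * parts m + r}"
      if "r < parts m" for r
    proof -
      have "p m x = a \<and> p (Suc m) x mod parts m = r \<longleftrightarrow> p (Suc m) x = a * parts m + r" for x
        using that unfolding div[of m x] by (metis div_mult_mod_eq div_mult_self3 mod_less mod_mult_self3 div_less add.right_neutral add.commute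
            less_nat_zero_code)
      then show ?thesis by auto
    qed
    ultimately show ?thesis by simp
  qed
  define w where "w m = cell_wt V \<alpha> (p m)" for m
  define U where "U m = quot V \<alpha> (p m) b" for m
  have "refining d parts cells w U"
  proof (rule refining.intro)
    fix m k a c
    show "interval_partition (cells m) (w m)"
    proof
      have "(\<Sum>a<cells m. \<Sum>x\<in>{x\<in>V. p m x = a}. \<alpha> x) = (\<Sum>x\<in>V. \<alpha> x)"
        using p_less by (intro sum.group) auto
      then show "(\<Sum>a<cells m. w m a) = 1" by (simp add: w_def cell_wt_def total)
    qed (simp add: w_def cell_wt_nonneg)
    show "w m a = (\<Sum>r<parts m. w (Suc m) (a * parts m + r))"
      unfolding w_def cell_wt_def by (rule split)
    show "U m k a c = U m k c a"
      unfolding U_def by (rule quot_sym) (simp add: b_def \<beta>(2))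
    show "moment_seq d (\<lambda>k. U m k a c)"
      unfolding U_def b_def[abs_def] by (rule quot_moment_seq[OF \<beta>(1) d])
    let ?q = "parts m"
    have "w m a * w m c * U m k a c = (\<Sum>x\<in>{x\<in>V. p m x = a}. \<Sum>y\<in>{y\<in>V. p m y = c}. \<alpha> x * \<alpha> y * b k x y)"
      unfolding w_def U_def by (rule quot_fibre[symmetric])
    also have "\<dots> = (\<Sum>r<?q. \<Sum>x\<in>{x\<in>V. p (Suc m) x = a * ?q + r}. \<Sum>s<?q.
        \<Sum>y\<in>{y\<in>V. p (Suc m) y = c * ?q + s}. \<alpha> x * \<alpha> y * b k x y)"
      by (simp only: split[where m = m])
    also have "\<dots> = (\<Sum>r<?q. \<Sum>s<?q. \<Sum>x\<in>{x\<in>V. p (Suc m) x = a * ?q + r}.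
        \<Sum>y\<in>{y\<in>V. p (Suc m) y = c * ?q + s}. \<alpha> x * \<alpha> y * b k x y)"
      by (intro sum.cong refl sum.swap)
    also have "\<dots> = (\<Sum>r<?q. \<Sum>s<?q. w (Suc m) (a * ?q + r) * w (Suc m) (c * ?q + s) *
        U (Suc m) k (a * ?q + r) (c * ?q + s))"
      unfolding w_def U_def quot_fibre ..
    finally show "w m a * w m c * U m k a c = (\<Sum>r<?q. \<Sum>s<?q. w (Suc m) (a * ?q + r) * w (Suc m) (c * ?q + s) *
        U (Suc m) k (a * ?q + r) (c * ?q + s))" .
  qed (use d parts_pos cells_Suc in auto)
  moreover have "\<bar>t_weighted F H - d ^ edge_count F * fin_dens F {..<cells (Suc m)} (w (Suc m)) (U (Suc m))\<bar> \<le>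
       d ^ edge_count F * (real (card (node_pairs F)) * (1 / real (Suc m)))"
    if F: "\<And>i j. (i, j) \<in> node_pairs F \<Longrightarrow> edge_mult F i j \<le> m" for F m
  proof -
    let ?p = "p (Suc m)"
    have pf: "fin_dens F {..<cells (Suc m)} (w (Suc m)) (U (Suc m)) = fin_dens F V \<alpha> (\<lambda>k x y. U (Suc m) k (?p x) (?p y))"
      unfolding w_def cell_wt_def[abs_def]
      by (rule fin_dens_pushforward[symmetric]) (use p_less in auto)
    have cl: "\<bar>fin_dens F V \<alpha> b - fin_dens F V \<alpha> (\<lambda>k x y. U (Suc m) k (?p x) (?p y))\<bar> \<le>
        real (card (node_pairs F)) * (1 / real (Suc m))"
    proof (rule counting_lemma[OF finV nonneg total b])
      show "\<bar>U (Suc m) k (?p x) (?p y)\<bar> \<le> 1" for k x y unfolding U_def by (rule quot_abs_le) (rule b)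
      show "cut_le V \<alpha> (\<lambda>x y. b (edge_mult F i j) x y - U (Suc m) (edge_mult F i j) (?p x) (?p y)) (1 / real (Suc m))"
        if "(i, j) \<in> node_pairs F" for i j
        unfolding U_def by (rule cut) (use F[OF that] in simp)
    qed
    have tw: "t_weighted F H = d ^ edge_count F * fin_dens F V \<alpha> b"
      unfolding V_def \<alpha>_def b_def[abs_def] \<beta>_def by (rule t_weighted_scaled[OF H d])
    have "0 \<le> d ^ edge_count F" using d by simp
    with cl show ?thesis
      unfolding pf tw right_diff_distrib[symmetric] abs_mult abs_of_nonneg[OF \<open>0 \<le> d ^ edge_count F\<close>]
      by (rule mult_left_mono)
  qed
  ultimately show thesis by (rule that)
qed

text \<open>All conditions on the step kernels are closed.\<close>

lemma refining_limit:
  assumes ref: "\<And>n. refining d q M (w n) (U n)"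
    and w: "\<And>m a. a < M m \<Longrightarrow> (\<lambda>n. w n m a) \<longlonglongrightarrow> w' m a"
    and U: "\<And>m k a c. (\<lambda>n. U n m k a c) \<longlonglongrightarrow> U' m k a c"
  shows "refining d q M w' U'"
proof (rule refining.intro)
  note r = refining.d[OF ref] refining.q[OF ref] refining.M_Suc[OF ref]
  show "0 < d" "\<And>m. 0 < q m" "\<And>m. M (Suc m) = M m * q m" by (rule r)+
  have less: "a * q m + s < M (Suc m)" if "a < M m" "s < q m" for a m s
  proof -
    have "a * q m + s < Suc a * q m" using that by simp
    also have "\<dots> \<le> M m * q m" using that by (intro mult_right_mono) auto
    finally show ?thesis by (simp add: r)
  qed
  fix m k a c :: nat
  show "interval_partition (M m) (w' m)"
  proof
    have ip: "interval_partition (M m) (w n m)" for n by (rule refining.part[OF ref])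
    show "0 \<le> w' m a" if "a < M m" for a
      using interval_partition.w_nonneg[OF ip that] by (intro LIMSEQ_le_const[OF w[OF that]]) auto
    have "(\<lambda>n. \<Sum>a<M m. w n m a) \<longlonglongrightarrow> (\<Sum>a<M m. w' m a)" by (intro tendsto_sum w) auto
    then show "(\<Sum>a<M m. w' m a) = 1"
      unfolding interval_partition.w_total[OF ip] by (simp add: LIMSEQ_const_iff)
  qed
  have "(\<lambda>n. U n m k a c) \<longlonglongrightarrow> U' m k c a"
    unfolding refining.U_sym[OF ref, of _ m k a c] by (rule U)
  then show "U' m k a c = U' m k c a" by (rule LIMSEQ_unique[OF U])
  show "moment_seq d (\<lambda>k. U' m k a c)"
    by (rule moment_seq_closed[OF r(1) refining.U_moments[OF ref] U])
  assume a: "a < M m"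
  have "(\<lambda>n. \<Sum>s<q m. w n (Suc m) (a * q m + s)) \<longlonglongrightarrow> (\<Sum>s<q m. w' (Suc m) (a * q m + s))"
    using a less by (intro tendsto_sum w) auto
  then show "w' m a = (\<Sum>s<q m. w' (Suc m) (a * q m + s))"
    unfolding refining.refine[OF ref a, symmetric] by (rule LIMSEQ_unique[OF w[OF a]])
  assume c: "c < M m"
  have "(\<lambda>n. w n m a * w n m c * U n m k a c) \<longlonglongrightarrow> w' m a * w' m c * U' m k a c"
    by (intro tendsto_mult w U a c)
  moreover have "(\<lambda>n. \<Sum>s<q m. \<Sum>t<q m. w n (Suc m) (a * q m + s) * w n (Suc m) (c * q m + t) *
         U n (Suc m) k (a * q m + s) (c * q m + t)) \<longlonglongrightarrow>
      (\<Sum>s<q m. \<Sum>t<q m. w' (Suc m) (a * q m + s) * w' (Suc m) (c * q m + t) *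
         U' (Suc m) k (a * q m + s) (c * q m + t))"
    using a c less by (intro tendsto_sum tendsto_mult w U) auto
  ultimately show "w' m a * w' m c * U' m k a c =
      (\<Sum>s<q m. \<Sum>t<q m. w' (Suc m) (a * q m + s) * w' (Suc m) (c * q m + t) *
         U' (Suc m) k (a * q m + s) (c * q m + t))"
    unfolding refining.martingale[OF ref a c] by (rule LIMSEQ_unique)
qed

text \<open>
  The approximation of \<open>t_weighted F (H n)\<close> by the quotients of level \<open>m + 1\<close> is uniform in \<open>n\<close>, so the limits in \<open>n\<close> and \<open>m\<close> may be
  interchanged.
\<close>

theorem limit_of_weighted_graphs:
  assumes d: "0 < d" and H: "\<And>n. is_weighted_graph d (H n)"
    and lim: "\<And>F. (\<lambda>n. t_weighted F (H n)) \<longlonglongrightarrow> f F"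
  obtains W where "is_graphon d W" "\<And>F. t_graphon F W = f F"
proof -
  have "\<exists>w U. refining d parts cells w U \<and>
    (\<forall>F m. (\<forall>i j. (i, j) \<in> node_pairs F \<longrightarrow> edge_mult F i j \<le> m) \<longrightarrow>
       \<bar>t_weighted F (H n) - d ^ edge_count F * fin_dens F {..<cells (Suc m)} (w (Suc m)) (U (Suc m))\<bar> \<le>
       d ^ edge_count F * (real (card (node_pairs F)) * (1 / real (Suc m))))" for n
    using regular_quotients[OF H[of n] d] by metis
  then obtain w U where ref: "\<And>n. refining d parts cells (w n) (U n)"
    and approx: "\<And>n F m. (\<And>i j. (i, j) \<in> node_pairs F \<Longrightarrow> edge_mult F i j \<le> m) \<Longrightarrow>
       \<bar>t_weighted F (H n) - d ^ edge_count F * fin_dens F {..<cells (Suc m)} (w n (Suc m)) (U n (Suc m))\<bar> \<le>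
       d ^ edge_count F * (real (card (node_pairs F)) * (1 / real (Suc m)))"
    by metis
  \<comment> \<open>One family of numbers contains the weights (first index \<open>0\<close>) and the kernels (first index \<open>k + 1\<close>).\<close>
  define X where "X n i = (case i of (l, m, a, c) \<Rightarrow>
      if l = 0 then if a < cells m then w n m a else 0 else U n m (l - 1) a c)"
    for n :: nat and i :: "nat \<times> nat \<times> nat \<times> nat"
  have "\<bar>X n i\<bar> \<le> 1" for n i
  proof -
    obtain l m a c where i: "i = (l, m, a, c)" by (cases i)
    interpret ip: interval_partition "cells m" "w n m" by (rule refining.part[OF ref])
    have "w n m a \<le> 1" "0 \<le> w n m a" if "a < cells m"
      using member_le_sum[of a "{..<cells m}" "w n m"] ip.w_nonneg ip.w_total that by auto
    then show ?thesis
      using moment_seq_bounds[OF d refining.U_moments[OF ref], of n m "l - 1" a c] by (auto simp: X_def i)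
  qed
  then obtain s Y where s: "strict_mono s" and Y: "\<And>i. (\<lambda>n. X (s n) i) \<longlonglongrightarrow> Y i"
    using bounded_family_convergent_subseq[of X] by blast
  define w' where "w' m a = Y (0, m, a, 0)" for m a
  define U' where "U' m k a c = Y (Suc k, m, a, c)" for m k a c
  have w': "(\<lambda>n. w (s n) m a) \<longlonglongrightarrow> w' m a" if "a < cells m" for m a
    using Y[of "(0, m, a, 0)"] that by (simp add: X_def w'_def)
  have U': "(\<lambda>n. U (s n) m k a c) \<longlonglongrightarrow> U' m k a c" for m k a c
    using Y[of "(Suc k, m, a, c)"] by (simp add: X_def U'_def)
  interpret L: refining d parts cells w' U'
    by (rule refining_limit[OF ref w' U'])
  obtain W R where W: "is_graphon d W" and R: "strict_mono R"
    and WR: "\<And>F. (\<lambda>j. d ^ edge_count F * fin_dens F {..<cells (R j)} (w' (R j)) (U' (R j))) \<longlonglongrightarrow> t_graphon F W"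
    using L.limit_graphon by blast
  have "t_graphon F W = f F" for F
  proof -
    define D where "D m = d ^ edge_count F * fin_dens F {..<cells m} (w' m) (U' m)" for m
    define C where "C = d ^ edge_count F * real (card (node_pairs F))"
    define m0 where "m0 = (\<Sum>(i, j)\<in>node_pairs F. edge_mult F i j)"
    have m0: "edge_mult F i j \<le> m0" if "(i, j) \<in> node_pairs F" for i j
      using member_le_sum[OF that, of "\<lambda>(i, j). edge_mult F i j"] by (simp add: m0_def)
    have D: "\<bar>f F - D (Suc m)\<bar> \<le> C * (1 / real (Suc m))" if m: "m0 \<le> m" for m
    proof (rule LIMSEQ_le_const2)
      have "(\<lambda>n. fin_dens F {..<cells (Suc m)} (w (s n) (Suc m)) (U (s n) (Suc m))) \<longlonglongrightarrow>
          fin_dens F {..<cells (Suc m)} (w' (Suc m)) (U' (Suc m))"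
        unfolding fin_dens_def case_prod_beta
        by (intro tendsto_sum tendsto_mult tendsto_prod w' U') (auto simp: PiE_iff)
      then show "(\<lambda>n. \<bar>t_weighted F (H (s n)) - d ^ edge_count F *
          fin_dens F {..<cells (Suc m)} (w (s n) (Suc m)) (U (s n) (Suc m))\<bar>) \<longlonglongrightarrow> \<bar>f F - D (Suc m)\<bar>"
        unfolding D_def using LIMSEQ_subseq_LIMSEQ[OF lim s, of F]
        by (intro tendsto_rabs tendsto_diff tendsto_mult_left) (simp_all add: comp_def)
      show "\<exists>N. \<forall>n\<ge>N. \<bar>t_weighted F (H (s n)) - d ^ edge_count F *
          fin_dens F {..<cells (Suc m)} (w (s n) (Suc m)) (U (s n) (Suc m))\<bar> \<le> C * (1 / real (Suc m))"
        unfolding C_def mult.assoc using m0 m by (intro exI[of _ 0] allI impI approx) (meson order_trans)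
    qed
    have "(\<lambda>j. D (R j) - f F) \<longlonglongrightarrow> 0"
    proof (rule Lim_null_comparison)
      show "\<forall>\<^sub>F j in sequentially. norm (D (R j) - f F) \<le> C * (1 / real j)"
        unfolding eventually_sequentially
      proof (intro exI[of _ "Suc m0"] allI impI)
        fix j assume j: "Suc m0 \<le> j"
        have "j \<le> R j" using R by (rule seq_suble)
        then obtain m where m: "R j = Suc m" "m0 \<le> m" using j by (cases "R j") auto
        have "\<bar>f F - D (R j)\<bar> \<le> C * (1 / real (R j))" using D[OF m(2)] by (simp only: m(1))
        also have "\<dots> \<le> C * (1 / real j)"
          using \<open>j \<le> R j\<close> j d by (intro mult_left_mono divide_left_mono) (auto simp: C_def)
        finally show "norm (D (R j) - f F) \<le> C * (1 / real j)" by (simp add: abs_minus_commute)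
      qed
      show "(\<lambda>j. C * (1 / real j)) \<longlonglongrightarrow> 0"
        using tendsto_mult_left[OF lim_1_over_n[where 'a = real], of C] by simp
    qed
    then have "(\<lambda>j. D (R j)) \<longlonglongrightarrow> f F" by (rule LIM_zero_cancel)
    with WR[of F] show ?thesis unfolding D_def by (rule LIMSEQ_unique)
  qed
  with W show thesis by (rule that)
qed

section \<open>Graphons are limits of weighted graphs\<close>

subsection \<open>Averages over a grid\<close>

text \<open>The division of \<open>[0, 1]\<close> into \<open>N\<close> intervals of equal length, and the corresponding cells of the unit square.\<close>

abbreviation grid :: "nat \<Rightarrow> real \<Rightarrow> nat" where "grid N \<equiv> cellmap N (\<lambda>_. 1 / real N)"

lemma interval_partition_grid: "0 < N \<Longrightarrow> interval_partition N (\<lambda>_. 1 / real N)"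
  by unfold_locales auto

lemma grid_measurable: "0 < N \<Longrightarrow> grid N \<in> I01 \<rightarrow>\<^sub>M count_space UNIV"
  by (rule interval_partition.cellmap_measurable[OF interval_partition_grid])

lemma grid_less: "0 < N \<Longrightarrow> x \<in> {0..1} \<Longrightarrow> grid N x < N"
  by (simp add: interval_partition.cellmap_less[OF interval_partition_grid])

lemma grid_fibre: "0 < N \<Longrightarrow> a < N \<Longrightarrow> measure I01 {x\<in>{0..1}. grid N x = a} = 1 / real N"
  by (rule interval_partition.measure_cellmap_fibre[OF interval_partition_grid])

lemma grid_dist:
  assumes N: "0 < N" and x: "x \<in> {0..1}" and y: "y \<in> {0..1}" and eq: "grid N x = grid N y"
  shows "\<bar>x - y\<bar> \<le> 1 / real N"
proof -
  have "real (grid N x) / N \<le> x \<and> x \<le> real (grid N x) / N + 1 / N" if x: "x \<in> {0..1}" for x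
  proof -
    let ?a = "grid N x"
    have a: "real ?a / N \<le> x" "Suc ?a = N \<or> x < (\<Sum>b<Suc ?a. 1 / real N)"
      using interval_partition.cellmap_iff[OF interval_partition_grid[OF N], of x ?a] x by simp_all
    have "x \<le> real ?a / N + 1 / N"
    proof (cases "Suc ?a = N")
      case True
      then have "real ?a + 1 = real N" by linarith
      then have "real ?a / N + 1 / N = 1" using N by (simp only: add_divide_distrib[symmetric]) simp
      then show ?thesis using x by simp
    next
      case False
      then show ?thesis using a(2) by (simp add: add_divide_distrib)
    qed
    with a(1) show ?thesis by blast
  qed
  from this[OF x] this[OF y] show ?thesis unfolding eq by linarith
qed

definition grid_cell :: "nat \<Rightarrow> nat \<Rightarrow> nat \<Rightarrow> (real \<times> real) set" where
  "grid_cell N a c = {x\<in>{0..1}. grid N x = a} \<times> {x\<in>{0..1}. grid N x = c}"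

text \<open>The average of \<open>f\<close> over a cell; the factor is the inverse of the area \<open>1 / N\<^sup>2\<close> of the cell.\<close>

definition grid_avg :: "nat \<Rightarrow> (real \<times> real \<Rightarrow> real) \<Rightarrow> nat \<Rightarrow> nat \<Rightarrow> real" where
  "grid_avg N f a c = (real N)\<^sup>2 * (\<integral>p. indicator (grid_cell N a c) p * f p \<partial>SQ)"

lemma sets_grid_cell: "0 < N \<Longrightarrow> grid_cell N a c \<in> sets SQ"
proof -
  assume N: "0 < N"
  have "{x\<in>{0..1}. grid N x = a} \<in> sets I01" for a
    using measurable_sets[OF grid_measurable[OF N], of "{a}"] by (simp add: vimage_def Int_def conj_commute)
  then show ?thesis unfolding grid_cell_def by (intro pair_measureI)
qed

lemma measure_grid_cell:
  assumes N: "0 < N" and "a < N" "c < N"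
  shows "measure SQ (grid_cell N a c) = (1 / real N)\<^sup>2"
proof -
  have "(\<integral>p. (\<lambda>i j. if i = a \<and> j = c then 1 else 0) (grid N (fst p)) (grid N (snd p)) \<partial>SQ) =
      (\<Sum>i<N. \<Sum>j<N. 1 / real N * (1 / real N) * (if i = a \<and> j = c then 1 else 0))"
    by (rule integral_SQ_step[OF grid_measurable[OF N] grid_less[OF N] grid_fibre[OF N]])
  also have "\<dots> = (\<Sum>i<N. if i = a then (1 / real N)\<^sup>2 else 0)"
  proof (intro sum.cong refl)
    fix i
    have "(\<Sum>j<N. 1 / real N * (1 / real N) * (if i = a \<and> j = c then 1 else 0)) =
        (\<Sum>j<N. if j = c then (if i = a then (1 / real N)\<^sup>2 else 0) else 0)"
      by (intro sum.cong refl) (auto simp: power2_eq_square)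
    then show "(\<Sum>j<N. 1 / real N * (1 / real N) * (if i = a \<and> j = c then 1 else 0)) =
        (if i = a then (1 / real N)\<^sup>2 else 0)" using assms by simp
  qed
  also have "\<dots> = (1 / real N)\<^sup>2" using assms by simp
  also have "(\<integral>p. (\<lambda>i j. if i = a \<and> j = c then 1 else 0) (grid N (fst p)) (grid N (snd p)) \<partial>SQ) =
      (\<integral>p. indicat_real (grid_cell N a c) p \<partial>SQ)"
    by (intro Bochner_Integration.integral_cong refl) (auto simp: grid_cell_def indicator_def space_SQ)
  also have "\<dots> = measure SQ (grid_cell N a c)"
    using sets.sets_into_space[OF sets_grid_cell[OF N], of a c] by (simp add: Int_absorb2)
  finally show ?thesis .
qed

lemma integrable_SQ_bounded:
  fixes f :: "real \<times> real \<Rightarrow> real"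
  assumes "f \<in> borel_measurable SQ" "\<And>p. p \<in> space SQ \<Longrightarrow> \<bar>f p\<bar> \<le> B"
  shows "integrable SQ f"
  by (rule SQ.integrable_const_bound[of _ B]) (use assms in \<open>auto intro!: AE_I2\<close>)

lemma integrable_grid_cell:
  "0 < N \<Longrightarrow> integrable SQ f \<Longrightarrow> integrable SQ (\<lambda>p. indicat_real (grid_cell N a c) p * f p)"
  using integrable_mult_indicator[OF sets_grid_cell, of N f a c] by simp

lemma grid_avg_diff:
  assumes "0 < N" "integrable SQ f" "integrable SQ g"
  shows "grid_avg N (\<lambda>p. f p - g p) a c = grid_avg N f a c - grid_avg N g a c"
  using assms unfolding grid_avg_def right_diff_distrib
  by (subst Bochner_Integration.integral_diff) (auto intro!: integrable_grid_cell simp: right_diff_distrib)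

lemma grid_avg_bounds:
  assumes N: "0 < N" and ac: "a < N" "c < N" and f: "integrable SQ f"
    and bd: "\<And>p. p \<in> grid_cell N a c \<Longrightarrow> l \<le> f p \<and> f p \<le> u"
  shows "l \<le> grid_avg N f a c \<and> grid_avg N f a c \<le> u"
proof -
  let ?I = "indicat_real (grid_cell N a c)"
  have const: "(\<integral>p. ?I p * e \<partial>SQ) = (1 / real N)\<^sup>2 * e" for e
    using sets.sets_into_space[OF sets_grid_cell[OF N], of a c] measure_grid_cell[OF N ac]
    by (simp add: Int_absorb2)
  have int: "integrable SQ (\<lambda>p. ?I p * e)" for e :: real by (rule integrable_grid_cell[OF N]) simp
  have "(\<integral>p. ?I p * l \<partial>SQ) \<le> (\<integral>p. ?I p * f p \<partial>SQ)" "(\<integral>p. ?I p * f p \<partial>SQ) \<le> (\<integral>p. ?I p * u \<partial>SQ)"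
    using bd by (intro integral_mono int integrable_grid_cell[OF N f]; auto simp: indicator_def)+
  then have "(real N)\<^sup>2 * ((1 / real N)\<^sup>2 * l) \<le> grid_avg N f a c \<and>
      grid_avg N f a c \<le> (real N)\<^sup>2 * ((1 / real N)\<^sup>2 * u)"
    unfolding grid_avg_def const by (intro conjI mult_left_mono) auto
  then show ?thesis using N by (simp add: power_divide)
qed

lemma grid_step_measurable:
  "0 < N \<Longrightarrow> (\<lambda>p. G (grid N (fst p)) (grid N (snd p)) :: real) \<in> borel_measurable SQ"
  by (rule borel_measurable_SQ_step[OF grid_measurable])

lemma grid_avg_contraction:
  assumes N: "0 < N" and f: "integrable SQ f"
  shows "(\<integral>p. \<bar>grid_avg N f (grid N (fst p)) (grid N (snd p))\<bar> \<partial>SQ) \<le> (\<integral>p. \<bar>f p\<bar> \<partial>SQ)"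
proof -
  let ?I = "\<lambda>a c. indicat_real (grid_cell N a c)"
  have "(\<integral>p. \<bar>grid_avg N f (grid N (fst p)) (grid N (snd p))\<bar> \<partial>SQ) =
      (\<Sum>a<N. \<Sum>c<N. 1 / real N * (1 / real N) * \<bar>grid_avg N f a c\<bar>)"
    by (rule integral_SQ_step[OF grid_measurable[OF N] grid_less[OF N] grid_fibre[OF N], of "\<lambda>a c. \<bar>grid_avg N f a c\<bar>"])
  also have "\<dots> = (\<Sum>a<N. \<Sum>c<N. \<bar>\<integral>p. ?I a c p * f p \<partial>SQ\<bar>)"
    using N by (intro sum.cong refl) (simp add: grid_avg_def abs_mult power2_eq_square)
  also have "\<dots> \<le> (\<Sum>a<N. \<Sum>c<N. \<integral>p. ?I a c p * \<bar>f p\<bar> \<partial>SQ)"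
    by (intro sum_mono order_trans[OF integral_abs_bound] order_eq_refl Bochner_Integration.integral_cong refl)
       (simp add: abs_mult)
  also have "\<dots> = (\<integral>p. (\<Sum>a<N. \<Sum>c<N. ?I a c p * \<bar>f p\<bar>) \<partial>SQ)"
    by (simp only: Bochner_Integration.integral_sum Bochner_Integration.integrable_sum
        integrable_grid_cell[OF N integrable_abs[OF f]])
  also have "\<dots> = (\<integral>p. \<bar>f p\<bar> \<partial>SQ)"
  proof (intro Bochner_Integration.integral_cong refl)
    fix p assume "p \<in> space SQ"
    then have p: "fst p \<in> {0..1}" "snd p \<in> {0..1}" unfolding space_SQ by auto
    have "(\<Sum>a<N. \<Sum>c<N. ?I a c p * \<bar>f p\<bar>) =
        (\<Sum>a<N. if a = grid N (fst p) then (\<Sum>c<N. if c = grid N (snd p) then \<bar>f p\<bar> else 0) else 0)"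
      using p by (intro sum.cong refl) (auto simp: grid_cell_def indicator_def mem_Times_iff intro!: sum.cong)
    then show "(\<Sum>a<N. \<Sum>c<N. ?I a c p * \<bar>f p\<bar>) = \<bar>f p\<bar>"
      using grid_less[OF N p(1)] grid_less[OF N p(2)] by simp
  qed
  finally show ?thesis .
qed

lemma continuous_L1_approx:
  fixes f :: "real \<times> real \<Rightarrow> real"
  assumes f: "f \<in> borel_measurable borel" "\<And>p. \<bar>f p\<bar> \<le> 1" and \<delta>: "0 < \<delta>"
  obtains h where "continuous_on UNIV h" "\<And>p. \<bar>h p\<bar> \<le> 1" "(\<integral>p. \<bar>f p - h p\<bar> \<partial>SQ) < \<delta>"
proof -
  have "f \<in> borel_measurable (lebesgue_on UNIV)" 
    unfolding lebesgue_on_UNIV_eq by (rule measurable_completion) (simp add: f(1))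
  then have "f measurable_on UNIV" by (subst measurable_on_iff_borel_measurable) simp_all
  then obtain N g where N: "negligible N" and g: "\<And>n. continuous_on UNIV (g n)"
    and lim: "\<And>p. p \<notin> N \<Longrightarrow> (\<lambda>n. g n p) \<longlonglongrightarrow> f p"
    unfolding measurable_on_def by auto
  define h where "h n p = max (-1) (min 1 (g n p))" for n p
  have hc: "continuous_on UNIV (h n)" for n unfolding h_def[abs_def] by (intro continuous_intros g)
  have hb: "\<bar>h n p\<bar> \<le> 1" for n p by (auto simp: h_def)
  have hm: "h n \<in> borel_measurable SQ" for n
    by (rule borel_measurable_SQ) (rule borel_measurable_continuous_onI[OF hc])
  have "N \<in> null_sets lebesgue" using N by (simp add: negligible_iff_null_sets)
  then have "AE p in lebesgue. p \<notin> N" by (rule AE_not_in)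
  then have "AE p in lborel. p \<notin> N" by (simp add: AE_completion_iff)
  then have "AE p in lborel. p \<in> {0..1} \<times> {0..1} \<longrightarrow> p \<notin> N" by eventually_elim simp
  then have "AE p in SQ. p \<notin> N" by (rule AE_lborel_imp_AE_SQ)
  then have "AE p in SQ. (\<lambda>n. \<bar>f p - h n p\<bar>) \<longlonglongrightarrow> 0"
  proof eventually_elim
    case (elim p)
    have "(\<lambda>n. h n p) \<longlonglongrightarrow> max (-1) (min 1 (f p))"
      unfolding h_def by (intro tendsto_intros lim elim)
    also have "max (-1) (min 1 (f p)) = f p" using f(2)[of p] by auto
    finally have "(\<lambda>n. \<bar>f p - h n p\<bar>) \<longlonglongrightarrow> \<bar>f p - f p\<bar>" by (intro tendsto_intros)
    then show ?case by simp
  qed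
  then have "(\<lambda>n. \<integral>p. \<bar>f p - h n p\<bar> \<partial>SQ) \<longlonglongrightarrow> (\<integral>p. 0 \<partial>SQ)"
  proof (rule integral_dominated_convergence[where w = "\<lambda>_. 2", rotated 3])
    show "AE p in SQ. norm \<bar>f p - h n p\<bar> \<le> 2" for n
    proof (rule AE_I2)
      fix p show "norm \<bar>f p - h n p\<bar> \<le> 2" using f(2)[of p] hb[of n p] by simp
    qed
  qed (auto intro!: borel_measurable_abs borel_measurable_diff borel_measurable_SQ f(1)
      borel_measurable_continuous_onI[OF hc])
  then have "\<forall>\<^sub>F n in sequentially. (\<integral>p. \<bar>f p - h n p\<bar> \<partial>SQ) < \<delta>"
    using \<delta> by (auto dest: order_tendstoD(2))
  then obtain n where "(\<integral>p. \<bar>f p - h n p\<bar> \<partial>SQ) < \<delta>" by (auto simp: eventually_sequentially)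
  then show thesis using hc hb that by blast
qed

text \<open>
  Averages over fine grids converge in \<open>L\<^sup>1\<close>: this holds for continuous functions, which are dense, and averaging is
  a contraction.
\<close>

theorem grid_avg_L1:
  fixes f :: "real \<times> real \<Rightarrow> real"
  assumes f: "f \<in> borel_measurable borel" "\<And>p. \<bar>f p\<bar> \<le> 1" and \<delta>: "0 < \<delta>"
  obtains N0 where "0 < N0"
    "\<And>N. N0 \<le> N \<Longrightarrow> (\<integral>p. \<bar>f p - grid_avg N f (grid N (fst p)) (grid N (snd p))\<bar> \<partial>SQ) \<le> \<delta>"
proof -
  have "0 < \<delta> / 3" using \<delta> by simp
  from continuous_L1_approx[OF f this] obtain h where h: "continuous_on UNIV h" "\<And>p. \<bar>h p\<bar> \<le> 1"
    "(\<integral>p. \<bar>f p - h p\<bar> \<partial>SQ) < \<delta> / 3" by blast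
  have int: "integrable SQ f" "integrable SQ h"
    using f h by (auto intro!: integrable_SQ_bounded[of _ 1] borel_measurable_SQ borel_measurable_continuous_onI)
  have "compact ({0..1::real} \<times> {0..1::real})" by (intro compact_Times) auto
  then have "uniformly_continuous_on ({0..1} \<times> {0..1}) h"
    using continuous_on_subset[OF h(1)] by (intro compact_uniformly_continuous) auto
  then obtain \<eta> where \<eta>: "0 < \<eta>" "\<And>p p'. p \<in> {0..1} \<times> {0..1} \<Longrightarrow> p' \<in> {0..1} \<times> {0..1} \<Longrightarrow>
      dist p' p < \<eta> \<Longrightarrow> dist (h p') (h p) < \<delta> / 3"
    unfolding uniformly_continuous_on_def using \<open>0 < \<delta> / 3\<close> by metis
  obtain N0 :: nat where N0: "2 / \<eta> < real N0" using reals_Archimedean2 by blast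
  have "0 < N0" using N0 \<eta>(1) by (metis divide_pos_pos less_trans of_nat_0_less_iff zero_less_numeral)
  moreover have "(\<integral>p. \<bar>f p - grid_avg N f (grid N (fst p)) (grid N (snd p))\<bar> \<partial>SQ) \<le> \<delta>" if "N0 \<le> N" for N
  proof -
    have N: "0 < N" using \<open>0 < N0\<close> that by simp
    have "2 / \<eta> < real N" using N0 that by linarith
    then have N\<eta>: "2 / real N < \<eta>" using \<eta>(1) N by (simp add: field_simps)
    let ?A = "\<lambda>f p. grid_avg N f (grid N (fst p)) (grid N (snd p))"
    have osc: "\<bar>h p - ?A h p\<bar> \<le> \<delta> / 3" if p: "p \<in> space SQ" for p
    proof -
      have p': "fst p \<in> {0..1}" "snd p \<in> {0..1}" using p unfolding space_SQ by auto
      have "h p - \<delta> / 3 \<le> h p' \<and> h p' \<le> h p + \<delta> / 3" if p'': "p' \<in> grid_cell N (grid N (fst p)) (grid N (snd p))" for p'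
      proof -
        have p'': "fst p' \<in> {0..1}" "snd p' \<in> {0..1}" "grid N (fst p') = grid N (fst p)" "grid N (snd p') = grid N (snd p)"
          using p'' unfolding grid_cell_def by auto
        have "dist p' p \<le> dist (fst p') (fst p) + dist (snd p') (snd p)"
          using sqrt_sum_squares_le_sum[of "dist (fst p') (fst p)" "dist (snd p') (snd p)"]
          by (simp add: dist_prod_def)
        also have "\<dots> \<le> 1 / real N + 1 / real N"
          unfolding dist_real_def using p' p'' by (intro add_mono grid_dist[OF N])
        also have "\<dots> < \<eta>" using N\<eta> by simp
        finally have "dist (h p') (h p) < \<delta> / 3"
          using p' p'' by (intro \<eta>(2)) (auto simp: mem_Times_iff)
        then show ?thesis unfolding dist_real_def by linarith
      qed
      then have "h p - \<delta> / 3 \<le> ?A h p \<and> ?A h p \<le> h p + \<delta> / 3"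
        using p' by (intro grid_avg_bounds[OF N grid_less[OF N] grid_less[OF N] int(2)])
      then show ?thesis by linarith
    qed
    have m: "?A f' \<in> borel_measurable SQ" for f' by (rule grid_step_measurable[OF N])
    have Ab: "\<bar>?A f' p\<bar> \<le> 2" if f': "integrable SQ f'" "\<And>p. \<bar>f' p\<bar> \<le> 2" and p: "p \<in> space SQ" for f' p
    proof -
      have p': "fst p \<in> {0..1}" "snd p \<in> {0..1}" using p unfolding space_SQ by auto
      have "-2 \<le> ?A f' p \<and> ?A f' p \<le> 2"
        using p' f'(2) by (intro grid_avg_bounds[OF N grid_less[OF N] grid_less[OF N] f'(1)])
          (auto simp: abs_le_iff minus_le_iff)
      then show ?thesis by linarith
    qed
    let ?g = "\<lambda>p. h p - f p"
    have gb: "\<bar>?g p\<bar> \<le> 2" for p using f(2)[of p] h(2)[of p] by linarith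
    have gi: "integrable SQ ?g" using int by auto
    have Ai: "integrable SQ (?A ?g)" "integrable SQ (?A h)" "integrable SQ (?A f)"
      using Ab[OF gi gb] Ab[OF int(2) order_trans[OF h(2)]] Ab[OF int(1) order_trans[OF f(2)]]
      by (auto intro!: integrable_SQ_bounded[of _ 2] m)
    have "(\<integral>p. \<bar>f p - ?A f p\<bar> \<partial>SQ) \<le> (\<integral>p. \<bar>f p - h p\<bar> + \<delta> / 3 + \<bar>?A ?g p\<bar> \<partial>SQ)"
    proof (rule integral_mono)
      fix p assume p: "p \<in> space SQ"
      have "?A ?g p = ?A h p - ?A f p" by (rule grid_avg_diff[OF N int(2,1)])
      then show "\<bar>f p - ?A f p\<bar> \<le> \<bar>f p - h p\<bar> + \<delta> / 3 + \<bar>?A ?g p\<bar>" using osc[OF p] by linarith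
    qed (use int Ai in auto)
    also have "\<dots> = (\<integral>p. \<bar>f p - h p\<bar> \<partial>SQ) + \<delta> / 3 + (\<integral>p. \<bar>?A ?g p\<bar> \<partial>SQ)"
      using int Ai SQ.prob_space by (subst Bochner_Integration.integral_add; simp)+
    also have "(\<integral>p. \<bar>?A ?g p\<bar> \<partial>SQ) \<le> (\<integral>p. \<bar>f p - h p\<bar> \<partial>SQ)"
      using grid_avg_contraction[OF N gi] by (simp add: abs_minus_commute)
    finally show ?thesis using h(3) by linarith
  qed
  ultimately show thesis by (rule that)
qed

subsection \<open>Approximation by finitely supported measures on a grid\<close>

text \<open>
  A probability distribution \<open>m\<close> on \<open>{..R}\<close> is approximated by the distribution of \<open>g z\<close> for a uniformly random \<open>z < Q\<close>.
  All weights but one are rounded down to multiples of \<open>1 / Q\<close>; the atom \<open>0\<close> absorbs the rest.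
\<close>

lemma rational_rounding:
  fixes m :: "nat \<Rightarrow> real"
  assumes m: "\<And>r. r \<le> R \<Longrightarrow> 0 \<le> m r" "(\<Sum>r\<le>R. m r) = 1" and Q: "0 < Q"
  obtains g where "\<And>z. g z \<le> R"
    "\<And>v. (\<And>r. r \<le> R \<Longrightarrow> \<bar>v r\<bar> \<le> 1) \<Longrightarrow> \<bar>(\<Sum>z<Q. v (g z)) / real Q - (\<Sum>r\<le>R. m r * v r)\<bar> \<le> 2 * real R / real Q"
proof -
  define c0 where "c0 r = nat \<lfloor>real Q * m r\<rfloor>" for r
  have c0: "real (c0 r) \<le> real Q * m r" "real Q * m r < real (c0 r) + 1" if "r \<le> R" for r
    using m(1)[OF that] unfolding c0_def by (simp_all add: of_nat_nat)
  have split: "(\<Sum>r\<le>R. f r) = f 0 + (\<Sum>r=1..R. f r)" for f :: "nat \<Rightarrow> real"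
    by (simp add: atMost_atLeast0 sum.atLeast_Suc_atMost)
  have "real (\<Sum>r=1..R. c0 r) \<le> (\<Sum>r=1..R. real Q * m r)"
    unfolding of_nat_sum by (intro sum_mono c0) auto
  also have "\<dots> \<le> (\<Sum>r\<le>R. real Q * m r)" unfolding split using m(1) by simp
  also have "\<dots> = real Q" using m(2) by (simp add: sum_distrib_left[symmetric])
  finally have le: "(\<Sum>r=1..R. c0 r) \<le> Q" by (simp only: of_nat_le_iff)
  define c where "c r = (if r = 0 then Q - (\<Sum>r=1..R. c0 r) else c0 r)" for r
  have total: "(\<Sum>r\<le>R. real (c r)) = real Q"
    unfolding split using le by (simp add: c_def of_nat_diff)
  define xs where "xs = concat (map (\<lambda>r. replicate (c r) r) [0..<Suc R])"
  have sum_xs: "sum_list (map v xs) = (\<Sum>r\<le>R. real (c r) * v r)" for v :: "nat \<Rightarrow> real"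
  proof -
    have "sum_list (map v (concat (map (\<lambda>r. replicate (c r) r) ys))) = sum_list (map (\<lambda>r. real (c r) * v r) ys)" for ys
      by (induction ys) (auto simp: sum_list_replicate)
    then have "sum_list (map v xs) = sum_list (map (\<lambda>r. real (c r) * v r) [0..<Suc R])"
      by (simp only: xs_def)
    also have "\<dots> = (\<Sum>r\<le>R. real (c r) * v r)"
      unfolding interv_sum_list_conv_sum_set_nat
      by (simp only: set_upt atMost_atLeast0 atLeastLessThanSuc_atLeastAtMost)
    finally show ?thesis .
  qed
  have "sum_list (map (\<lambda>_. 1 :: real) xs) = real (length xs)" by (induction xs) auto
  then have len: "length xs = Q" using sum_xs[of "\<lambda>_. 1"] total by simp
  define g where "g z = (if z < Q then xs ! z else 0)" for z
  have xs_le: "x \<le> R" if "x \<in> set xs" for x using that by (auto simp: xs_def)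
  have g: "g z \<le> R" for z
    using xs_le[OF nth_mem[of z xs]] by (simp add: g_def len)
  have bound: "\<bar>(\<Sum>z<Q. v (g z)) / real Q - (\<Sum>r\<le>R. m r * v r)\<bar> \<le> 2 * real R / real Q"
    if v: "\<And>r. r \<le> R \<Longrightarrow> \<bar>v r\<bar> \<le> 1" for v
  proof -
    have "(\<Sum>z<Q. v (g z)) = (\<Sum>r\<le>R. real (c r) * v r)"
      unfolding sum_xs[symmetric] by (simp add: sum_list_sum_nth len g_def lessThan_atLeast0)
    then have "(\<Sum>z<Q. v (g z)) - real Q * (\<Sum>r\<le>R. m r * v r) = (\<Sum>r\<le>R. (real (c r) - real Q * m r) * v r)"
      by (simp add: sum_distrib_left sum_subtractf left_diff_distrib mult.assoc)
    also have "\<bar>\<dots>\<bar> \<le> (\<Sum>r\<le>R. \<bar>real (c r) - real Q * m r\<bar> * 1)"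
      by (intro order_trans[OF sum_abs] sum_mono, unfold abs_mult)
        (rule mult_left_mono, use v in auto)
    also have "\<dots> = \<bar>real (c 0) - real Q * m 0\<bar> + (\<Sum>r=1..R. \<bar>real (c0 r) - real Q * m r\<bar>)"
      unfolding split by (simp add: c_def)
    also have "real (c 0) - real Q * m 0 = - (\<Sum>r=1..R. real (c0 r) - real Q * m r)"
    proof -
      have "real (c 0) + (\<Sum>r=1..R. real (c0 r)) = real Q * (m 0 + (\<Sum>r=1..R. m r))"
        using total m(2) unfolding split by (simp add: c_def)
      then show ?thesis by (simp add: sum_subtractf sum_distrib_left distrib_left)
    qed
    also have "\<bar>- (\<Sum>r=1..R. real (c0 r) - real Q * m r)\<bar> \<le> (\<Sum>r=1..R. \<bar>real (c0 r) - real Q * m r\<bar>)"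
      by simp
    also have "(\<Sum>r=1..R. \<bar>real (c0 r) - real Q * m r\<bar>) \<le> (\<Sum>r=1..R. 1)"
    proof (rule sum_mono)
      fix r assume "r \<in> {1..R}"
      then have "r \<le> R" by simp
      from c0[OF this] show "\<bar>real (c0 r) - real Q * m r\<bar> \<le> 1" by linarith
    qed
    finally have "\<bar>(\<Sum>z<Q. v (g z)) - real Q * (\<Sum>r\<le>R. m r * v r)\<bar> \<le> 2 * real R" by simp
    then have "\<bar>(\<Sum>z<Q. v (g z)) - real Q * (\<Sum>r\<le>R. m r * v r)\<bar> / real Q \<le> 2 * real R / real Q"
      by (rule divide_right_mono) simp
    moreover have "(\<Sum>z<Q. v (g z)) / real Q - (\<Sum>r\<le>R. m r * v r) =
        ((\<Sum>z<Q. v (g z)) - real Q * (\<Sum>r\<le>R. m r * v r)) / real Q"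
      using Q by (simp add: diff_divide_distrib)
    ultimately show ?thesis by (simp add: abs_divide)
  qed
  show thesis by (rule that[of g]) (use g bound in auto)
qed

text \<open>
  The Bernstein basis functions are non-negative with sum \<open>1\<close>. For a measure \<open>\<mu>\<close> on \<open>[-d, d]\<close>, their integrals are the
  masses of a measure on the \<open>R + 1\<close> atoms \<open>d * (2 * r / R - 1)\<close> whose normalised moments up to \<open>K\<close> differ from those of \<open>\<mu>\<close> by at most \<open>\<delta>\<close>.
\<close>

lemma bernstein_atoms:
  assumes d: "0 < d" and \<delta>: "0 < \<delta>"
  obtains R where "0 < R" "\<And>k s. k \<le> K \<Longrightarrow> s \<in> {-d..d} \<Longrightarrow>
    \<bar>(s / d) ^ k - (\<Sum>r\<le>R. (2 * (real r / real R) - 1) ^ k * Bernstein R r ((s / d + 1) / 2))\<bar> \<le> \<delta>"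
proof -
  define P where "P k N \<longleftrightarrow> (\<forall>n x. N \<le> n \<and> x \<in> {0..1} \<longrightarrow>
      \<bar>(2 * x - 1) ^ k - (\<Sum>r\<le>n. (2 * (real r / real n) - 1) ^ k * Bernstein n r x)\<bar> < \<delta>)" for k N
  have "\<exists>N. P k N" for k
    unfolding P_def by (rule Bernstein_Weierstrass[OF _ \<delta>]) (intro continuous_intros)
  then obtain N where "\<And>k. P k (N k)" by metis
  then have N: "\<bar>(2 * x - 1) ^ k - (\<Sum>r\<le>n. (2 * (real r / real n) - 1) ^ k * Bernstein n r x)\<bar> < \<delta>"
    if "N k \<le> n" "x \<in> {0..1}" for k n x
    using that unfolding P_def by blast
  define R where "R = Suc (\<Sum>k\<le>K. N k)"
  show thesis
  proof (rule that[of R])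
    fix k s assume k: "k \<le> K" and s: "s \<in> {-d..d}"
    have "N k \<le> (\<Sum>k\<le>K. N k)" using k by (intro member_le_sum) auto
    then have "N k \<le> R" by (simp add: R_def)
    moreover have "(s / d + 1) / 2 \<in> {0..1}" using s d by (auto simp: field_simps)
    ultimately have lt: "\<bar>(2 * ((s / d + 1) / 2) - 1) ^ k - (\<Sum>r\<le>R. (2 * (real r / real R) - 1) ^ k *
        Bernstein R r ((s / d + 1) / 2))\<bar> < \<delta>" by (rule N)
    have "2 * ((t + 1) / 2) - 1 = t" for t :: real by (simp add: field_simps)
    with lt show "\<bar>(s / d) ^ k - (\<Sum>r\<le>R. (2 * (real r / real R) - 1) ^ k *
        Bernstein R r ((s / d + 1) / 2))\<bar> \<le> \<delta>" by (simp only: less_imp_le)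
  qed (simp add: R_def)
qed

lemma AE_SQ_swap: "AE p in SQ. P p \<Longrightarrow> AE p in SQ. P (snd p, fst p)"
proof -
  assume "AE p in SQ. P p"
  then have "AE p in distr SQ SQ (\<lambda>(x, y). (y, x)). P p"
    by (subst (asm) SQ.distr_pair_swap)
  then have "AE p in SQ. P ((\<lambda>(x, y). (y, x)) p)"
    by (rule AE_distrD[rotated]) (rule measurable_pair_swap')
  then show ?thesis by (simp add: case_prod_beta)
qed

lemma integral_SQ_swap:
  fixes f :: "real \<times> real \<Rightarrow> real"
  assumes "f \<in> borel_measurable SQ"
  shows "(\<integral>p. f (snd p, fst p) \<partial>SQ) = (\<integral>p. f p \<partial>SQ)"
proof -
  have "(\<integral>p. f p \<partial>SQ) = (\<integral>p. f p \<partial>distr SQ SQ (\<lambda>(x, y). (y, x)))"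
    by (subst SQ.distr_pair_swap) (rule refl)
  also have "\<dots> = (\<integral>p. f ((\<lambda>(x, y). (y, x)) p) \<partial>SQ)"
    by (rule integral_distr) (use assms measurable_pair_swap' in auto)
  finally show ?thesis by (simp add: case_prod_beta)
qed

lemma is_graphonD:
  assumes "is_graphon d W"
  shows "\<And>x y. x \<in> {0..1} \<Longrightarrow> y \<in> {0..1} \<Longrightarrow> W x y = W y x"
    and "\<And>x y. x \<in> {0..1} \<Longrightarrow> y \<in> {0..1} \<Longrightarrow> W x y \<in> prob_measures d"
    and "\<And>f. continuous_on {-d..d} (f :: real \<Rightarrow> real) \<Longrightarrow>
      (\<lambda>p. \<integral>s. f s \<partial>W (fst p) (snd p)) \<in> borel_measurable (lebesgue_on ({0..1} \<times> {0..1}))"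
proof -
  have W: "(\<lambda>(x, y). W x y) \<in> lebesgue_on ({0..1} \<times> {0..1}) \<rightarrow>\<^sub>M borel_prob_measures d"
    using assms by (simp add: is_graphon_def)
  show "W x y = W y x" if "x \<in> {0..1}" "y \<in> {0..1}" for x y using assms that by (simp add: is_graphon_def)
  show "W x y \<in> prob_measures d" if "x \<in> {0..1}" "y \<in> {0..1}" for x y
    using measurable_space[OF W, of "(x, y)"] that by (simp add: space_restrict_space)
  show "(\<lambda>p. \<integral>s. f s \<partial>W (fst p) (snd p)) \<in> borel_measurable (lebesgue_on ({0..1} \<times> {0..1}))"
    if "continuous_on {-d..d} (f :: real \<Rightarrow> real)" for f
    using measurable_compose[OF W measurable_integral_borel_prob_measures[OF that]] by (simp add: case_prod_beta)
qed

text \<open>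
  A symmetric Borel version, with values in \<open>[l, u]\<close>, of the integrals of \<open>f\<close> with respect to the values
  of the graphon \<open>W\<close>.
\<close>

definition integral_version ::
    "(real \<Rightarrow> real \<Rightarrow> real measure) \<Rightarrow> (real \<Rightarrow> real) \<Rightarrow> real \<Rightarrow> real \<Rightarrow> (real \<times> real \<Rightarrow> real) \<Rightarrow> bool" where
  "integral_version W f l u g \<longleftrightarrow> g \<in> borel_measurable borel \<and> (\<forall>p. l \<le> g p \<and> g p \<le> u) \<and>
     (\<forall>x y. g (x, y) = g (y, x)) \<and> (AE p in SQ. (\<integral>s. f s \<partial>W (fst p) (snd p)) = g p)"

lemma integral_version_exists:
  assumes W: "is_graphon d W" and f: "continuous_on {-d..d} (f :: real \<Rightarrow> real)"
    and bd: "\<And>s. s \<in> {-d..d} \<Longrightarrow> l \<le> f s \<and> f s \<le> u" and lu: "l \<le> u"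
  shows "\<exists>g. integral_version W f l u g"
proof -
  let ?f = "\<lambda>p. \<integral>s. f s \<partial>W (fst p) (snd p)"
  have "l \<le> ?f p \<and> ?f p \<le> u" if "p \<in> {0..1} \<times> {0..1}" for p
    using that by (intro integral_prob_measures_bounds[OF _ f bd] is_graphonD(2)[OF W]) auto
  from borel_version_on_square[OF is_graphonD(3)[OF W f] this lu]
  obtain g where g: "g \<in> borel_measurable borel" "\<And>p. l \<le> g p \<and> g p \<le> u" "AE p in SQ. ?f p = g p"
    by blast
  define g' where "g' p = (g p + g (snd p, fst p)) / 2" for p
  show ?thesis
    unfolding integral_version_def
  proof (intro exI[of _ g'] conjI allI)
    have "(\<lambda>p :: real \<times> real. (snd p, fst p)) \<in> borel_measurable borel"
      by (intro borel_measurable_continuous_onI continuous_intros)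
    from measurable_compose[OF this g(1)] show "g' \<in> borel_measurable borel"
      unfolding g'_def[abs_def] by (intro borel_measurable_divide borel_measurable_add g(1) borel_measurable_const) auto
    show "l \<le> g' p" "g' p \<le> u" for p using g(2)[of p] g(2)[of "(snd p, fst p)"] by (simp_all add: g'_def)
    show "g' (x, y) = g' (y, x)" for x y by (simp add: g'_def add.commute)
    have "AE p in SQ. p \<in> space SQ" by (rule AE_space)
    with g(3) AE_SQ_swap[OF g(3)] show "AE p in SQ. ?f p = g' p"
    proof eventually_elim
      case (elim p)
      then have "W (snd p) (fst p) = W (fst p) (snd p)"
        unfolding space_SQ by (intro is_graphonD(1)[OF W]) auto
      then show ?case using elim by (simp add: g'_def)
    qed
  qed
qed

lemma grid_avg_swap:
  assumes N: "0 < N" and f: "f \<in> borel_measurable SQ" "\<And>x y. f (x, y) = f (y, x)"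
  shows "grid_avg N f a c = grid_avg N f c a"
proof -
  let ?g = "\<lambda>p. indicat_real (grid_cell N c a) p * f p"
  have "?g \<in> borel_measurable SQ"
    by (intro borel_measurable_times borel_measurable_indicator sets_grid_cell[OF N] f(1))
  then have "(\<integral>p. ?g (snd p, fst p) \<partial>SQ) = (\<integral>p. ?g p \<partial>SQ)" by (rule integral_SQ_swap)
  moreover have "?g (snd p, fst p) = indicat_real (grid_cell N a c) p * f p" for p
    using f(2)[of "fst p" "snd p"] by (auto simp: grid_cell_def indicator_def mem_Times_iff)
  ultimately show ?thesis by (simp add: grid_avg_def)
qed

text \<open>
  The approximating step graphon has the uniform distribution on the list of the \<open>Q\<close> values \<open>d * g a c z\<close> on the cell \<open>(a, c)\<close>
  of the grid. The error \<open>\<delta>\<close> of the normalised moments consists of \<open>\<delta> / 4\<close> for the Bernstein approximation, \<open>\<delta> / 4\<close> for rounding, and \<open>\<delta> / 4\<close>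
  for averaging over the grid.
\<close>

theorem graphon_grid_approx:
  assumes W: "is_graphon d W" and d: "0 < d" and \<delta>: "0 < \<delta>"
  obtains N Q and g :: "nat \<Rightarrow> nat \<Rightarrow> nat \<Rightarrow> real"
  where "0 < N" "0 < Q" "\<And>a c z. \<bar>g a c z\<bar> \<le> 1" "\<And>a c z. g a c z = g c a z"
    "\<And>F. (\<And>i j. (i, j) \<in> node_pairs F \<Longrightarrow> edge_mult F i j \<le> K) \<Longrightarrow>
      \<bar>t_graphon F W - d ^ edge_count F *
         fin_dens F {..<N} (\<lambda>_. 1 / real N) (\<lambda>k a c. (\<Sum>z<Q. g a c z ^ k) / real Q)\<bar> \<le>
      d ^ edge_count F * (real (card (node_pairs F)) * \<delta>)"
proof -
  have \<delta>4: "0 < \<delta> / 4" using \<delta> by simp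
  obtain R where R: "0 < R" "\<And>k s. k \<le> K \<Longrightarrow> s \<in> {-d..d} \<Longrightarrow>
    \<bar>(s / d) ^ k - (\<Sum>r\<le>R. (2 * (real r / real R) - 1) ^ k * Bernstein R r ((s / d + 1) / 2))\<bar> \<le> \<delta> / 4"
    using bernstein_atoms[OF d \<delta>4, of K] by blast
  define \<sigma> where "\<sigma> r = 2 * (real r / real R) - 1" for r
  define B where "B r s = Bernstein R r ((s / d + 1) / 2)" for r s
  have \<sigma>: "\<bar>\<sigma> r ^ k\<bar> \<le> 1" if "r \<le> R" for r k
  proof -
    have "\<bar>\<sigma> r\<bar> \<le> 1" using that R(1) by (simp add: \<sigma>_def abs_le_iff field_simps)
    then show ?thesis unfolding power_abs by (intro power_le_one) auto
  qed
  have Bc: "continuous_on A (B r)" for A r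
    unfolding B_def[abs_def] Bernstein_def by (intro continuous_intros) (use d in auto)
  have B0: "0 \<le> B r s" if "s \<in> {-d..d}" for r s
    using that d unfolding B_def by (intro Bernstein_nonneg) (auto simp: field_simps)
  have B_sum: "(\<Sum>r\<le>R. B r s) = 1" for s unfolding B_def by (rule sum_Bernstein)
  have B1: "0 \<le> B r s \<and> B r s \<le> 1" if "s \<in> {-d..d}" "r \<le> R" for r s
    using B0[OF that(1)] B_sum[of s] member_le_sum[of r "{..R}" "\<lambda>r. B r s"] that by auto
  have "\<exists>g. integral_version W (B r) 0 1 g" if "r \<le> R" for r
    by (rule integral_version_exists[OF W Bc]) (use B1 that in auto)
  then have "\<exists>g. r \<le> R \<longrightarrow> integral_version W (B r) 0 1 g" for r by blast
  then obtain m where m_ver: "\<And>r. r \<le> R \<Longrightarrow> integral_version W (B r) 0 1 (m r)" by metis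
  have m: "m r \<in> borel_measurable borel" "0 \<le> m r p \<and> m r p \<le> 1" "m r (x, y) = m r (y, x)"
    "AE p in SQ. (\<integral>s. B r s \<partial>W (fst p) (snd p)) = m r p" if "r \<le> R" for r p x y
    using m_ver[OF that] unfolding integral_version_def by blast+
  have sd: "- 1 \<le> (s / d) ^ k \<and> (s / d) ^ k \<le> 1" if "s \<in> {-d..d}" for s k
  proof -
    have "\<bar>s / d\<bar> \<le> 1" using that d by (auto simp: abs_le_iff field_simps)
    then have "\<bar>(s / d) ^ k\<bar> \<le> 1" unfolding power_abs by (intro power_le_one) auto
    then show ?thesis by linarith
  qed
  have sdc: "continuous_on A (\<lambda>s. (s / d) ^ k)" for A k using d by (intro continuous_intros) auto
  have "\<exists>g. integral_version W (\<lambda>s. (s / d) ^ k) (- 1) 1 g" for k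
    by (rule integral_version_exists[OF W sdc sd]) auto
  then obtain b where b_ver: "\<And>k. integral_version W (\<lambda>s. (s / d) ^ k) (- 1) 1 (b k)" by metis
  have b: "b k \<in> borel_measurable borel" "- 1 \<le> b k p \<and> b k p \<le> 1"
    "AE p in SQ. (\<integral>s. (s / d) ^ k \<partial>W (fst p) (snd p)) = b k p" for k p
    using b_ver[of k] unfolding integral_version_def by blast+
  have m_all: "AE p in SQ. \<forall>r\<in>{..R}. (\<integral>s. B r s \<partial>W (fst p) (snd p)) = m r p"
    by (rule AE_finite_allI) (auto intro: m(4))
  have lin: "(\<Sum>r\<le>R. v r * (\<integral>s. B r s \<partial>\<mu>)) = (\<integral>s. (\<Sum>r\<le>R. v r * B r s) \<partial>\<mu>)"
    if "\<mu> \<in> prob_measures d" for \<mu> and v :: "nat \<Rightarrow> real"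
    using integrable_prob_measures[OF that Bc] by (simp add: Bochner_Integration.integral_sum)
  have m_sum: "AE p in SQ. (\<Sum>r\<le>R. m r p) = 1"
    using m_all AE_space
  proof eventually_elim
    case (elim p)
    have \<mu>: "W (fst p) (snd p) \<in> prob_measures d" using elim(2) unfolding space_SQ by (intro is_graphonD(2)[OF W]) auto
    have "(\<Sum>r\<le>R. m r p) = (\<Sum>r\<le>R. 1 * (\<integral>s. B r s \<partial>W (fst p) (snd p)))" using elim(1) by simp
    also have "\<dots> = 1" unfolding lin[OF \<mu>] using B_sum prob_space.prob_space[OF prob_measuresD(1)[OF \<mu>]] by simp
    finally show ?case .
  qed
  have b_approx: "AE p in SQ. \<bar>b k p - (\<Sum>r\<le>R. \<sigma> r ^ k * m r p)\<bar> \<le> \<delta> / 4" if k: "k \<le> K" for k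
    using m_all b(3)[of k] AE_space
  proof eventually_elim
    case (elim p)
    have \<mu>: "W (fst p) (snd p) \<in> prob_measures d" using elim(3) unfolding space_SQ by (intro is_graphonD(2)[OF W]) auto
    have "(\<Sum>r\<le>R. \<sigma> r ^ k * m r p) = (\<integral>s. (\<Sum>r\<le>R. \<sigma> r ^ k * B r s) \<partial>W (fst p) (snd p))"
      unfolding lin[OF \<mu>, symmetric] using elim(1) by simp
    moreover have "\<bar>(\<integral>s. (s / d) ^ k \<partial>W (fst p) (snd p)) - (\<integral>s. (\<Sum>r\<le>R. \<sigma> r ^ k * B r s) \<partial>W (fst p) (snd p))\<bar> \<le> \<delta> / 4"
      using R(2)[OF k] unfolding \<sigma>_def B_def
      by (intro integral_prob_measures_abs_diff[OF \<mu> sdc]) (auto intro!: continuous_intros Bc[unfolded B_def[abs_def]])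
    ultimately show ?case using elim(2) by simp
  qed
  \<comment> \<open>A grid on which all the weights are almost constant.\<close>
  define \<eta> where "\<eta> = \<delta> / 4 / real (Suc R)"
  have \<eta>: "0 < \<eta>" using \<delta>4 by (simp add: \<eta>_def)
  define near where "near r N0 \<longleftrightarrow>
      (\<forall>N\<ge>N0. (\<integral>p. \<bar>m r p - grid_avg N (m r) (grid N (fst p)) (grid N (snd p))\<bar> \<partial>SQ) \<le> \<eta>)" for r N0
  have "\<exists>N0. near r N0" if r: "r \<le> R" for r
  proof -
    have "\<bar>m r p\<bar> \<le> 1" for p using m(2)[OF r, of p] by linarith
    from grid_avg_L1[OF m(1)[OF r] this \<eta>] show ?thesis unfolding near_def by blast
  qed
  then have "\<exists>N0. r \<le> R \<longrightarrow> near r N0" for r by blast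
  then obtain N0 where N0: "\<And>r. r \<le> R \<Longrightarrow> near r (N0 r)" by metis
  define N where "N = Suc (\<Sum>r\<le>R. N0 r)"
  have N: "0 < N" by (simp add: N_def)
  define \<mu> where "\<mu> r a c = grid_avg N (m r) a c" for r a c
  have close: "(\<integral>p. \<bar>m r p - \<mu> r (grid N (fst p)) (grid N (snd p))\<bar> \<partial>SQ) \<le> \<eta>" if r: "r \<le> R" for r
  proof -
    have "N0 r \<le> (\<Sum>r\<le>R. N0 r)" using r by (intro member_le_sum) auto
    then have "N0 r \<le> N" by (simp add: N_def)
    with N0[OF r] show ?thesis unfolding near_def \<mu>_def by blast
  qed
  have mi: "integrable SQ (m r)" if "r \<le> R" for r
    using m(1,2)[OF that] by (intro integrable_SQ_bounded[of _ 1] borel_measurable_SQ) auto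
  have \<mu>_bd: "0 \<le> \<mu> r a c \<and> \<mu> r a c \<le> 1" if "r \<le> R" "a < N" "c < N" for r a c
    unfolding \<mu>_def using m(2)[OF that(1)] by (intro grid_avg_bounds[OF N that(2,3) mi[OF that(1)]])
  have \<mu>_sym: "\<mu> r a c = \<mu> r c a" if "r \<le> R" for r a c
    unfolding \<mu>_def using m(1,3)[OF that] by (intro grid_avg_swap[OF N] borel_measurable_SQ)
  have \<mu>_sum: "(\<Sum>r\<le>R. \<mu> r a c) = 1" if ac: "a < N" "c < N" for a c
  proof -
    let ?I = "indicat_real (grid_cell N a c)"
    have "(\<integral>p. (\<Sum>r\<le>R. ?I p * m r p) \<partial>SQ) = (\<Sum>r\<le>R. \<integral>p. ?I p * m r p \<partial>SQ)"
      by (rule Bochner_Integration.integral_sum) (auto intro!: integrable_grid_cell[OF N mi])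
    then have "(\<Sum>r\<le>R. \<mu> r a c) = (real N)\<^sup>2 * (\<integral>p. (\<Sum>r\<le>R. ?I p * m r p) \<partial>SQ)"
      by (simp only: \<mu>_def grid_avg_def sum_distrib_left)
    also have "(\<integral>p. (\<Sum>r\<le>R. ?I p * m r p) \<partial>SQ) = (\<integral>p. ?I p \<partial>SQ)"
    proof (rule integral_cong_AE)
      show "AE p in SQ. (\<Sum>r\<le>R. ?I p * m r p) = ?I p"
        using m_sum by eventually_elim (simp add: sum_distrib_left[symmetric])
      show I: "?I \<in> borel_measurable SQ" by (rule borel_measurable_indicator[OF sets_grid_cell[OF N]])
      show "(\<lambda>p. \<Sum>r\<le>R. ?I p * m r p) \<in> borel_measurable SQ"
        by (rule borel_measurable_sum, rule borel_measurable_times[OF I], rule borel_measurable_SQ, rule m(1)) simp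
    qed
    also have "\<dots> = (1 / real N)\<^sup>2"
      using sets.sets_into_space[OF sets_grid_cell[OF N], of a c] measure_grid_cell[OF N ac]
      by (simp add: Int_absorb2)
    finally show ?thesis using N by (simp add: power_divide)
  qed
  obtain Q :: nat where Q: "8 * real R / \<delta> < real Q" using reals_Archimedean2 by blast
  have Q0: "0 < Q"
  proof -
    have "0 \<le> 8 * real R / \<delta>" using \<delta> by simp
    then show ?thesis using Q by linarith
  qed
  have QR: "2 * real R / real Q \<le> \<delta> / 4" using Q Q0 \<delta> by (simp add: field_simps)
  define rounded where "rounded a c G \<longleftrightarrow> (\<forall>z. G z \<le> R) \<and> (a < N \<and> c < N \<longrightarrow> (\<forall>v. (\<forall>r\<le>R. \<bar>v r\<bar> \<le> 1) \<longrightarrow>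
      \<bar>(\<Sum>z<Q. v (G z)) / real Q - (\<Sum>r\<le>R. \<mu> r a c * v r)\<bar> \<le> 2 * real R / real Q))"
    for a c and G :: "nat \<Rightarrow> nat"
  have "\<exists>G. rounded a c G" for a c
  proof (cases "a < N \<and> c < N")
    case True
    then have "\<And>r. r \<le> R \<Longrightarrow> 0 \<le> \<mu> r a c" "(\<Sum>r\<le>R. \<mu> r a c) = 1" using \<mu>_bd \<mu>_sum by auto
    from rational_rounding[of R "\<lambda>r. \<mu> r a c" Q, OF this Q0] obtain G where "\<And>z. G z \<le> R"
      "\<And>v. (\<And>r. r \<le> R \<Longrightarrow> \<bar>v r\<bar> \<le> 1) \<Longrightarrow>
        \<bar>(\<Sum>z<Q. v (G z)) / real Q - (\<Sum>r\<le>R. \<mu> r a c * v r)\<bar> \<le> 2 * real R / real Q" by blast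
    then show ?thesis unfolding rounded_def by (intro exI[of _ G]) simp
  next
    case False
    then show ?thesis unfolding rounded_def by (intro exI[of _ "\<lambda>_. 0"]) auto
  qed
  then obtain G where rounded: "\<And>a c. rounded a c (G a c)" by metis
  have G: "G a c z \<le> R" for a c z using rounded[of a c] unfolding rounded_def by blast
  \<comment> \<open>Rounding was done for ordered pairs; only the pairs \<open>a \<le> c\<close> are used, to obtain symmetry.\<close>
  define g where "g a c z = \<sigma> (G (min a c) (max a c) z)" for a c z
  define Y where "Y k a c = (\<Sum>z<Q. g a c z ^ k) / real Q" for k a c
  have gk: "\<bar>g a c z ^ k\<bar> \<le> 1" for a c z k unfolding g_def by (rule \<sigma>[OF G])
  have Y1: "\<bar>Y k a c\<bar> \<le> 1" for k a c
  proof -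
    have "\<bar>\<Sum>z<Q. g a c z ^ k\<bar> \<le> (\<Sum>z<Q. 1)" by (intro order_trans[OF sum_abs] sum_mono gk)
    then show ?thesis unfolding Y_def using Q0 by (simp add: abs_divide)
  qed
  have Y_approx: "\<bar>Y k a c - (\<Sum>r\<le>R. \<mu> r a c * \<sigma> r ^ k)\<bar> \<le> \<delta> / 4" if ac: "a < N" "c < N" for k a c
  proof -
    have "(\<Sum>r\<le>R. \<mu> r (min a c) (max a c) * \<sigma> r ^ k) = (\<Sum>r\<le>R. \<mu> r a c * \<sigma> r ^ k)"
      using \<mu>_sym[of _ c a] by (intro sum.cong refl) (auto simp: min_def max_def)
    moreover have round: "\<bar>(\<Sum>z<Q. \<sigma> (G (min a c) (max a c) z) ^ k) / real Q -
        (\<Sum>r\<le>R. \<mu> r (min a c) (max a c) * \<sigma> r ^ k)\<bar> \<le> 2 * real R / real Q"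
    proof -
      have "min a c < N" "max a c < N" using ac by auto
      then have "\<forall>v. (\<forall>r\<le>R. \<bar>v r\<bar> \<le> 1) \<longrightarrow>
          \<bar>(\<Sum>z<Q. v (G (min a c) (max a c) z)) / real Q - (\<Sum>r\<le>R. \<mu> r (min a c) (max a c) * v r)\<bar>
            \<le> 2 * real R / real Q"
        using rounded[of "min a c" "max a c"] unfolding rounded_def by blast
      from this[THEN spec, of "\<lambda>r. \<sigma> r ^ k"] show ?thesis using \<sigma> by blast
    qed
    ultimately show ?thesis
      using round QR unfolding Y_def g_def by linarith
  qed
  let ?Y = "\<lambda>k x y. Y k (grid N x) (grid N y)"
  let ?b = "\<lambda>k x y. b k (x, y)"
  have L1: "(\<integral>p. \<bar>b k p - Y k (grid N (fst p)) (grid N (snd p))\<bar> \<partial>SQ) \<le> \<delta>" if k: "k \<le> K" for k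
  proof -
    let ?\<mu> = "\<lambda>r p. \<mu> r (grid N (fst p)) (grid N (snd p))"
    let ?e = "\<lambda>p. \<bar>b k p - Y k (grid N (fst p)) (grid N (snd p))\<bar>"
    have \<mu>m: "?\<mu> r \<in> borel_measurable SQ" for r by (rule grid_step_measurable[OF N])
    have \<mu>i: "integrable SQ (?\<mu> r)" if "r \<le> R" for r
    proof (rule integrable_SQ_bounded[of _ 1, OF \<mu>m])
      fix p assume "p \<in> space SQ"
      then have "fst p \<in> {0..1}" "snd p \<in> {0..1}" unfolding space_SQ by auto
      from \<mu>_bd[OF that grid_less[OF N this(1)] grid_less[OF N this(2)]] show "\<bar>?\<mu> r p\<bar> \<le> 1" by simp
    qed
    have di: "integrable SQ (\<lambda>p. \<Sum>r\<le>R. \<bar>m r p - ?\<mu> r p\<bar>)"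
      using mi \<mu>i by (intro Bochner_Integration.integrable_sum integrable_abs Bochner_Integration.integrable_diff) auto
    have ei: "integrable SQ ?e"
    proof (rule integrable_SQ_bounded[of _ 2])
      show "?e \<in> borel_measurable SQ"
        by (intro borel_measurable_abs borel_measurable_diff borel_measurable_SQ b(1) grid_step_measurable[OF N])
      fix p show "\<bar>?e p\<bar> \<le> 2" using b(2)[of k p] Y1[of k "grid N (fst p)" "grid N (snd p)"] by linarith
    qed
    have "(\<integral>p. ?e p \<partial>SQ) \<le> (\<integral>p. \<delta> / 2 + (\<Sum>r\<le>R. \<bar>m r p - ?\<mu> r p\<bar>) \<partial>SQ)"
    proof (rule integral_mono_AE)
      show "AE p in SQ. ?e p \<le> \<delta> / 2 + (\<Sum>r\<le>R. \<bar>m r p - ?\<mu> r p\<bar>)"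
        using b_approx[OF k] AE_space
      proof eventually_elim
        case (elim p)
        then have p: "fst p \<in> {0..1}" "snd p \<in> {0..1}" unfolding space_SQ by auto
        have "\<bar>(\<Sum>r\<le>R. \<sigma> r ^ k * m r p) - (\<Sum>r\<le>R. ?\<mu> r p * \<sigma> r ^ k)\<bar> = \<bar>\<Sum>r\<le>R. \<sigma> r ^ k * (m r p - ?\<mu> r p)\<bar>"
          by (simp add: sum_subtractf right_diff_distrib mult.commute)
        also have "\<dots> \<le> (\<Sum>r\<le>R. 1 * \<bar>m r p - ?\<mu> r p\<bar>)"
        proof (intro order_trans[OF sum_abs] sum_mono)
          fix r assume "r \<in> {..R}"
          then show "\<bar>\<sigma> r ^ k * (m r p - ?\<mu> r p)\<bar> \<le> 1 * \<bar>m r p - ?\<mu> r p\<bar>"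
            unfolding abs_mult by (intro mult_right_mono \<sigma>) auto
        qed
        finally have "\<bar>(\<Sum>r\<le>R. \<sigma> r ^ k * m r p) - (\<Sum>r\<le>R. ?\<mu> r p * \<sigma> r ^ k)\<bar> \<le> (\<Sum>r\<le>R. \<bar>m r p - ?\<mu> r p\<bar>)"
          by (simp only: mult_1_left)
        then show ?case
          using elim(1) Y_approx[OF grid_less[OF N p(1)] grid_less[OF N p(2)], of k] by linarith
      qed
    qed (use ei di in auto)
    also have "\<dots> = \<delta> / 2 + (\<integral>p. (\<Sum>r\<le>R. \<bar>m r p - ?\<mu> r p\<bar>) \<partial>SQ)"
      using di SQ.prob_space by (subst Bochner_Integration.integral_add) auto
    also have "(\<integral>p. (\<Sum>r\<le>R. \<bar>m r p - ?\<mu> r p\<bar>) \<partial>SQ) = (\<Sum>r\<le>R. \<integral>p. \<bar>m r p - ?\<mu> r p\<bar> \<partial>SQ)"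
      using mi \<mu>i by (intro Bochner_Integration.integral_sum) auto
    also have "\<dots> \<le> (\<Sum>r\<le>R. \<eta>)" by (intro sum_mono close) auto
    also have "\<dots> = real (Suc R) * \<eta>" by (simp only: sum_constant card_atMost)
    also have "\<dots> = \<delta> / 4" unfolding \<eta>_def by (simp del: of_nat_Suc)
    finally show ?thesis using \<delta> by simp
  qed
  have "\<bar>t_graphon F W - d ^ edge_count F * fin_dens F {..<N} (\<lambda>_. 1 / real N) Y\<bar> \<le>
      d ^ edge_count F * (real (card (node_pairs F)) * \<delta>)"
    if F: "\<And>i j. (i, j) \<in> node_pairs F \<Longrightarrow> edge_mult F i j \<le> K" for F
  proof -
    have bm: "(\<lambda>p. b k (fst p, snd p)) \<in> borel_measurable SQ" for k using borel_measurable_SQ[OF b(1)] by simp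
    have tg: "t_graphon F W = d ^ edge_count F * graph_dens F ?b"
    proof (rule t_graphon_eq_graph_dens[OF bm])
      show "AE p in SQ. moment k W (fst p) (snd p) = d ^ k * b k (fst p, snd p)" for k
        using b(3)[of k]
      proof eventually_elim
        case (elim p)
        have "moment k W (fst p) (snd p) = d ^ k * (\<integral>s. (s / d) ^ k \<partial>W (fst p) (snd p))"
          using d by (simp add: moment_def power_divide)
        then show ?case using elim by simp
      qed
    qed
    have st: "graph_dens F ?Y = fin_dens F {..<N} (\<lambda>_. 1 / real N) Y"
      by (rule graph_dens_step[OF grid_measurable[OF N] grid_less[OF N] grid_fibre[OF N]])
    have "\<bar>graph_dens F ?b - graph_dens F ?Y\<bar> \<le> (\<Sum>(i, j)\<in>node_pairs F. \<integral>p. \<bar>?b (edge_mult F i j) (fst p) (snd p) -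
        ?Y (edge_mult F i j) (fst p) (snd p)\<bar> \<partial>SQ)"
    proof (rule graph_dens_L1[OF bm])
      show "(\<lambda>p. ?Y k (fst p) (snd p)) \<in> borel_measurable SQ" for k by (rule grid_step_measurable[OF N])
      show "\<bar>?b k x y\<bar> \<le> 1" for k x y using b(2)[of k "(x, y)"] by linarith
    qed (rule Y1)
    also have "\<dots> \<le> (\<Sum>(i, j)\<in>node_pairs F. \<delta>)" using L1 F by (intro sum_mono) auto
    finally have le: "\<bar>graph_dens F ?b - graph_dens F ?Y\<bar> \<le> real (card (node_pairs F)) * \<delta>" by simp
    have "0 \<le> d ^ edge_count F" using d by simp
    with le show ?thesis
      unfolding tg st[symmetric] right_diff_distrib[symmetric] abs_mult abs_of_nonneg[OF \<open>0 \<le> d ^ edge_count F\<close>]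
      by (rule mult_left_mono)
  qed
  moreover have "\<bar>g a c z\<bar> \<le> 1" for a c z using gk[of a c z 1] by simp
  moreover have "g a c z = g c a z" for a c z by (simp add: g_def min.commute max.commute)
  ultimately show thesis using N Q0 unfolding Y_def[abs_def] by (intro that[of N Q g]) auto
qed

subsection \<open>Realization by weighted graphs\<close>

text \<open>A symmetric kernel on a finite set of any type is a weighted graph on natural numbers.\<close>

lemma weighted_graph_of_finite:
  fixes V :: "'a set" and \<beta> :: "'a \<Rightarrow> 'a \<Rightarrow> real"
  assumes V: "finite V" "V \<noteq> {}" and d: "0 < d"
    and \<beta>: "\<And>x y. \<bar>\<beta> x y\<bar> \<le> 1" "\<And>x y. \<beta> x y = \<beta> y x"
  obtains H where "is_weighted_graph d H"
    "\<And>F. t_weighted F H = d ^ edge_count F * fin_dens F V (\<lambda>_. 1 / real (card V)) (\<lambda>k x y. \<beta> x y ^ k)"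
proof -
  from finite_imp_inj_to_nat_seg[OF V(1)] obtain f :: "'a \<Rightarrow> nat" where f: "inj_on f V" by blast
  define g where "g = inv_into V f"
  have g: "g (f x) = x" if "x \<in> V" for x using f that by (simp add: g_def)
  define H where "H = \<lparr>wnodes = f ` V, nodeweight = (\<lambda>_. 1), edgeweight = (\<lambda>i j. d * \<beta> (g i) (g j))\<rparr>"
  have "\<bar>d * \<beta> x y\<bar> \<le> d" for x y using \<beta>(1)[of x y] d by (simp add: abs_mult)
  then have "is_weighted_graph d H"
    using V \<beta>(2) unfolding is_weighted_graph_def H_def by (auto simp: abs_le_iff minus_le_iff)
  moreover have "t_weighted F H = d ^ edge_count F * fin_dens F V (\<lambda>_. 1 / real (card V)) (\<lambda>k x y. \<beta> x y ^ k)" for F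
  proof -
    let ?b = "\<lambda>k i j. (d * \<beta> (g i) (g j)) ^ k"
    have "t_weighted F H = fin_dens F (f ` V) (\<lambda>_. 1 / real (card V)) ?b"
      unfolding t_weighted_eq_fin_dens by (simp add: H_def card_image[OF f])
    also have "\<dots> = fin_dens F (f ` V) (\<lambda>c. \<Sum>x\<in>{x\<in>V. f x = c}. 1 / real (card V)) ?b"
    proof (rule fin_dens_cong)
      fix c assume "c \<in> f ` V"
      then obtain x where "x \<in> V" "c = f x" by blast
      then have "{y\<in>V. f y = c} = {x}" using f by (auto simp: inj_on_def)
      then show "1 / real (card V) = (\<Sum>x\<in>{x\<in>V. f x = c}. 1 / real (card V))" by simp
    qed simp
    also have "\<dots> = fin_dens F V (\<lambda>_. 1 / real (card V)) (\<lambda>k x y. ?b k (f x) (f y))"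
      using V(1) by (intro fin_dens_pushforward[symmetric]) auto
    also have "\<dots> = fin_dens F V (\<lambda>_. 1 / real (card V)) (\<lambda>k x y. d ^ k * \<beta> x y ^ k)"
      by (rule fin_dens_cong) (simp_all add: g power_mult_distrib)
    finally show ?thesis unfolding fin_dens_scale .
  qed
  ultimately show thesis by (rule that)
qed

text \<open>
  The step graphon on a grid is realized, up to a small error, by a quasirandom blow-up. As the error bound of
  \<open>quasirandom_blowup\<close> does not depend on the values of \<open>g\<close>, it holds for all powers of \<open>g\<close> at once.
\<close>

lemma blowup_realization:
  fixes g :: "nat \<Rightarrow> nat \<Rightarrow> nat \<Rightarrow> real"
  assumes N: "0 < N" and Q: "0 < Q" and d: "0 < d" and \<delta>: "0 < \<delta>"
    and g: "\<And>a c z. \<bar>g a c z\<bar> \<le> 1" "\<And>a c z. g a c z = g c a z"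
  obtains H where "is_weighted_graph d H"
    "\<And>F. \<bar>t_weighted F H - d ^ edge_count F *
       fin_dens F {..<N} (\<lambda>_. 1 / real N) (\<lambda>k a c. (\<Sum>z<Q. g a c z ^ k) / real Q)\<bar> \<le>
     d ^ edge_count F * (real (card (node_pairs F)) * \<delta>)"
proof -
  obtain S :: nat where S: "4 / \<delta>\<^sup>2 < real S" using reals_Archimedean2 by blast
  have "0 < 4 / \<delta>\<^sup>2" using \<delta> by simp
  with S have S0: "0 < S" by linarith
  have S4: "4 / real S \<le> \<delta>\<^sup>2" using S S0 \<delta> by (simp add: field_simps)
  let ?V = "blowup N S Q"
  let ?\<alpha> = "\<lambda>_::bnode. 1 / real (card ?V)"
  let ?Y = "\<lambda>k a c. (\<Sum>z<Q. g a c z ^ k) / real Q"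
  define \<beta> where "\<beta> x y = g (fst x) (fst y) (colour Q x y)" for x y
  have card: "0 < card ?V" using N S0 Q by (simp add: card_blowup)
  then have V: "?V \<noteq> {}" by auto
  have gk: "\<bar>g a c z ^ k\<bar> \<le> 1" for a c z k unfolding power_abs using g(1) by (intro power_le_one) auto
  have Y: "\<bar>?Y k a c\<bar> \<le> 1" for k a c
  proof -
    have "\<bar>\<Sum>z<Q. g a c z ^ k\<bar> \<le> (\<Sum>z<Q. 1)" by (intro order_trans[OF sum_abs] sum_mono gk)
    then show ?thesis using Q by (simp add: abs_divide)
  qed
  have \<beta>: "\<bar>\<beta> x y\<bar> \<le> 1" "\<beta> x y = \<beta> y x" for x y
    unfolding \<beta>_def by (rule g(1)) (simp add: g(2)[of "fst x"] colour_sym[of Q x])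
  obtain H where H: "is_weighted_graph d H"
    "\<And>F. t_weighted F H = d ^ edge_count F * fin_dens F ?V ?\<alpha> (\<lambda>k x y. \<beta> x y ^ k)"
    using weighted_graph_of_finite[of ?V d \<beta>, OF finite_blowup V d \<beta>] by blast
  have "\<bar>t_weighted F H - d ^ edge_count F * fin_dens F {..<N} (\<lambda>_. 1 / real N) ?Y\<bar> \<le>
     d ^ edge_count F * (real (card (node_pairs F)) * \<delta>)" for F
  proof -
    have "fin_dens F ?V ?\<alpha> (\<lambda>k x y. ?Y k (fst x) (fst y)) =
        fin_dens F {..<N} (\<lambda>a. \<Sum>x\<in>{x\<in>?V. fst x = a}. 1 / real (card ?V)) ?Y"
      by (rule fin_dens_pushforward[OF finite_blowup]) (auto simp: blowup_def)
    also have "\<dots> = fin_dens F {..<N} (\<lambda>_. 1 / real N) ?Y"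
    proof (rule fin_dens_cong)
      fix a assume "a \<in> {..<N}"
      then show "(\<Sum>x\<in>{x\<in>?V. fst x = a}. 1 / real (card ?V)) = 1 / real N"
        using N S0 Q by (simp add: card_blowup card_blowup_cell)
    qed simp
    finally have pf: "fin_dens F {..<N} (\<lambda>_. 1 / real N) ?Y = fin_dens F ?V ?\<alpha> (\<lambda>k x y. ?Y k (fst x) (fst y))" ..
    have le: "\<bar>fin_dens F ?V ?\<alpha> (\<lambda>k x y. \<beta> x y ^ k) - fin_dens F ?V ?\<alpha> (\<lambda>k x y. ?Y k (fst x) (fst y))\<bar> \<le>
        real (card (node_pairs F)) * \<delta>"
    proof (rule counting_lemma[OF finite_blowup])
      show "(\<Sum>x\<in>?V. ?\<alpha> x) = 1" using card V by simp
      show "\<bar>\<beta> x y ^ k\<bar> \<le> 1" for k x y unfolding \<beta>_def by (rule gk)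
      show "cut_le ?V ?\<alpha> (\<lambda>x y. \<beta> x y ^ edge_mult F i j - ?Y (edge_mult F i j) (fst x) (fst y)) \<delta>" for i j
        unfolding \<beta>_def using \<delta> S4 gk by (intro quasirandom_blowup[OF N S0 Q]) auto
    qed (use Y in auto)
    have "0 \<le> d ^ edge_count F" using d by simp
    with le show ?thesis
      unfolding H(2) pf right_diff_distrib[symmetric] abs_mult abs_of_nonneg[OF \<open>0 \<le> d ^ edge_count F\<close>]
      by (rule mult_left_mono)
  qed
  with H(1) show thesis by (rule that)
qed

theorem graphon_approx:
  assumes W: "is_graphon d W" and d: "0 < d" and \<F>: "finite \<F>" and \<epsilon>: "0 < \<epsilon>"
  obtains H where "is_weighted_graph d H" "\<And>F. F \<in> \<F> \<Longrightarrow> \<bar>t_weighted F H - t_graphon F W\<bar> < \<epsilon>"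
proof -
  define K where "K = (\<Sum>F\<in>\<F>. edge_count F)"
  have K: "edge_mult F i j \<le> K" if "F \<in> \<F>" "(i, j) \<in> node_pairs F" for F i j
  proof -
    have "edge_mult F i j \<le> edge_count F"
      using member_le_sum[OF that(2), of "\<lambda>(i, j). edge_mult F i j"] by (simp add: edge_count_def)
    also have "\<dots> \<le> K" unfolding K_def using that(1) \<F> by (intro member_le_sum) auto
    finally show ?thesis .
  qed
  define C where "C F = d ^ edge_count F * real (card (node_pairs F))" for F
  have C: "0 \<le> C F" for F using d by (simp add: C_def)
  define D where "D = 1 + (\<Sum>F\<in>\<F>. C F)"
  have D0: "0 < D" unfolding D_def using sum_nonneg[of \<F> C] C by (simp add: add_pos_nonneg)
  have CD: "C F < D" if "F \<in> \<F>" for F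
    using member_le_sum[of F \<F> C] that C \<F> unfolding D_def by simp
  define \<delta> where "\<delta> = \<epsilon> / (2 * D)"
  have \<delta>: "0 < \<delta>" using \<epsilon> D0 by (simp add: \<delta>_def)
  obtain N Q and g :: "nat \<Rightarrow> nat \<Rightarrow> nat \<Rightarrow> real"
    where N: "0 < N" "0 < Q" and g: "\<And>a c z. \<bar>g a c z\<bar> \<le> 1" "\<And>a c z. g a c z = g c a z"
    and approx: "\<And>F. (\<And>i j. (i, j) \<in> node_pairs F \<Longrightarrow> edge_mult F i j \<le> K) \<Longrightarrow>
      \<bar>t_graphon F W - d ^ edge_count F *
         fin_dens F {..<N} (\<lambda>_. 1 / real N) (\<lambda>k a c. (\<Sum>z<Q. g a c z ^ k) / real Q)\<bar> \<le>
      d ^ edge_count F * (real (card (node_pairs F)) * \<delta>)"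
    using graphon_grid_approx[OF W d \<delta>, of K] by blast
  obtain H where H: "is_weighted_graph d H" and real: "\<And>F. \<bar>t_weighted F H - d ^ edge_count F *
       fin_dens F {..<N} (\<lambda>_. 1 / real N) (\<lambda>k a c. (\<Sum>z<Q. g a c z ^ k) / real Q)\<bar> \<le>
     d ^ edge_count F * (real (card (node_pairs F)) * \<delta>)"
    using blowup_realization[of N Q d \<delta> g, OF N d \<delta> g] by blast
  have "\<bar>t_weighted F H - t_graphon F W\<bar> < \<epsilon>" if F: "F \<in> \<F>" for F
  proof -
    have "\<bar>t_weighted F H - t_graphon F W\<bar> \<le> 2 * (C F * \<delta>)"
      using real[of F] approx[OF K[OF F]] unfolding C_def mult.assoc by linarith
    also have "\<dots> < 2 * (D * \<delta>)" using CD[OF F] \<delta> by simp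
    also have "\<dots> = \<epsilon>" using D0 by (simp add: \<delta>_def)
    finally show ?thesis .
  qed
  with H show thesis by (rule that)
qed

section \<open>The topology of pointwise convergence\<close>

lemma closure_pointwise:
  fixes S :: "('a \<Rightarrow> real) set"
  shows "f \<in> closure S \<longleftrightarrow> (\<forall>A \<epsilon>. finite A \<longrightarrow> 0 < \<epsilon> \<longrightarrow> (\<exists>g\<in>S. \<forall>x\<in>A. \<bar>g x - f x\<bar> < \<epsilon>))"
proof
  assume f: "f \<in> closure S"
  show "\<forall>A \<epsilon>. finite A \<longrightarrow> 0 < \<epsilon> \<longrightarrow> (\<exists>g\<in>S. \<forall>x\<in>A. \<bar>g x - f x\<bar> < \<epsilon>)"
  proof (intro allI impI)
    fix A :: "'a set" and \<epsilon> :: real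
    assume A: "finite A" and \<epsilon>: "0 < \<epsilon>"
    define T where "T = (\<Inter>x\<in>A. (\<lambda>g :: 'a \<Rightarrow> real. g x) -` ball (f x) \<epsilon>)"
    have "open T"
      unfolding T_def using A
      by (intro open_INT ballI open_vimage open_ball continuous_on_product_coordinates)
    moreover have "f \<in> T" using \<epsilon> by (simp add: T_def)
    ultimately have "S \<inter> T \<noteq> {}" using f open_Int_closure_eq_empty[of T S] by blast
    then obtain g where g: "g \<in> S" "g \<in> T" by blast
    then have "\<bar>g x - f x\<bar> < \<epsilon>" if "x \<in> A" for x
      using that by (simp add: T_def dist_real_def abs_minus_commute)
    with g(1) show "\<exists>g\<in>S. \<forall>x\<in>A. \<bar>g x - f x\<bar> < \<epsilon>" by blast
  qed
next
  assume approx: "\<forall>A \<epsilon>. finite A \<longrightarrow> 0 < \<epsilon> \<longrightarrow> (\<exists>g\<in>S. \<forall>x\<in>A. \<bar>g x - f x\<bar> < \<epsilon>)"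
  show "f \<in> closure S"
    unfolding closure_iff_nhds_not_empty
  proof (intro allI impI)
    fix A T assume "T \<subseteq> A" "open T" "f \<in> T"
    then have "openin (product_topology (\<lambda>_. euclidean) UNIV) T" by (simp add: euclidean_product_topology)
    from product_topology_open_contains_basis[OF this \<open>f \<in> T\<close>] obtain X where
      X: "f \<in> Pi\<^sub>E UNIV X" "\<And>i. open (X i)" "finite {i. X i \<noteq> UNIV}" "Pi\<^sub>E UNIV X \<subseteq> T"
      by (auto simp: topspace_euclidean)
    have "\<exists>e>0. ball (f i) e \<subseteq> X i" for i
      using X(1,2) open_contains_ball[of "X i"] by (auto simp: PiE_iff)
    then obtain e where e: "\<And>i. 0 < e i" "\<And>i. ball (f i) (e i) \<subseteq> X i" by metis
    let ?I = "{i. X i \<noteq> UNIV}"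
    define \<epsilon> where "\<epsilon> = Min (insert 1 (e ` ?I))"
    have "0 < \<epsilon>" using X(3) e(1) by (auto simp: \<epsilon>_def)
    with approx X(3) obtain g where g: "g \<in> S" "\<forall>x\<in>?I. \<bar>g x - f x\<bar> < \<epsilon>" by blast
    have "g i \<in> X i" for i
    proof (cases "i \<in> ?I")
      case True
      then have "\<epsilon> \<le> e i" using X(3) by (auto simp: \<epsilon>_def)
      then have "g i \<in> ball (f i) (e i)" using g(2) True by (auto simp: dist_real_def abs_minus_commute)
      then show ?thesis using e(2) by blast
    qed simp
    then have "g \<in> T" using X(4) by (auto simp: PiE_iff)
    then show "S \<inter> A \<noteq> {}" using g(1) \<open>T \<subseteq> A\<close> by blast
  qed
qed

lemma finite_bounded_multigraphs:
  "finite {F. nodes F \<subseteq> {..<n} \<and> (\<forall>i j. edge_mult F i j \<le> n)}"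
proof -
  let ?A = "{F. nodes F \<subseteq> {..<n} \<and> (\<forall>i j. edge_mult F i j \<le> n)}"
  let ?r = "\<lambda>F. (nodes F, \<lambda>p\<in>{..<n} \<times> {..<n}. edge_mult F (fst p) (snd p))"
  have "?r ` ?A \<subseteq> Pow {..<n} \<times> (({..<n} \<times> {..<n}) \<rightarrow>\<^sub>E {..n})"
    by (rule image_subsetI) (simp add: restrict_PiE_iff)
  moreover have "finite (Pow {..<n} \<times> (({..<n} \<times> {..<n}) \<rightarrow>\<^sub>E {..n}))" by (auto intro!: finite_PiE)
  ultimately have "finite (?r ` ?A)" by (rule finite_subset)
  moreover have "inj_on ?r ?A"
  proof (rule inj_onI)
    fix F G assume F: "F \<in> ?A" and G: "G \<in> ?A" and eq: "?r F = ?r G"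
    have out: "edge_mult E i j = 0" if "i \<notin> nodes E \<or> j \<notin> nodes E" for E i j
      using Rep_multigraph[of E] that by (auto simp: nodes_def edge_mult_def split_beta)
    have N: "nodes F = nodes G" using eq by simp
    have "edge_mult F i j = edge_mult G i j" for i j
    proof (cases "i < n \<and> j < n")
      case True
      then show ?thesis using fun_cong[OF arg_cong[OF eq, of snd], of "(i, j)"] by simp
    next
      case False
      then have "i \<notin> nodes F \<or> j \<notin> nodes F" using F by auto
      then show ?thesis using out N by metis
    qed
    then have "edge_mult F = edge_mult G" by (intro ext)
    with N show "F = G" unfolding nodes_def edge_mult_def by (metis Rep_multigraph_inject prod_eqI)
  qed
  ultimately show ?thesis by (rule finite_imageD)
qed

lemma bounded_multigraphs_exhaust:
  obtains n0 where "\<And>n. n0 \<le> n \<Longrightarrow> nodes F \<subseteq> {..<n} \<and> (\<forall>i j. edge_mult F i j \<le> n)"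
proof -
  obtain a where a: "nodes F \<subseteq> {..<a}" using finite_nodes[of F] finite_nat_iff_bounded by blast
  define n0 where "n0 = a + (\<Sum>i\<in>nodes F. \<Sum>j\<in>nodes F. edge_mult F i j)"
  have out: "edge_mult F i j = 0" if "i \<notin> nodes F \<or> j \<notin> nodes F" for i j
    using Rep_multigraph[of F] that by (auto simp: nodes_def edge_mult_def split_beta)
  have "edge_mult F i j \<le> n0" for i j
  proof (cases "i \<in> nodes F \<and> j \<in> nodes F")
    case True
    then have "edge_mult F i j \<le> (\<Sum>j\<in>nodes F. edge_mult F i j)" by (intro member_le_sum) auto
    also have "\<dots> \<le> (\<Sum>i\<in>nodes F. \<Sum>j\<in>nodes F. edge_mult F i j)"
      using True by (intro member_le_sum[of i _ "\<lambda>i. \<Sum>j\<in>nodes F. edge_mult F i j"]) auto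
    finally show ?thesis by (simp add: n0_def)
  next
    case False
    then show ?thesis using out[of i j] by auto
  qed
  moreover have "a \<le> n0" by (simp add: n0_def)
  ultimately show thesis
    using a by (intro that[of n0] conjI allI) (auto intro: order_trans less_le_trans)
qed

lemma t_weighted_iso:
  assumes H: "is_weighted_graph d H" and iso: "multigraph_iso F G"
  shows "t_weighted F H = t_weighted G H"
proof -
  let ?V = "wnodes H" and ?\<beta> = "edgeweight H"
  from iso obtain \<pi> where \<pi>: "bij_betw \<pi> (nodes F) (nodes G)"
    and e: "\<And>i j. i \<in> nodes F \<Longrightarrow> j \<in> nodes F \<Longrightarrow> edge_mult F i j = edge_mult G (\<pi> i) (\<pi> j)"
    unfolding multigraph_iso_def by blast
  have inj: "inj_on \<pi> (nodes F)" and im: "\<pi> ` nodes F = nodes G" using \<pi> by (auto simp: bij_betw_def)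
  \<comment> \<open>The orientation of the pairs may change under \<open>\<pi>\<close>; the edgeweights are symmetric.\<close>
  define o' where "o' p = (let i = \<pi> (fst p); j = \<pi> (snd p) in (min i j, max i j))" for p
  have o': "bij_betw o' (node_pairs F) (node_pairs G)"
  proof (rule bij_betwI')
    fix p q assume "p \<in> node_pairs F" "q \<in> node_pairs F"
    then show "(o' p = o' q) = (p = q)"
      using inj_on_eq_iff[OF inj]
      by (cases p; cases q) (auto simp: o'_def node_pairs_def Let_def min_def max_def split: if_splits)
  next
    fix p assume "p \<in> node_pairs F"
    then obtain i j where p: "p = (i, j)" "i \<in> nodes F" "j \<in> nodes F" "i < j" by (auto simp: node_pairs_def)
    then have "\<pi> i \<noteq> \<pi> j" using inj_on_eq_iff[OF inj] by auto
    then show "o' p \<in> node_pairs G" using p im by (auto simp: o'_def node_pairs_def Let_def min_def max_def)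
  next
    fix q assume q: "q \<in> node_pairs G"
    then obtain a b where ab: "q = (a, b)" "a \<in> \<pi> ` nodes F" "b \<in> \<pi> ` nodes F" "a < b"
      unfolding im by (cases q) (auto simp: node_pairs_def)
    then obtain i j where "i \<in> nodes F" "j \<in> nodes F" "a = \<pi> i" "b = \<pi> j" by blast
    with ab have ij: "i \<in> nodes F" "j \<in> nodes F" "q = (\<pi> i, \<pi> j)" "\<pi> i < \<pi> j" by auto
    show "\<exists>p\<in>node_pairs F. q = o' p"
    proof (cases "i < j")
      case True
      then show ?thesis using ij by (intro bexI[of _ "(i, j)"]) (auto simp: o'_def node_pairs_def)
    next
      case False
      then have "j < i" using ij by (cases "i = j") auto
      then show ?thesis using ij by (intro bexI[of _ "(j, i)"]) (auto simp: o'_def node_pairs_def)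
    qed
  qed
  have pair: "(\<Prod>(i, j)\<in>node_pairs G. ?\<beta> (\<phi> i) (\<phi> j) ^ edge_mult G i j) =
      (\<Prod>(i, j)\<in>node_pairs F. ?\<beta> (\<phi> (\<pi> i)) (\<phi> (\<pi> j)) ^ edge_mult F i j)" if \<phi>: "\<phi> \<in> nodes G \<rightarrow>\<^sub>E ?V" for \<phi>
  proof -
    have "(\<Prod>(i, j)\<in>node_pairs G. ?\<beta> (\<phi> i) (\<phi> j) ^ edge_mult G i j) =
      (\<Prod>p\<in>node_pairs F. case o' p of (i, j) \<Rightarrow> ?\<beta> (\<phi> i) (\<phi> j) ^ edge_mult G i j)"
      by (rule prod.reindex_bij_betw[OF o', symmetric])
    also have "\<dots> = (\<Prod>(i, j)\<in>node_pairs F. ?\<beta> (\<phi> (\<pi> i)) (\<phi> (\<pi> j)) ^ edge_mult F i j)"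
    proof (rule prod.cong[OF refl])
      fix p assume "p \<in> node_pairs F"
      then obtain i j where p: "p = (i, j)" "i \<in> nodes F" "j \<in> nodes F" by (auto simp: node_pairs_def)
      then have "\<phi> (\<pi> i) \<in> ?V" "\<phi> (\<pi> j) \<in> ?V" using \<phi> im by auto
      then have "?\<beta> (\<phi> (\<pi> i)) (\<phi> (\<pi> j)) = ?\<beta> (\<phi> (\<pi> j)) (\<phi> (\<pi> i))"
        using H by (auto simp: is_weighted_graph_def)
      then show "(case o' p of (i, j) \<Rightarrow> ?\<beta> (\<phi> i) (\<phi> j) ^ edge_mult G i j) =
          (case p of (i, j) \<Rightarrow> ?\<beta> (\<phi> (\<pi> i)) (\<phi> (\<pi> j)) ^ edge_mult F i j)"
        using e[OF p(2,3)] edge_mult_sym[of G "\<pi> j"] p(1)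
        by (auto simp: o'_def Let_def min_def max_def)
    qed
    finally show ?thesis .
  qed
  have "hom_weighted G H = (\<Sum>\<phi>\<in>nodes G \<rightarrow>\<^sub>E ?V. (\<Prod>i\<in>nodes F. nodeweight H (\<phi> (\<pi> i))) *
      (\<Prod>(i, j)\<in>node_pairs F. ?\<beta> (\<phi> (\<pi> i)) (\<phi> (\<pi> j)) ^ edge_mult F i j))"
    unfolding hom_weighted_def
    by (intro sum.cong refl arg_cong2[where f = "(*)"] pair) (rule prod.reindex_bij_betw[OF \<pi>, symmetric])
  also have "\<dots> = (\<Sum>\<psi>\<in>nodes F \<rightarrow>\<^sub>E ?V. (\<Prod>i\<in>nodes F. nodeweight H (\<psi> i)) *
      (\<Prod>(i, j)\<in>node_pairs F. ?\<beta> (\<psi> i) (\<psi> j) ^ edge_mult F i j))"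
  proof (rule sum.reindex_bij_witness[of _ "\<lambda>\<psi>. \<lambda>a\<in>nodes G. \<psi> (inv_into (nodes F) \<pi> a)" "\<lambda>\<phi>. \<lambda>i\<in>nodes F. \<phi> (\<pi> i)"])
    fix \<phi> assume \<phi>: "\<phi> \<in> nodes G \<rightarrow>\<^sub>E ?V"
    show "(\<lambda>a\<in>nodes G. (\<lambda>i\<in>nodes F. \<phi> (\<pi> i)) (inv_into (nodes F) \<pi> a)) = \<phi>"
      using \<phi> im by (auto simp: fun_eq_iff PiE_iff extensional_def restrict_def f_inv_into_f inv_into_into)
    show "(\<lambda>i\<in>nodes F. \<phi> (\<pi> i)) \<in> nodes F \<rightarrow>\<^sub>E ?V" using \<phi> im by auto
    show "(\<Prod>i\<in>nodes F. nodeweight H ((\<lambda>i\<in>nodes F. \<phi> (\<pi> i)) i)) *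
        (\<Prod>(i, j)\<in>node_pairs F. ?\<beta> ((\<lambda>i\<in>nodes F. \<phi> (\<pi> i)) i) ((\<lambda>i\<in>nodes F. \<phi> (\<pi> i)) j) ^ edge_mult F i j) =
        (\<Prod>i\<in>nodes F. nodeweight H (\<phi> (\<pi> i))) *
        (\<Prod>(i, j)\<in>node_pairs F. ?\<beta> (\<phi> (\<pi> i)) (\<phi> (\<pi> j)) ^ edge_mult F i j)"
      by (intro arg_cong2[where f = "(*)"] prod.cong) (auto simp: node_pairs_def)
  next
    fix \<psi> assume \<psi>: "\<psi> \<in> nodes F \<rightarrow>\<^sub>E ?V"
    show "(\<lambda>i\<in>nodes F. (\<lambda>a\<in>nodes G. \<psi> (inv_into (nodes F) \<pi> a)) (\<pi> i)) = \<psi>"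
      using \<psi> im inj by (auto simp: fun_eq_iff PiE_iff extensional_def restrict_def inv_into_f_f)
    show "(\<lambda>a\<in>nodes G. \<psi> (inv_into (nodes F) \<pi> a)) \<in> nodes G \<rightarrow>\<^sub>E ?V"
      using \<psi> im by (auto simp: PiE_iff inv_into_into)
  qed
  finally have "hom_weighted G H = hom_weighted F H" unfolding hom_weighted_def .
  then show ?thesis unfolding t_weighted_def using bij_betw_same_card[OF \<pi>] by simp
qed

theorem theorem3p2:
  fixes d :: real
  assumes "d > 0"
  shows "T3 d = graph_parameter_topology closure_of (T0 d)"
proof -
  have T0: "T0 d \<subseteq> graph_parameters"
    using t_weighted_iso by (auto simp: T0_def graph_parameters_def)
  have closed: "closure (T0 d) \<subseteq> graph_parameters"
  proof
    fix f assume f: "f \<in> closure (T0 d)"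
    have "f F = f G" if iso: "multigraph_iso F G" for F G
    proof (rule ccontr)
      assume "f F \<noteq> f G"
      then have "0 < \<bar>f F - f G\<bar> / 2" by simp
      with f obtain g where g: "g \<in> T0 d" "\<forall>E\<in>{F, G}. \<bar>g E - f E\<bar> < \<bar>f F - f G\<bar> / 2"
        unfolding closure_pointwise by (metis finite.emptyI finite.insertI)
      have "g F = g G" using g(1) T0 iso by (auto simp: graph_parameters_def)
      moreover have "\<bar>g F - f F\<bar> < \<bar>f F - f G\<bar> / 2" "\<bar>g G - f G\<bar> < \<bar>f F - f G\<bar> / 2" using g(2) by auto
      moreover have "\<bar>f F - f G\<bar> \<le> \<bar>g F - f F\<bar> + \<bar>g G - f G\<bar>" using \<open>g F = g G\<close> by linarith
      moreover have "False" if "x < c / 2" "y < c / 2" "c \<le> x + y" for x y c :: real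
        using that by linarith
      ultimately show False by blast
    qed
    then show "f \<in> graph_parameters" by (auto simp: graph_parameters_def)
  qed
  have "graph_parameter_topology closure_of T0 d = closure (T0 d)"
    unfolding graph_parameter_topology_def closure_of_subtopology Int_absorb1[OF T0]
    using closed by auto
  moreover have "T3 d \<subseteq> closure (T0 d)"
  proof
    fix f assume "f \<in> T3 d"
    then obtain W where W: "is_graphon d W" and f: "f = (\<lambda>F. t_graphon F W)" by (auto simp: T3_def)
    show "f \<in> closure (T0 d)"
      unfolding closure_pointwise
    proof (intro allI impI)
      fix A :: "multigraph set" and \<epsilon> :: real
      assume A: "finite A" "0 < \<epsilon>"
      obtain H where "is_weighted_graph d H" "\<And>F. F \<in> A \<Longrightarrow> \<bar>t_weighted F H - t_graphon F W\<bar> < \<epsilon>"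
        using graphon_approx[OF W assms A] by blast
      then show "\<exists>g\<in>T0 d. \<forall>F\<in>A. \<bar>g F - f F\<bar> < \<epsilon>"
        unfolding f T0_def by (intro bexI[of _ "\<lambda>F. t_weighted F H"]) auto
    qed
  qed
  moreover have "closure (T0 d) \<subseteq> T3 d"
  proof
    fix f assume f: "f \<in> closure (T0 d)"
    \<comment> \<open>A countable exhaustion of the multigraphs by finite sets.\<close>
    define A where "A n = {F. nodes F \<subseteq> {..<n} \<and> (\<forall>i j. edge_mult F i j \<le> n)}" for n
    define close where "close n H \<longleftrightarrow> is_weighted_graph d H \<and> (\<forall>F\<in>A n. \<bar>t_weighted F H - f F\<bar> < 1 / real (Suc n))"
      for n H
    have "\<exists>H. close n H" for n
    proof -
      have "finite (A n)" unfolding A_def by (rule finite_bounded_multigraphs)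
      moreover have "0 < 1 / real (Suc n)" by simp
      ultimately obtain g where "g \<in> T0 d" "\<forall>F\<in>A n. \<bar>g F - f F\<bar> < 1 / real (Suc n)"
        using f unfolding closure_pointwise by blast
      then show ?thesis unfolding T0_def close_def by blast
    qed
    then obtain H where close: "\<And>n. close n (H n)" by metis
    have wg: "is_weighted_graph d (H n)" for n
      using close[of n] unfolding close_def by (rule conjunct1)
    have near: "\<bar>t_weighted F (H n) - f F\<bar> \<le> 1 / real (Suc n)" if F: "F \<in> A n" for n F
    proof -
      have "\<forall>F\<in>A n. \<bar>t_weighted F (H n) - f F\<bar> < 1 / real (Suc n)"
        using close[of n] unfolding close_def by (rule conjunct2)
      from bspec[OF this F] show ?thesis by (rule less_imp_le)
    qed
    have lim: "(\<lambda>n. t_weighted F (H n)) \<longlonglongrightarrow> f F" for F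
    proof -
      obtain n0 where n0: "\<And>n. n0 \<le> n \<Longrightarrow> F \<in> A n"
      proof (rule bounded_multigraphs_exhaust[of F])
        fix n0 assume "\<And>n. n0 \<le> n \<Longrightarrow> nodes F \<subseteq> {..<n} \<and> (\<forall>i j. edge_mult F i j \<le> n)"
        then show thesis by (intro that[of n0]) (simp add: A_def)
      qed
      have "(\<lambda>n. t_weighted F (H n) - f F) \<longlonglongrightarrow> 0"
      proof (rule Lim_null_comparison)
        show "\<forall>\<^sub>F n in sequentially. norm (t_weighted F (H n) - f F) \<le> 1 / real (Suc n)"
          unfolding eventually_sequentially real_norm_def by (intro exI[of _ n0] allI impI near n0)
        show "(\<lambda>n. 1 / real (Suc n)) \<longlonglongrightarrow> 0" by (rule LIMSEQ_Suc[OF lim_1_over_n])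
      qed
      then show ?thesis by (rule LIM_zero_cancel)
    qed
    show "f \<in> T3 d"
    proof (rule limit_of_weighted_graphs[of d H f, OF assms wg lim])
      fix W assume W: "is_graphon d W" and "\<And>F. t_graphon F W = f F"
      then have "f = (\<lambda>F. t_graphon F W)" by (simp add: fun_eq_iff)
      with W show "f \<in> T3 d" unfolding T3_def by blast
    qed
  qed
  ultimately show ?thesis by blast
qed

end
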